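(* Let $\Omega=(0,1)$, $\lambda>0$, let $a\in C(\mathbb{R}^+,[m,M])$ for some $m,M\in(0,\infty)$, let $l:H^1_0(\Omega)\to\mathbb{R}^+$ be continuous, let $h:\mathbb{R}\to\mathbb{R}$ be continuous and bounded, and let $f:\mathbb{R}\to\mathbb{R}$ be a continuous function such that for every $r>0$ there exists $\gamma=\gamma(r)>0$ for which $s\mapsto\gamma s+\lambda f(s)$ is increasing in $(-r,r)$. Suppose there exist $C_0,C_1\in\mathbb{R}$ such that $$uf(u)\le-\nu C_0u^2+|u|C_1$$ for all $u\in\mathbb{R}$ and for both $\nu=\frac m\lambda$ and $\nu=\frac M\lambda$. Then, for every $\sigma\in\mathbb{R}$ and $w_0\in H^1_0(\Omega)$, the solutions of $$\frac{\partial w}{\partial\tau}-a(l(w))\frac{\partial^2w}{\partial x^2}=\lambda f(w)+h(\tau),\ \tau>\sigma,\ x\in\Omega,\qquad w(\tau,0)=w(\tau,1)=0,\qquad w(\sigma,x)=w_0(x),$$ are globally defined, i.e. defined for all $\tau\ge\sigma$.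
   Context: Solutions of the quasilinear nonlocal problem are understood through the following time reparametrization. Let $u$ be a mild solution (continuous with values in $H^1_0(0,1)$, satisfying the variation of constants formula with the heat semigroup on $L^2(0,1)$ with Dirichlet boundary conditions) of $$u_t=u_{xx}+\frac{\lambda f(u)+h(\alpha(t))}{a(l(u))},\ t>\sigma,\qquad u(t,0)=u(t,1)=0,\qquad u(\sigma)=w_0,\qquad \alpha(t)=\sigma+\int_\sigma^ta(l(u(r)))\,dr .$$ Then $w(\tau)=u(t)$ with $\tau=\alpha(t)$ is a solution of the quasilinear problem; conversely, $u$ is recovered from $w$ via $t=\alpha^{-1}(\tau)=\sigma+\int_\sigma^\tau a(l(w(r)))^{-1}\,dr$. Solutions are considered on their maximal intervals of existence and need not be unique. *)

theory Defs
  imports "HOL-Analysis.Analysis"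
begin

section \<open>The Hilbert space \<open>L\<^sup>2(0,1)\<close>\<close>

abbreviation leb01 :: "real measure" where
  "leb01 \<equiv> lebesgue_on {0<..<1}"

definition sq_integrable :: "(real \<Rightarrow> real) \<Rightarrow> bool" where
  "sq_integrable v \<longleftrightarrow> v \<in> borel_measurable leb01 \<and> integrable leb01 (\<lambda>x. (v x)\<^sup>2)"

lemma sq_integrable_measurable: "sq_integrable v \<Longrightarrow> v \<in> borel_measurable leb01"
  by (simp add: sq_integrable_def)

lemma sq_integrable_mult:
  assumes "sq_integrable u" "sq_integrable v"
  shows "integrable leb01 (\<lambda>x. u x * v x)"
proof (rule Bochner_Integration.integrable_bound)
  show "integrable leb01 (\<lambda>x. (u x)\<^sup>2 + (v x)\<^sup>2)"
    using assms by (simp add: sq_integrable_def)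
  show "(\<lambda>x. u x * v x) \<in> borel_measurable leb01"
    using assms[THEN sq_integrable_measurable] by measurable
  have "\<bar>a * b\<bar> \<le> a\<^sup>2 + b\<^sup>2" for a b :: real
  proof -
    have "2 * (\<bar>a\<bar> * \<bar>b\<bar>) \<le> a\<^sup>2 + b\<^sup>2"
      using sum_squares_bound[of "\<bar>a\<bar>" "\<bar>b\<bar>"] by simp
    moreover have "0 \<le> \<bar>a\<bar> * \<bar>b\<bar>" by simp
    ultimately show ?thesis unfolding abs_mult by linarith
  qed
  then show "AE x in leb01. norm (u x * v x) \<le> norm ((u x)\<^sup>2 + (v x)\<^sup>2)"
    by simp
qed

lemma sq_integrable_zero: "sq_integrable (\<lambda>x. 0)"
  by (simp add: sq_integrable_def)

lemma sq_integrable_add: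
  assumes "sq_integrable u" "sq_integrable v"
  shows "sq_integrable (\<lambda>x. u x + v x)"
  unfolding sq_integrable_def
proof
  show "(\<lambda>x. u x + v x) \<in> borel_measurable leb01"
    using assms[THEN sq_integrable_measurable] by measurable
  have "integrable leb01 (\<lambda>x. (u x)\<^sup>2 + (v x)\<^sup>2 + 2 * (u x * v x))"
    using assms sq_integrable_mult[OF assms] by (simp add: sq_integrable_def)
  then show "integrable leb01 (\<lambda>x. (u x + v x)\<^sup>2)"
    by (simp add: power2_sum mult.assoc)
qed

lemma sq_integrable_scale:
  assumes "sq_integrable u"
  shows "sq_integrable (\<lambda>x. c * u x)"
  using assms by (auto simp: sq_integrable_def power_mult_distrib)

lemma sq_integrable_diff:
  assumes "sq_integrable u" "sq_integrable v"
  shows "sq_integrable (\<lambda>x. u x - v x)"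
  using sq_integrable_add[OF assms(1) sq_integrable_scale[OF assms(2), of "-1"]] by simp

lemma sq_integrable_bounded:
  assumes "u \<in> borel_measurable leb01" "\<And>x. \<bar>u x\<bar> \<le> B"
  shows "sq_integrable u"
  unfolding sq_integrable_def
proof
  have "finite_measure leb01"
    by (rule finite_measureI) (simp add: emeasure_restrict_space)
  then show "integrable leb01 (\<lambda>x. (u x)\<^sup>2)"
  proof (rule finite_measure.integrable_const_bound)
    have "(u x)\<^sup>2 \<le> B\<^sup>2" for x
      using assms(2)[of x] abs_ge_zero[of "u x"] by (simp add: abs_le_square_iff[symmetric])
    then show "AE x in leb01. norm ((u x)\<^sup>2) \<le> B\<^sup>2" by simp
  qed (use assms in measurable)
qed (rule assms)

lemma sq_integrable_continuous:
  assumes "continuous_on {0..1} u"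
  shows "sq_integrable u"
proof -
  let ?u = "\<lambda>x. if x \<in> {0<..<1} then u x else 0"
  have "compact (u ` {0..1})"
    using assms by (intro compact_continuous_image) auto
  then obtain B where B: "\<And>x. x \<in> {0..1} \<Longrightarrow> \<bar>u x\<bar> \<le> B" "0 \<le> B"
    by (metis bounded_iff compact_imp_bounded imageI real_norm_def abs_ge_zero order_trans
        atLeastAtMost_iff order_refl zero_le_one)
  have um: "u \<in> borel_measurable leb01"
    by (rule continuous_imp_measurable_on_sets_lebesgue)
       (auto intro: continuous_on_subset[OF assms])
  then have "?u \<in> borel_measurable leb01"
    by (rule measurable_cong[THEN iffD1, rotated]) simp
  then have "sq_integrable ?u"
    by (rule sq_integrable_bounded[where B = B]) (use B in auto)
  moreover have "integrable leb01 (\<lambda>x. (?u x)\<^sup>2) \<longleftrightarrow> integrable leb01 (\<lambda>x. (u x)\<^sup>2)"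
    by (rule Bochner_Integration.integrable_cong) auto
  ultimately show ?thesis
    using um by (simp add: sq_integrable_def)
qed

definition l2_rel :: "(real \<Rightarrow> real) \<Rightarrow> (real \<Rightarrow> real) \<Rightarrow> bool" where
  "l2_rel u v \<longleftrightarrow> sq_integrable u \<and> sq_integrable v \<and> (AE x in leb01. u x = v x)"

quotient_type l2 = "real \<Rightarrow> real" / partial: l2_rel
proof (rule part_equivpI)
  show "\<exists>x. l2_rel x x"
    using sq_integrable_zero by (auto simp: l2_rel_def)
  show "symp l2_rel"
    by (auto simp: symp_def l2_rel_def elim: AE_mp)
  show "transp l2_rel"
  proof (rule transpI)
    fix u v w assume uv: "l2_rel u v" and vw: "l2_rel v w"
    then have "AE x in leb01. u x = v x" "AE x in leb01. v x = w x"
      by (auto simp: l2_rel_def)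
    then have "AE x in leb01. u x = w x"
      by eventually_elim simp
    with uv vw show "l2_rel u w" by (simp add: l2_rel_def)
  qed
qed

instantiation l2 :: real_vector
begin

lift_definition zero_l2 :: l2 is "\<lambda>x. 0"
  by (simp add: l2_rel_def sq_integrable_zero)

lift_definition plus_l2 :: "l2 \<Rightarrow> l2 \<Rightarrow> l2" is "\<lambda>u v x. u x + v x"
  by (auto simp: l2_rel_def sq_integrable_add elim: AE_mp)

lift_definition minus_l2 :: "l2 \<Rightarrow> l2 \<Rightarrow> l2" is "\<lambda>u v x. u x - v x"
  by (auto simp: l2_rel_def sq_integrable_diff elim: AE_mp)

lift_definition uminus_l2 :: "l2 \<Rightarrow> l2" is "\<lambda>u x. - u x"
  using sq_integrable_scale[where c = "-1"] by (auto simp: l2_rel_def elim: AE_mp)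

lift_definition scaleR_l2 :: "real \<Rightarrow> l2 \<Rightarrow> l2" is "\<lambda>c u x. c * u x"
  by (auto simp: l2_rel_def sq_integrable_scale elim: AE_mp)

instance
proof
  fix u v w :: l2 and a b :: real
  show "u + v + w = u + (v + w)"
    by transfer (auto simp: l2_rel_def sq_integrable_add add.assoc)
  show "u + v = v + u"
    by transfer (auto simp: l2_rel_def sq_integrable_add add.commute)
  show "0 + u = u"
    by transfer (auto simp: l2_rel_def)
  show "- u + u = 0"
    by transfer (auto simp: l2_rel_def sq_integrable_zero)
  show "u - v = u + - v"
    by transfer (auto simp: l2_rel_def sq_integrable_diff)
  show "a *\<^sub>R (u + v) = a *\<^sub>R u + a *\<^sub>R v"
    by transfer (simp add: l2_rel_def sq_integrable_add sq_integrable_scale distrib_left)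
  show "(a + b) *\<^sub>R u = a *\<^sub>R u + b *\<^sub>R u"
    by transfer (simp add: l2_rel_def sq_integrable_add sq_integrable_scale distrib_right)
  show "a *\<^sub>R b *\<^sub>R u = (a * b) *\<^sub>R u"
    by transfer (simp add: l2_rel_def sq_integrable_scale mult.assoc)
  show "1 *\<^sub>R u = u"
    by transfer (simp add: l2_rel_def)
qed

end

instantiation l2 :: real_inner
begin

lift_definition inner_l2 :: "l2 \<Rightarrow> l2 \<Rightarrow> real" is "\<lambda>u v. \<integral>x. u x * v x \<partial>leb01"
proof -
  fix u u' v v' assume *: "l2_rel u u'" "l2_rel v v'"
  show "(\<integral>x. u x * v x \<partial>leb01) = (\<integral>x. u' x * v' x \<partial>leb01)"
  proof (rule integral_cong_AE)
    show "(\<lambda>x. u x * v x) \<in> borel_measurable leb01" "(\<lambda>x. u' x * v' x) \<in> borel_measurable leb01"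
      using * by (auto simp: l2_rel_def intro: borel_measurable_times sq_integrable_measurable)
    have "AE x in leb01. u x = u' x" "AE x in leb01. v x = v' x"
      using * by (auto simp: l2_rel_def)
    then show "AE x in leb01. u x * v x = u' x * v' x"
      by eventually_elim simp
  qed
qed

definition norm_l2 :: "l2 \<Rightarrow> real" where "norm_l2 v = sqrt (inner v v)"
definition sgn_l2 :: "l2 \<Rightarrow> l2" where "sgn_l2 v = v /\<^sub>R norm v"
definition dist_l2 :: "l2 \<Rightarrow> l2 \<Rightarrow> real" where "dist_l2 v w = norm (v - w)"
definition uniformity_l2 :: "(l2 \<times> l2) filter" where
  "uniformity_l2 = (INF e\<in>{0<..}. principal {(x, y). dist x y < e})"
definition open_l2 :: "l2 set \<Rightarrow> bool" where
  "open_l2 S = (\<forall>x\<in>S. \<forall>\<^sub>F (x', y) in uniformity. x' = x \<longrightarrow> y \<in> S)"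

instance
proof
  fix u v w :: l2 and a :: real
  show "inner u v = inner v u"
    by transfer (simp add: mult.commute)
  show "inner (u + v) w = inner u w + inner v w"
    by transfer (simp add: l2_rel_def distrib_right sq_integrable_mult)
  show "inner (a *\<^sub>R u) v = a * inner u v"
    by transfer (simp add: mult.assoc)
  show "0 \<le> inner u u"
    by transfer simp
  show "inner u u = 0 \<longleftrightarrow> u = 0"
  proof transfer
    fix u assume u: "l2_rel u u"
    then have "(\<integral>x. u x * u x \<partial>leb01) = 0 \<longleftrightarrow> (AE x in leb01. u x * u x = 0)"
      by (intro integral_nonneg_eq_0_iff_AE) (auto simp: l2_rel_def sq_integrable_mult)
    then show "(\<integral>x. u x * u x \<partial>leb01) = 0 \<longleftrightarrow> l2_rel u (\<lambda>x. 0)"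
      using u by (simp add: l2_rel_def sq_integrable_zero)
  qed
qed (rule norm_l2_def sgn_l2_def dist_l2_def uniformity_l2_def open_l2_def)+

end

definition to_l2 :: "(real \<Rightarrow> real) \<Rightarrow> l2" where
  "to_l2 v = abs_l2 v"


section \<open>The Sobolev space \<open>H\<^sup>1\<^sub>0(0,1)\<close>\<close>

text \<open>\<open>\<phi>\<close> belongs to \<open>C\<^sup>1\<^sub>c(0,1)\<close> and \<open>\<phi>'\<close> is its derivative.\<close>

definition test_function :: "(real \<Rightarrow> real) \<Rightarrow> (real \<Rightarrow> real) \<Rightarrow> bool" where
  "test_function \<phi> \<phi>' \<longleftrightarrow>
     (\<forall>x. (\<phi> has_real_derivative \<phi>' x) (at x)) \<and> continuous_on UNIV \<phi>' \<and>
     (\<exists>a b. 0 < a \<and> b < 1 \<and> (\<forall>x. x \<notin> {a..b} \<longrightarrow> \<phi> x = 0))"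

definition weak_derivative :: "(real \<Rightarrow> real) \<Rightarrow> (real \<Rightarrow> real) \<Rightarrow> bool" where
  "weak_derivative u g \<longleftrightarrow>
     (\<forall>\<phi> \<phi>'. test_function \<phi> \<phi>' \<longrightarrow>
        (\<integral>x. u x * \<phi>' x \<partial>leb01) = - (\<integral>x. g x * \<phi> x \<partial>leb01))"

lemma test_function_continuous: "test_function \<phi> \<phi>' \<Longrightarrow> continuous_on S \<phi>"
  unfolding test_function_def by (blast intro: continuous_at_imp_continuous_on DERIV_isCont)

lemma test_function_sq_integrable:
  assumes "test_function \<phi> \<phi>'"
  shows "sq_integrable \<phi>" "sq_integrable \<phi>'"
proof -
  show "sq_integrable \<phi>"
    by (intro sq_integrable_continuous test_function_continuous[OF assms])
  show "sq_integrable \<phi>'"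
    using assms by (intro sq_integrable_continuous) (auto simp: test_function_def intro: continuous_on_subset)
qed

lemma weak_derivative_add:
  assumes "sq_integrable u" "sq_integrable v" "sq_integrable g" "sq_integrable k"
    and "weak_derivative u g" "weak_derivative v k"
  shows "weak_derivative (\<lambda>x. u x + v x) (\<lambda>x. g x + k x)"
  unfolding weak_derivative_def
proof (intro allI impI)
  fix \<phi> \<phi>' assume t: "test_function \<phi> \<phi>'"
  note s = test_function_sq_integrable[OF t]
  show "(\<integral>x. (u x + v x) * \<phi>' x \<partial>leb01) = - (\<integral>x. (g x + k x) * \<phi> x \<partial>leb01)"
    using assms t by (simp add: distrib_right sq_integrable_mult s weak_derivative_def)
qed

lemma weak_derivative_scale:
  assumes "weak_derivative u g"
  shows "weak_derivative (\<lambda>x. c * u x) (\<lambda>x. c * g x)"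
  using assms by (simp add: weak_derivative_def mult.assoc)

lemma sq_max_deriv: "((\<lambda>t::real. (max 0 t)\<^sup>2) has_real_derivative 2 * max 0 t) (at t)"
proof (cases "t = 0")
  case False
  then consider "t < 0" | "0 < t" by linarith
  then show ?thesis
  proof cases
    case 1
    have "((\<lambda>t::real. 0) has_real_derivative 0) (at t)" by simp
    moreover have "\<forall>\<^sub>F x in nhds t. (max 0 x)\<^sup>2 = 0"
    proof (rule eventually_mono)
      show "\<forall>\<^sub>F x in nhds t. x \<in> {..<0}"
        using 1 by (intro eventually_nhds_in_open) auto
    qed auto
    ultimately show ?thesis
      using 1 by (subst DERIV_cong_ev[OF refl _ refl, where g = "\<lambda>t. 0"]) auto
  next
    case 2
    have "((\<lambda>t::real. t\<^sup>2) has_real_derivative 2 * t) (at t)"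
      by (auto intro!: derivative_eq_intros)
    moreover have "\<forall>\<^sub>F x in nhds t. (max 0 x)\<^sup>2 = x\<^sup>2"
    proof (rule eventually_mono)
      show "\<forall>\<^sub>F x in nhds t. x \<in> {0<..}"
        using 2 by (intro eventually_nhds_in_open) auto
    qed auto
    ultimately show ?thesis
      using 2 by (subst DERIV_cong_ev[OF refl _ refl, where g = "\<lambda>t. t\<^sup>2"]) auto
  qed
next
  case True
  have "((\<lambda>h::real. (max 0 (0 + h))\<^sup>2 / h) \<longlongrightarrow> 0) (at 0)"
  proof (rule Lim_null_comparison)
    show "\<forall>\<^sub>F h in at (0::real). norm ((max 0 (0 + h))\<^sup>2 / h) \<le> \<bar>h\<bar>"
      by (rule always_eventually) (auto simp: max_def power2_eq_square)
    show "((\<lambda>h::real. \<bar>h\<bar>) \<longlongrightarrow> 0) (at 0)"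
      by (rule tendsto_rabs_zero[OF tendsto_ident_at])
  qed
  then show ?thesis
    using True by (simp add: DERIV_def)
qed

lemma test_function_cutoff:
  fixes a b c :: real
  assumes "0 < a" "a \<le> b" "b < 1" "0 \<le> c"
  shows "\<exists>\<phi>'. test_function (\<lambda>x. 1 - 1 / (1 + c * (max 0 ((x - a) * (b - x)))\<^sup>2)) \<phi>'"
proof -
  let ?q = "\<lambda>x::real. (x - a) * (b - x)"
  let ?p = "\<lambda>x. (max 0 (?q x))\<^sup>2"
  let ?p' = "\<lambda>x. 2 * max 0 (?q x) * (a + b - 2 * x)"
  have "(?q has_real_derivative (a + b - 2 * x)) (at x)" for x
    by (auto intro!: derivative_eq_intros simp: algebra_simps)
  then have p: "(?p has_real_derivative ?p' x) (at x)" for x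
    using DERIV_chain2[OF sq_max_deriv] by fast
  have pos: "0 < 1 + c * ?p x" for x
    using assms by (intro add_pos_nonneg) auto
  have "?q x < 0" if "x \<notin> {a..b}" for x
    using that assms by (cases "x < a") (auto simp: mult_neg_pos mult_pos_neg)
  then have q0: "max 0 (?q x) = 0" if "x \<notin> {a..b}" for x
    using that by (fastforce simp: max_def)
  have "test_function (\<lambda>x. 1 - 1 / (1 + c * ?p x)) (\<lambda>x. c * ?p' x / (1 + c * ?p x)\<^sup>2)"
    unfolding test_function_def
  proof (intro conjI allI)
    show "((\<lambda>x. 1 - 1 / (1 + c * ?p x)) has_real_derivative (c * ?p' x / (1 + c * ?p x)\<^sup>2)) (at x)" for x
    proof -
      have "((\<lambda>x. 1 + c * ?p x) has_real_derivative (c * ?p' x)) (at x)"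
        using DERIV_add[OF DERIV_const DERIV_cmult[OF p]] by simp
      from DERIV_diff[OF DERIV_const DERIV_inverse_fun[OF this]] pos[of x]
      show ?thesis by (simp add: divide_inverse power2_eq_square mult.commute)
    qed
    have "1 + c * ?p x \<noteq> 0" for x
      using pos[of x] by linarith
    then show "continuous_on UNIV (\<lambda>x. c * ?p' x / (1 + c * ?p x)\<^sup>2)"
      by (intro continuous_intros) auto
    have "1 - 1 / (1 + c * ?p x) = 0" if "x \<notin> {a..b}" for x
      using q0[OF that] by simp
    then show "\<exists>a b. 0 < a \<and> b < 1 \<and> (\<forall>x. x \<notin> {a..b} \<longrightarrow> 1 - 1 / (1 + c * ?p x) = 0)"
      using assms by blast
  qed
  then show ?thesis by blast
qed

lemma sq_integrable_integrable:
  assumes "sq_integrable g"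
  shows "integrable leb01 g"
  using sq_integrable_mult[OF assms sq_integrable_continuous[of "\<lambda>x. 1"]] by simp

lemma borel_ae_zero:
  fixes g :: "real \<Rightarrow> real"
  assumes g: "integrable lborel g"
    and z: "\<And>y. (\<integral>x. g x * indicator {y<..} x \<partial>lborel) = 0"
  shows "AE x in lborel. g x = 0"
proof -
  have [measurable]: "g \<in> borel_measurable borel" using g by auto
  have p: "integrable lborel (\<lambda>x. max 0 (g x) * indicator {y<..} x)" for y
    by (rule Bochner_Integration.integrable_bound[OF g]) (auto simp: indicator_def)
  have n: "integrable lborel (\<lambda>x. max 0 (- g x) * indicator {y<..} x)" for y
    by (rule Bochner_Integration.integrable_bound[OF g]) (auto simp: indicator_def)
  have dp: "emeasure (density lborel (\<lambda>x. ennreal (max 0 (g x)))) {y<..} =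
      ennreal (\<integral>x. max 0 (g x) * indicator {y<..} x \<partial>lborel)" for y
    by (subst nn_integral_eq_integral[OF p, symmetric])
       (auto simp: emeasure_density indicator_def intro!: nn_integral_cong)
  have dn: "emeasure (density lborel (\<lambda>x. ennreal (max 0 (- g x)))) {y<..} =
      ennreal (\<integral>x. max 0 (- g x) * indicator {y<..} x \<partial>lborel)" for y
    by (subst nn_integral_eq_integral[OF n, symmetric])
       (auto simp: emeasure_density indicator_def intro!: nn_integral_cong)
  have eq: "(\<integral>x. max 0 (g x) * indicator {y<..} x \<partial>lborel) =
      (\<integral>x. max 0 (- g x) * indicator {y<..} x \<partial>lborel)" for y
  proof -
    have "(\<integral>x. max 0 (g x) * indicator {y<..} x \<partial>lborel) -
      (\<integral>x. max 0 (- g x) * indicator {y<..} x \<partial>lborel) =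
      (\<integral>x. max 0 (g x) * indicator {y<..} x - max 0 (- g x) * indicator {y<..} x \<partial>lborel)"
      using p n by simp
    also have "\<dots> = (\<integral>x. g x * indicator {y<..} x \<partial>lborel)"
      by (rule Bochner_Integration.integral_cong) (auto simp: indicator_def)
    finally show ?thesis using z[of y] by simp
  qed
  have "density lborel (\<lambda>x. ennreal (max 0 (g x))) = density lborel (\<lambda>x. ennreal (max 0 (- g x)))"
    by (rule measure_eqI_lessThan) (simp_all add: dp dn eq)
  then have "AE x in lborel. ennreal (max 0 (g x)) = ennreal (max 0 (- g x))"
    by (intro sigma_finite_measure.density_unique[OF sigma_finite_lborel]) auto
  then show ?thesis
    by eventually_elim (auto simp: max_def split: if_splits)
qed

lemma test_function_separation:
  assumes g: "sq_integrable g"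
    and z: "\<And>\<phi> \<phi>'. test_function \<phi> \<phi>' \<Longrightarrow> (\<integral>x. g x * \<phi> x \<partial>leb01) = 0"
  shows "AE x in leb01. g x = 0"
proof -
  note gi = sq_integrable_integrable[OF g]
  have tail: "(\<integral>x. g x * indicator {y<..} x \<partial>leb01) = 0" if y: "0 \<le> y" "y < 1" for y
  proof -
    define e where "e n = (1 - y) / (real n + 3)" for n
    define a where "a n = y + e n" for n
    define b where "b n = 1 - e n" for n
    define \<phi> where "\<phi> n x = 1 - 1 / (1 + real n * (max 0 ((x - a n) * (b n - x)))\<^sup>2)" for n x
    have d: "0 < e n" "e n \<le> (1 - y) / 2" for n
    proof -
      show "0 < e n" using y unfolding e_def by (intro divide_pos_pos) auto
      show "e n \<le> (1 - y) / 2" using y unfolding e_def by (intro divide_left_mono) auto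
    qed
    have ab: "0 < a n" "y < a n" "a n \<le> b n" "b n < 1" for n
      using d(1)[of n] d(2)[of n] y by (simp_all add: a_def b_def field_simps)
    have "e \<longlonglongrightarrow> 0"
      using LIMSEQ_ignore_initial_segment[OF lim_const_over_n[of "1 - y"], of 3]
      by (simp add: e_def[abs_def])
    then have alim: "a \<longlonglongrightarrow> y" and blim: "b \<longlonglongrightarrow> 1"
      unfolding a_def b_def by (auto intro!: tendsto_eq_intros)
    have "\<exists>\<phi>'. test_function (\<phi> n) \<phi>'" for n
      unfolding \<phi>_def[abs_def] using ab[of n] by (intro test_function_cutoff) auto
    then obtain \<phi>' where t: "test_function (\<phi> n) (\<phi>' n)" for n
      by metis
    have "(\<lambda>n. \<integral>x. g x * \<phi> n x \<partial>leb01) \<longlonglongrightarrow> (\<integral>x. g x * indicator {y<..} x \<partial>leb01)"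
    proof (rule integral_dominated_convergence[where w = "\<lambda>x. \<bar>g x\<bar>"])
      show "(\<lambda>x. g x * indicator {y<..} x) \<in> borel_measurable leb01"
        using sq_integrable_measurable[OF g]
        by (rule borel_measurable_times[OF _ measurable_restrict_space1[OF borel_measurable_indicator]]) simp
      show "(\<lambda>x. g x * \<phi> n x) \<in> borel_measurable leb01" for n
        using sq_integrable_measurable[OF g] sq_integrable_measurable[OF test_function_sq_integrable(1)[OF t]]
        by (rule borel_measurable_times)
      show "integrable leb01 (\<lambda>x. \<bar>g x\<bar>)" using gi by simp
      have "\<bar>1 - 1 / (1 + d)\<bar> \<le> 1" if "0 \<le> d" for d :: real
        using that by (simp add: abs_le_iff divide_le_eq)
      then have "\<bar>\<phi> n x\<bar> \<le> 1" for n x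
        unfolding \<phi>_def by (meson mult_nonneg_nonneg of_nat_0_le_iff zero_le_power2)
      then show "AE x in leb01. norm (g x * \<phi> n x) \<le> \<bar>g x\<bar>" for n
        by (auto simp: abs_mult mult_left_le)
      have "(\<lambda>n. g x * \<phi> n x) \<longlonglongrightarrow> g x * indicator {y<..} x" if x: "x \<in> {0<..<1}" for x
      proof (cases "y < x")
        case True
        have l: "(\<lambda>n. (max 0 ((x - a n) * (b n - x)))\<^sup>2) \<longlonglongrightarrow> (max 0 ((x - y) * (1 - x)))\<^sup>2"
          by (intro tendsto_intros alim blim)
        have p: "0 < (max 0 ((x - y) * (1 - x)))\<^sup>2"
          using True x by simp
        have "filterlim (\<lambda>n. real n * (max 0 ((x - a n) * (b n - x)))\<^sup>2) at_top sequentially"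
          using filterlim_tendsto_pos_mult_at_top[OF l p filterlim_real_sequentially]
          by (simp add: mult.commute)
        then have "filterlim (\<lambda>n. 1 + real n * (max 0 ((x - a n) * (b n - x)))\<^sup>2) at_top sequentially"
          by (rule filterlim_tendsto_add_at_top[OF tendsto_const])
        then have "(\<lambda>n. 1 / (1 + real n * (max 0 ((x - a n) * (b n - x)))\<^sup>2)) \<longlonglongrightarrow> 0"
          by (rule tendsto_divide_0[OF tendsto_const filterlim_at_top_imp_at_infinity])
        then have "(\<lambda>n. \<phi> n x) \<longlonglongrightarrow> 1 - 0"
          unfolding \<phi>_def by (intro tendsto_intros)
        then show ?thesis using True by (auto intro!: tendsto_eq_intros)
      next
        case False
        have "(x - a n) * (b n - x) \<le> 0" for n
          using False ab[of n] by (intro mult_nonpos_nonneg) auto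
        then have "\<phi> n x = 0" for n by (simp add: \<phi>_def max_absorb1)
        then show ?thesis using False by simp
      qed
      then show "AE x in leb01. (\<lambda>n. g x * \<phi> n x) \<longlonglongrightarrow> g x * indicator {y<..} x"
        by (intro AE_I2) (simp add: space_restrict_space)
    qed
    moreover have "(\<integral>x. g x * \<phi> n x \<partial>leb01) = 0" for n
      using z[OF t] .
    ultimately show ?thesis
      by (simp add: LIMSEQ_const_iff)
  qed
  have tail': "(\<integral>x. g x * indicator {y<..} x \<partial>leb01) = 0" for y
  proof -
    consider "y < 0" | "0 \<le> y" "y < 1" | "1 \<le> y" by linarith
    then show ?thesis
    proof cases
      case 1
      have "(\<integral>x. g x * indicator {y<..} x \<partial>leb01) = (\<integral>x. g x * indicator {0<..} x \<partial>leb01)"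
        using 1 by (intro Bochner_Integration.integral_cong) (auto simp: indicator_def space_restrict_space)
      then show ?thesis using tail[of 0] by simp
    next
      case 2 then show ?thesis by (rule tail)
    next
      case 3
      have "(\<integral>x. g x * indicator {y<..} x \<partial>leb01) = (\<integral>x. 0 \<partial>leb01)"
        using 3 by (intro Bochner_Integration.integral_cong) (auto simp: indicator_def space_restrict_space)
      then show ?thesis by simp
    qed
  qed
  let ?G = "\<lambda>x. indicator {0<..<1} x *\<^sub>R g x"
  have S: "{0<..<1::real} \<inter> space lebesgue \<in> sets lebesgue" by simp
  have Gi: "integrable lebesgue ?G"
    using gi integrable_restrict_space[OF S, of g] by (simp add: set_integrable_def)
  then obtain k where k: "k \<in> borel_measurable lborel" and ae: "AE x in lborel. ?G x = k x"
    using completion_ex_borel_measurable_real[of ?G lborel] by auto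
  have ae': "AE x in lebesgue. ?G x = k x"
    using ae by (rule AE_completion)
  have km: "k \<in> borel_measurable lebesgue"
    using k by (rule measurable_completion)
  have ki: "integrable lborel k"
    using Gi integrable_cong_AE[THEN iffD1, OF _ km ae'] integrable_completion[OF k]
    by (auto dest: borel_measurable_integrable)
  have "AE x in lborel. k x = 0"
  proof (rule borel_ae_zero[OF ki])
    fix y :: real
    have km2: "(\<lambda>x. k x * indicator {y<..} x) \<in> borel_measurable lborel"
      using k by (intro borel_measurable_times borel_measurable_indicator) auto
    have "(\<integral>x. k x * indicator {y<..} x \<partial>lborel) = (\<integral>x. k x * indicator {y<..} x \<partial>lebesgue)"
      using integral_completion[OF km2] by simp
    also have "\<dots> = (\<integral>x. indicator {0<..<1} x *\<^sub>R (g x * indicator {y<..} x) \<partial>lebesgue)"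
    proof (rule integral_cong_AE)
      show "(\<lambda>x. k x * indicator {y<..} x) \<in> borel_measurable lebesgue"
        using km2 by (rule measurable_completion)
      have "(\<lambda>x. ?G x * indicator {y<..} x) \<in> borel_measurable lebesgue"
        using Gi by (intro borel_measurable_times borel_measurable_indicator borel_measurable_integrable) auto
      then show "(\<lambda>x. indicator {0<..<1} x *\<^sub>R (g x * indicator {y<..} x)) \<in> borel_measurable lebesgue"
        by (simp add: mult.assoc)
      show "AE x in lebesgue. k x * indicator {y<..} x = indicator {0<..<1} x *\<^sub>R (g x * indicator {y<..} x)"
        using ae' by eventually_elim (auto simp: indicator_def split: if_splits)
    qed
    also have "\<dots> = (\<integral>x. g x * indicator {y<..} x \<partial>leb01)"
      using integral_restrict_space[OF S, of "\<lambda>x. g x * indicator {y<..} x"] by simp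
    finally show "(\<integral>x. k x * indicator {y<..} x \<partial>lborel) = 0"
      using tail'[of y] by simp
  qed
  then have "AE x in lebesgue. k x = 0"
    by (rule AE_completion)
  with ae' have "AE x in lebesgue. ?G x = 0"
    by eventually_elim simp
  then show ?thesis
    by (subst AE_restrict_space_iff) (auto elim: AE_mp)
qed

lemma weak_derivative_unique:
  assumes "sq_integrable g" "sq_integrable k" "weak_derivative u g" "weak_derivative u k"
  shows "AE x in leb01. g x = k x"
proof -
  have "AE x in leb01. g x - k x = 0"
  proof (rule test_function_separation)
    show "sq_integrable (\<lambda>x. g x - k x)" using assms by (simp add: sq_integrable_diff)
    fix \<phi> \<phi>' assume t: "test_function \<phi> \<phi>'"
    note s = test_function_sq_integrable[OF t]
    show "(\<integral>x. (g x - k x) * \<phi> x \<partial>leb01) = 0"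
    proof -
      have "(\<integral>x. g x * \<phi> x \<partial>leb01) = (\<integral>x. k x * \<phi> x \<partial>leb01)"
        using assms(3,4)[unfolded weak_derivative_def, rule_format, OF t] by simp
      then show ?thesis
        by (simp add: left_diff_distrib sq_integrable_mult[OF assms(1) s(1)]
          sq_integrable_mult[OF assms(2) s(1)])
    qed
  qed
  then show ?thesis by simp
qed

text \<open>In one dimension every element of \<open>H\<^sup>1(0,1)\<close> has a unique representative that is continuous
  on \<open>[0,1]\<close>, and it lies in \<open>H\<^sup>1\<^sub>0(0,1)\<close> iff that representative vanishes at \<open>0\<close> and \<open>1\<close>.
  The elements below are these representatives, extended by zero to the whole line.\<close>

typedef h10 =
  "{u :: real \<Rightarrow> real. continuous_on UNIV u \<and> (\<forall>x. x \<notin> {0<..<1} \<longrightarrow> u x = 0) \<and>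
     (\<exists>g. sq_integrable g \<and> weak_derivative u g)}"
  morphisms fun_of h10_of
proof (rule exI, rule CollectI, intro conjI)
  show "continuous_on UNIV (\<lambda>x::real. 0::real)"
    by simp
  show "\<exists>g. sq_integrable g \<and> weak_derivative (\<lambda>x. 0) g"
    by (rule exI[of _ "\<lambda>x. 0"]) (simp add: sq_integrable_zero weak_derivative_def)
qed simp

setup_lifting type_definition_h10

lemma fun_of_continuous: "continuous_on S (fun_of u)"
  using fun_of[of u] by (auto intro: continuous_on_subset)

lemma fun_of_outside: "x \<notin> {0<..<1} \<Longrightarrow> fun_of u x = 0"
  using fun_of[of u] by blast

lemma fun_of_sq_integrable: "sq_integrable (fun_of u)"
  by (rule sq_integrable_continuous[OF fun_of_continuous])

definition h10_to_l2 :: "h10 \<Rightarrow> l2" where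
  "h10_to_l2 u = to_l2 (fun_of u)"

definition h10_deriv :: "h10 \<Rightarrow> l2" where
  "h10_deriv u = to_l2 (SOME g. sq_integrable g \<and> weak_derivative (fun_of u) g)"

lemma to_l2_eq_iff:
  assumes "sq_integrable u" "sq_integrable v"
  shows "to_l2 u = to_l2 v \<longleftrightarrow> (AE x in leb01. u x = v x)"
  using Quotient3_rel[OF Quotient3_l2, of u v] assms by (auto simp: to_l2_def l2_rel_def)

lemma l2_rel_self: "sq_integrable u \<Longrightarrow> l2_rel u u"
  by (simp add: l2_rel_def)

lemma to_l2_zero: "to_l2 (\<lambda>x. 0) = 0"
  by (simp add: to_l2_def zero_l2_def)

lemma to_l2_add:
  "sq_integrable u \<Longrightarrow> sq_integrable v \<Longrightarrow> to_l2 (\<lambda>x. u x + v x) = to_l2 u + to_l2 v"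
  by (simp add: to_l2_def plus_l2.abs_eq l2_rel_self)

lemma to_l2_scale: "sq_integrable u \<Longrightarrow> to_l2 (\<lambda>x. c * u x) = c *\<^sub>R to_l2 u"
  by (simp add: to_l2_def scaleR_l2.abs_eq l2_rel_self)

lemma h10_deriv_eqI:
  assumes g: "sq_integrable g" "weak_derivative (fun_of u) g"
  shows "h10_deriv u = to_l2 g"
proof -
  let ?k = "SOME g. sq_integrable g \<and> weak_derivative (fun_of u) g"
  have "sq_integrable ?k \<and> weak_derivative (fun_of u) ?k"
    by (rule someI[of _ g]) (use g in blast)
  then show ?thesis
    using g weak_derivative_unique unfolding h10_deriv_def
    by (subst to_l2_eq_iff) blast+
qed

lemma h10_derivE:
  obtains g where "sq_integrable g" "weak_derivative (fun_of u) g" "h10_deriv u = to_l2 g"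
  using fun_of[of u] h10_deriv_eqI by blast

instantiation h10 :: real_vector
begin

lift_definition zero_h10 :: h10 is "\<lambda>x. 0"
  by (auto simp: weak_derivative_def intro!: exI[of _ "\<lambda>x. 0"] sq_integrable_zero)

lift_definition plus_h10 :: "h10 \<Rightarrow> h10 \<Rightarrow> h10" is "\<lambda>u v x. u x + v x"
proof (intro conjI)
  fix u v :: "real \<Rightarrow> real"
  assume u: "continuous_on UNIV u \<and> (\<forall>x. x \<notin> {0<..<1} \<longrightarrow> u x = 0) \<and>
      (\<exists>g. sq_integrable g \<and> weak_derivative u g)"
    and v: "continuous_on UNIV v \<and> (\<forall>x. x \<notin> {0<..<1} \<longrightarrow> v x = 0) \<and>
      (\<exists>g. sq_integrable g \<and> weak_derivative v g)"
  then obtain g k where gk: "sq_integrable g" "weak_derivative u g"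
      "sq_integrable k" "weak_derivative v k"
    by blast
  have "sq_integrable u" "sq_integrable v"
    using u v by (auto intro!: sq_integrable_continuous intro: continuous_on_subset)
  then have "weak_derivative (\<lambda>x. u x + v x) (\<lambda>x. g x + k x)"
    using gk by (intro weak_derivative_add)
  then show "\<exists>g. sq_integrable g \<and> weak_derivative (\<lambda>x. u x + v x) g"
    using gk sq_integrable_add by blast
  show "continuous_on UNIV (\<lambda>x. u x + v x)"
    using u v by (intro continuous_intros) auto
  show "\<forall>x. x \<notin> {0<..<1} \<longrightarrow> u x + v x = 0"
    using u v by simp
qed

lift_definition scaleR_h10 :: "real \<Rightarrow> h10 \<Rightarrow> h10" is "\<lambda>c u x. c * u x"
proof (intro conjI)
  fix c :: real and u :: "real \<Rightarrow> real"
  assume u: "continuous_on UNIV u \<and> (\<forall>x. x \<notin> {0<..<1} \<longrightarrow> u x = 0) \<and>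
      (\<exists>g. sq_integrable g \<and> weak_derivative u g)"
  show "\<exists>g. sq_integrable g \<and> weak_derivative (\<lambda>x. c * u x) g"
    using u sq_integrable_scale weak_derivative_scale by blast
  show "continuous_on UNIV (\<lambda>x. c * u x)"
    using u by (intro continuous_intros) auto
  show "\<forall>x. x \<notin> {0<..<1} \<longrightarrow> c * u x = 0"
    using u by simp
qed

definition uminus_h10 :: "h10 \<Rightarrow> h10" where "uminus_h10 u = (-1) *\<^sub>R u"
definition minus_h10 :: "h10 \<Rightarrow> h10 \<Rightarrow> h10" where "minus_h10 u v = u + (-1) *\<^sub>R v"

instance
proof
  fix u v w :: h10 and a b :: real
  show "u + v + w = u + (v + w)" by transfer (simp add: add.assoc)
  show "u + v = v + u" by transfer (simp add: add.commute)
  show "0 + u = u" by transfer simp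
  show "- u + u = 0" unfolding uminus_h10_def by transfer simp
  show "u - v = u + - v" unfolding uminus_h10_def minus_h10_def by simp
  show "a *\<^sub>R (u + v) = a *\<^sub>R u + a *\<^sub>R v" by transfer (simp add: distrib_left)
  show "(a + b) *\<^sub>R u = a *\<^sub>R u + b *\<^sub>R u" by transfer (simp add: distrib_right)
  show "a *\<^sub>R b *\<^sub>R u = (a * b) *\<^sub>R u" by transfer (simp add: mult.assoc)
  show "1 *\<^sub>R u = u" by transfer simp
qed

end

lemma h10_to_l2_add: "h10_to_l2 (u + v) = h10_to_l2 u + h10_to_l2 v"
  by (simp add: h10_to_l2_def plus_h10.rep_eq to_l2_add fun_of_sq_integrable)

lemma h10_to_l2_scale: "h10_to_l2 (c *\<^sub>R u) = c *\<^sub>R h10_to_l2 u"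
  by (simp add: h10_to_l2_def scaleR_h10.rep_eq to_l2_scale fun_of_sq_integrable)

lemma h10_deriv_add: "h10_deriv (u + v) = h10_deriv u + h10_deriv v"
proof -
  obtain g where g: "sq_integrable g" "weak_derivative (fun_of u) g" "h10_deriv u = to_l2 g"
    by (rule h10_derivE)
  obtain k where k: "sq_integrable k" "weak_derivative (fun_of v) k" "h10_deriv v = to_l2 k"
    by (rule h10_derivE)
  have "h10_deriv (u + v) = to_l2 (\<lambda>x. g x + k x)"
    using g k by (intro h10_deriv_eqI)
      (auto simp: plus_h10.rep_eq intro!: sq_integrable_add weak_derivative_add fun_of_sq_integrable)
  then show ?thesis using g k by (simp add: to_l2_add)
qed

lemma h10_deriv_scale: "h10_deriv (c *\<^sub>R u) = c *\<^sub>R h10_deriv u"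
proof -
  obtain g where g: "sq_integrable g" "weak_derivative (fun_of u) g" "h10_deriv u = to_l2 g"
    by (rule h10_derivE)
  have "h10_deriv (c *\<^sub>R u) = to_l2 (\<lambda>x. c * g x)"
    using g by (intro h10_deriv_eqI)
      (auto simp: scaleR_h10.rep_eq intro!: sq_integrable_scale weak_derivative_scale)
  then show ?thesis using g by (simp add: to_l2_scale)
qed

lemma h10_to_l2_eq_0:
  assumes "h10_to_l2 u = 0"
  shows "u = 0"
proof -
  have ae: "AE x in leb01. fun_of u x = 0"
    using assms to_l2_eq_iff[OF fun_of_sq_integrable sq_integrable_zero]
    by (simp add: h10_to_l2_def to_l2_zero)
  have "fun_of u x = 0" for x
  proof (cases "x \<in> {0<..<1}")
    case True
    have "x \<in> {x. fun_of u x = 0}"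
    proof (rule mem_closed_if_AE_lebesgue_open[OF _ _ _ True])
      show "closed {x. fun_of u x = 0}"
        by (intro closed_Collect_eq fun_of_continuous continuous_on_const)
      show "AE x\<in>{0<..<1} in lebesgue. x \<in> {x. fun_of u x = 0}"
        using ae by (subst (asm) AE_restrict_space_iff) auto
    qed simp
    then show ?thesis by simp
  qed (rule fun_of_outside)
  then have "fun_of u = fun_of 0"
    by (auto simp: zero_h10.rep_eq)
  then show ?thesis by (simp add: fun_of_inject)
qed

instantiation h10 :: real_inner
begin

definition inner_h10 :: "h10 \<Rightarrow> h10 \<Rightarrow> real" where
  "inner_h10 u v = inner (h10_to_l2 u) (h10_to_l2 v) + inner (h10_deriv u) (h10_deriv v)"
definition norm_h10 :: "h10 \<Rightarrow> real" where "norm_h10 v = sqrt (inner v v)"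
definition sgn_h10 :: "h10 \<Rightarrow> h10" where "sgn_h10 v = v /\<^sub>R norm v"
definition dist_h10 :: "h10 \<Rightarrow> h10 \<Rightarrow> real" where "dist_h10 v w = norm (v - w)"
definition uniformity_h10 :: "(h10 \<times> h10) filter" where
  "uniformity_h10 = (INF e\<in>{0<..}. principal {(x, y). dist x y < e})"
definition open_h10 :: "h10 set \<Rightarrow> bool" where
  "open_h10 S = (\<forall>x\<in>S. \<forall>\<^sub>F (x', y) in uniformity. x' = x \<longrightarrow> y \<in> S)"

instance
proof
  fix u v w :: h10 and a :: real
  show "inner u v = inner v u"
    by (simp add: inner_h10_def inner_commute)
  show "inner (u + v) w = inner u w + inner v w"
    by (simp add: inner_h10_def h10_to_l2_add h10_deriv_add inner_add_left)
  show "inner (a *\<^sub>R u) v = a * inner u v"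
    by (simp add: inner_h10_def h10_to_l2_scale h10_deriv_scale distrib_left)
  show "0 \<le> inner u u"
    by (simp add: inner_h10_def)
  show "inner u u = 0 \<longleftrightarrow> u = 0"
  proof
    assume "inner u u = 0"
    then have "inner (h10_to_l2 u) (h10_to_l2 u) = 0"
      by (simp add: inner_h10_def add_nonneg_eq_0_iff)
    then show "u = 0" by (simp add: h10_to_l2_eq_0)
  next
    assume "u = 0"
    then have "u = 0 *\<^sub>R u" by simp
    then show "inner u u = 0"
      using h10_to_l2_scale[of 0 u] h10_deriv_scale[of 0 u] by (simp add: inner_h10_def)
  qed
qed (rule norm_h10_def sgn_h10_def dist_h10_def uniformity_h10_def open_h10_def)+

end


section \<open>The heat semigroup with Dirichlet boundary conditions\<close>

text \<open>\<open>dirichlet_mode n\<close> is the normalized eigenfunction of the Dirichlet Laplacian \<open>d\<^sup>2/dx\<^sup>2\<close> on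
  \<open>(0,1)\<close> for the eigenvalue \<open>-((n + 1) \<pi>)\<^sup>2\<close>; these form an orthonormal basis of \<open>L\<^sup>2(0,1)\<close>, and the
  semigroup generated by the Laplacian is diagonal in it.  The series is taken in the norm of
  \<open>L\<^sup>2(0,1)\<close>; it is used for \<open>t \<ge> 0\<close> only.\<close>

definition dirichlet_mode :: "nat \<Rightarrow> l2" where
  "dirichlet_mode n = to_l2 (\<lambda>x. sqrt 2 * sin (real (Suc n) * pi * x))"

definition heat_semigroup :: "real \<Rightarrow> l2 \<Rightarrow> l2" where
  "heat_semigroup t v =
     (\<Sum>n. (exp (- ((real (Suc n) * pi)\<^sup>2 * t)) * inner v (dirichlet_mode n)) *\<^sub>R dirichlet_mode n)"


section \<open>Solutions\<close>

definition forward_interval :: "real \<Rightarrow> real set \<Rightarrow> bool" where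
  "forward_interval \<sigma> I \<longleftrightarrow> is_interval I \<and> \<sigma> \<in> I \<and> I \<subseteq> {\<sigma>..} \<and> I \<noteq> {\<sigma>}"

definition time_change ::
    "(real \<Rightarrow> real) \<Rightarrow> (h10 \<Rightarrow> real) \<Rightarrow> real \<Rightarrow> (real \<Rightarrow> h10) \<Rightarrow> real \<Rightarrow> real" where
  "time_change a l \<sigma> u t = \<sigma> + integral {\<sigma>..t} (\<lambda>r. a (l (u r)))"

definition reaction ::
    "real \<Rightarrow> (real \<Rightarrow> real) \<Rightarrow> (real \<Rightarrow> real) \<Rightarrow> (real \<Rightarrow> real) \<Rightarrow> (h10 \<Rightarrow> real) \<Rightarrow> real \<Rightarrow>
     (real \<Rightarrow> h10) \<Rightarrow> real \<Rightarrow> l2" where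
  "reaction lam f h a l \<sigma> u t =
     to_l2 (\<lambda>x. (lam * f (fun_of (u t) x) + h (time_change a l \<sigma> u t)) / a (l (u t)))"

text \<open>Mild solutions on \<open>I\<close> of
  \<open>u\<^sub>t = u\<^sub>x\<^sub>x + (\<lambda> f(u) + h(\<alpha>(t))) / a(l(u))\<close>, \<open>u(t,0) = u(t,1) = 0\<close>, \<open>u(\<sigma>) = w\<^sub>0\<close>, where \<open>\<alpha>\<close> is
  \<open>time_change a l \<sigma> u\<close>.  The last conjunct is the variation of constants formula
  \<open>u(t) = S(t - \<sigma>) w\<^sub>0 + \<integral>\<^sub>\<sigma>\<^sup>t S(t - s) F(s) ds\<close>, with an \<open>L\<^sup>2(0,1)\<close>-valued integral.\<close>

definition mild_solution ::
    "real \<Rightarrow> (real \<Rightarrow> real) \<Rightarrow> (real \<Rightarrow> real) \<Rightarrow> (real \<Rightarrow> real) \<Rightarrow> (h10 \<Rightarrow> real) \<Rightarrow> real \<Rightarrow> h10 \<Rightarrow>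
     real set \<Rightarrow> (real \<Rightarrow> h10) \<Rightarrow> bool" where
  "mild_solution lam f h a l \<sigma> w0 I u \<longleftrightarrow>
     forward_interval \<sigma> I \<and> continuous_on I u \<and> u \<sigma> = w0 \<and>
     (\<forall>t\<in>I. ((\<lambda>s. heat_semigroup (t - s) (reaction lam f h a l \<sigma> u s)) has_integral
               h10_to_l2 (u t) - heat_semigroup (t - \<sigma>) (h10_to_l2 w0)) {\<sigma>..t})"

text \<open>Solutions on \<open>J\<close> of
  \<open>w\<^sub>\<tau> - a(l(w)) w\<^sub>x\<^sub>x = \<lambda> f(w) + h(\<tau>)\<close>, \<open>w(\<tau>,0) = w(\<tau>,1) = 0\<close>, \<open>w(\<sigma>) = w\<^sub>0\<close>:
  the time reparametrizations of mild solutions.\<close>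

definition quasilinear_solution ::
    "real \<Rightarrow> (real \<Rightarrow> real) \<Rightarrow> (real \<Rightarrow> real) \<Rightarrow> (real \<Rightarrow> real) \<Rightarrow> (h10 \<Rightarrow> real) \<Rightarrow> real \<Rightarrow> h10 \<Rightarrow>
     real set \<Rightarrow> (real \<Rightarrow> h10) \<Rightarrow> bool" where
  "quasilinear_solution lam f h a l \<sigma> w0 J w \<longleftrightarrow>
     (\<exists>I u. mild_solution lam f h a l \<sigma> w0 I u \<and> J = time_change a l \<sigma> u ` I \<and>
            (\<forall>t\<in>I. w (time_change a l \<sigma> u t) = u t))"

definition maximal_quasilinear_solution ::
    "real \<Rightarrow> (real \<Rightarrow> real) \<Rightarrow> (real \<Rightarrow> real) \<Rightarrow> (real \<Rightarrow> real) \<Rightarrow> (h10 \<Rightarrow> real) \<Rightarrow> real \<Rightarrow> h10 \<Rightarrow>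
     real set \<Rightarrow> (real \<Rightarrow> h10) \<Rightarrow> bool" where
  "maximal_quasilinear_solution lam f h a l \<sigma> w0 J w \<longleftrightarrow>
     quasilinear_solution lam f h a l \<sigma> w0 J w \<and>
     (\<forall>J' w'. quasilinear_solution lam f h a l \<sigma> w0 J' w' \<and> J \<subseteq> J' \<and> (\<forall>\<tau>\<in>J. w' \<tau> = w \<tau>)
        \<longrightarrow> J' = J)"

end

theory Submission
  imports Defs "HOL-Complex_Analysis.Great_Picard"
begin

text \<open>Expand in the Dirichlet eigenfunctions: the variation of constants formula becomes a family of
  scalar identities, and a bound on the forcing in \<open>L\<^sup>2\<close> makes the tails of the expansion small in
  \<open>H\<^sup>1\<^sub>0\<close>, uniformly in time. This gives local existence by Tonelli's delay method, after truncating
  \<open>f\<close>, and it shows that a solution on \<open>[\<sigma>,T)\<close> which is bounded in the supremum norm has a limit in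
  \<open>H\<^sup>1\<^sub>0\<close> as \<open>t\<close> tends to \<open>T\<close>. The supremum bound comes from the maximum principle: since
  \<open>\<gamma>s + \<lambda>f(s)\<close> is increasing, \<open>\<bar>\<gamma>u + \<lambda>f(u)\<bar>\<close> is controlled by its values at the current bound for
  \<open>\<bar>u\<bar>\<close>, where the growth condition on \<open>f\<close> applies, and the contraction of the supremum norm by the
  semigroup keeps \<open>\<bar>u\<bar>\<close> below an exponential. Hence every solution on a bounded interval extends
  properly, and because \<open>a \<ge> m > 0\<close> the time change maps \<open>[\<sigma>,\<infinity>)\<close> onto itself.\<close>

section \<open>Completeness of \<open>L\<^sup>2(0,1)\<close>\<close>

text \<open>Since \<open>l\<close> is merely continuous on H^1_0, limits pass through
  \<open>a (l u)\<close> only under strong convergence in H^1_0. The semigroup supplies it: against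
  a forcing bounded by B in L^2, the modes from N on contribute to the squared H^1_0 norm at most a
  multiple of B^2 divided by the N-th eigenvalue, at every time. The data are not Lipschitz and
  solutions need not be unique; hence a delay instead of a contraction, and hence every maximal
  solution has to be treated rather than a constructed one. The equation is also nonlocal in time
  through h(\<alpha>(t)), so restarting a solution needs the value of \<alpha> reached so far as an
  extra datum. In the supremum bound, \<gamma> depends on the size of u, which is what is to be
  bounded. The argument is not circular: \<gamma> enters the operator and the forcing alike and
  cancels, so the exponential rate does not depend on it. Finally, maximality concerns
  \<tau>-intervals, so an extension in t has to be carried over by injectivity of the time
  change.\<close>

lemma to_l2_cases:
  obtains g where "sq_integrable g" "v = to_l2 g"
proof
  show "sq_integrable (rep_l2 v)"
    using Quotient3_rep_reflp[OF Quotient3_l2, of v] by (simp add: l2_rel_def)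
  show "v = to_l2 (rep_l2 v)"
    using Quotient3_abs_rep[OF Quotient3_l2, of v] by (simp add: to_l2_def)
qed

lemma to_l2_inner:
  assumes "sq_integrable u" "sq_integrable v"
  shows "inner (to_l2 u) (to_l2 v) = (\<integral>x. u x * v x \<partial>leb01)"
  using assms by (simp add: to_l2_def inner_l2.abs_eq l2_rel_self)

lemma to_l2_norm_sq:
  assumes "sq_integrable u"
  shows "(norm (to_l2 u))\<^sup>2 = (\<integral>x. (u x)\<^sup>2 \<partial>leb01)"
  using to_l2_inner[OF assms assms] unfolding power2_norm_eq_inner by (simp add: power2_eq_square)

lemma to_l2_diff:
  "sq_integrable u \<Longrightarrow> sq_integrable v \<Longrightarrow> to_l2 (\<lambda>x. u x - v x) = to_l2 u - to_l2 v"
  by (simp add: to_l2_def minus_l2.abs_eq l2_rel_self)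

lemma to_l2_cong:
  assumes "sq_integrable u" "sq_integrable v" "\<And>x. 0 < x \<Longrightarrow> x < 1 \<Longrightarrow> u x = v x"
  shows "to_l2 u = to_l2 v"
  using assms by (subst to_l2_eq_iff) (auto intro!: AE_I2 simp: space_restrict_space)

lemma emeasure_leb01 [simp]: "emeasure leb01 {0<..<1} = 1"
  by (simp add: emeasure_restrict_space)

lemma finite_measure_leb01: "finite_measure leb01"
  by (rule finite_measureI) simp

lemma measure_leb01 [simp]: "measure leb01 {0<..<1} = 1"
  by (simp add: measure_def)

lemma integrable_leb01_const [simp]: "integrable leb01 (\<lambda>x. c::real)"
  using finite_measure.integrable_const[OF finite_measure_leb01] .

lemma integral_leb01_const [simp]: "(\<integral>x. c \<partial>leb01) = (c::real)"
  by simp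

lemma to_l2_norm_le:
  assumes u: "sq_integrable u" and b: "\<And>x. 0 < x \<Longrightarrow> x < 1 \<Longrightarrow> \<bar>u x\<bar> \<le> B" and B: "0 \<le> B"
  shows "norm (to_l2 u) \<le> B"
proof -
  have "(\<integral>x. (u x)\<^sup>2 \<partial>leb01) \<le> (\<integral>x. B\<^sup>2 \<partial>leb01)"
  proof (rule integral_mono)
    show "integrable leb01 (\<lambda>x. (u x)\<^sup>2)" using u by (simp add: sq_integrable_def)
    fix x assume "x \<in> space leb01"
    then show "(u x)\<^sup>2 \<le> B\<^sup>2"
      using b[of x] B by (intro power2_le_iff_abs_le[THEN iffD2]) (auto simp: space_restrict_space)
  qed simp
  then have "(norm (to_l2 u))\<^sup>2 \<le> B\<^sup>2" using to_l2_norm_sq[OF u] by simp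
  then show ?thesis using B by (rule power2_le_imp_le)
qed

text \<open>Cauchy-Schwarz against the constant 1, whose norm is at most 1 on an interval of unit
  length. It turns Cauchy sequences in L^2 into Cauchy sequences in L^1.\<close>

lemma integral_abs_le_norm:
  assumes u: "sq_integrable u"
  shows "(\<integral>x. \<bar>u x\<bar> \<partial>leb01) \<le> norm (to_l2 u)"
proof -
  have m: "(\<lambda>x. \<bar>u x\<bar>) \<in> borel_measurable leb01"
    using sq_integrable_measurable[OF u] by measurable
  have a: "sq_integrable (\<lambda>x. \<bar>u x\<bar>)"
    using u m by (simp add: sq_integrable_def)
  have o: "sq_integrable (\<lambda>x. 1::real)"
    by (rule sq_integrable_continuous) simp
  have "(norm (to_l2 (\<lambda>x. \<bar>u x\<bar>)))\<^sup>2 = (norm (to_l2 u))\<^sup>2"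
    unfolding to_l2_norm_sq[OF a] to_l2_norm_sq[OF u] by simp
  then have "norm (to_l2 (\<lambda>x. \<bar>u x\<bar>)) = norm (to_l2 u)"
    by (rule power2_eq_imp_eq) (rule norm_ge_zero)+
  moreover have "norm (to_l2 (\<lambda>x. 1)) \<le> 1"
    by (rule to_l2_norm_le[OF o]) auto
  moreover have "inner (to_l2 (\<lambda>x. \<bar>u x\<bar>)) (to_l2 (\<lambda>x. 1)) \<le> norm (to_l2 (\<lambda>x. \<bar>u x\<bar>)) * norm (to_l2 (\<lambda>x. 1))"
    by (rule norm_cauchy_schwarz)
  ultimately have "inner (to_l2 (\<lambda>x. \<bar>u x\<bar>)) (to_l2 (\<lambda>x. 1)) \<le> norm (to_l2 u)"
    by (metis mult_left_le norm_ge_zero order_trans)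
  then show ?thesis using to_l2_inner[OF a o] by simp
qed

text \<open>A Cauchy sequence has an almost everywhere convergent subsequence, because \<open>L\<^sup>2\<close> embeds into
  \<open>L\<^sup>1\<close> on \<open>(0,1)\<close>; Fatou's lemma identifies its pointwise limit as the limit in \<open>L\<^sup>2\<close>.\<close>

instance l2 :: complete_space
proof
  fix X :: "nat \<Rightarrow> l2" assume C: "Cauchy X"
  have "\<forall>n. \<exists>g. sq_integrable g \<and> X n = to_l2 g"
    using to_l2_cases by blast
  then obtain s where s: "\<And>n. sq_integrable (s n)" and X: "\<And>n. X n = to_l2 (s n)"
    by metis
  have dX: "norm (X i - X j) = norm (to_l2 (\<lambda>x. s i x - s j x))" for i j
    using s by (simp add: X to_l2_diff)
  have sd: "sq_integrable (\<lambda>x. s i x - s j x)" for i j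
    using s by (simp add: sq_integrable_diff)
  obtain r where r: "strict_mono r" and ae: "AE x in leb01. Cauchy (\<lambda>i. s (r i) x)"
  proof (rule cauchy_L1_AE_cauchy_subseq[of leb01 s])
    show "integrable leb01 (s n)" for n
      by (rule sq_integrable_integrable[OF s])
    fix e :: real assume "0 < e"
    then obtain N where N: "\<And>i j. N \<le> i \<Longrightarrow> N \<le> j \<Longrightarrow> norm (X i - X j) < e"
      using C by (metis CauchyD)
    have "(\<integral>x. norm (s i x - s j x) \<partial>leb01) < e" if "N \<le> i" "N \<le> j" for i j
      using integral_abs_le_norm[OF sd, of i j] N[OF that] dX[of i j] by simp
    then show "\<exists>N. \<forall>i\<ge>N. \<forall>j\<ge>N. (\<integral>x. norm (s i x - s j x) \<partial>leb01) < e"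
      by blast
  qed blast
  \<comment> \<open>Where the subsequence diverges, a null set, \<open>lim\<close> is unspecified;
    the pointwise limit is measurable all the same.\<close>
  define g where "g x = lim (\<lambda>i. s (r i) x)" for x
  have lim: "AE x in leb01. (\<lambda>i. s (r i) x) \<longlonglongrightarrow> g x"
    using ae by eventually_elim (simp add: g_def Cauchy_convergent_iff convergent_LIMSEQ_iff[symmetric])
  have gm: "g \<in> borel_measurable leb01"
    unfolding g_def by (rule borel_measurable_lim_metric) (rule sq_integrable_measurable[OF s])
  note sm [measurable] = sq_integrable_measurable[OF s] and gm [measurable]
  \<comment> \<open>One index stays fixed while the other runs to infinity, so the bound reaches
    \<open>s n - g\<close> before \<open>g\<close> is known to be square integrable.\<close>
  have fatou: "(\<integral>\<^sup>+x. ennreal ((s n x - g x)\<^sup>2) \<partial>leb01) \<le> ennreal (e\<^sup>2)"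
    if e: "0 \<le> e" "\<And>j. N \<le> j \<Longrightarrow> norm (X n - X j) \<le> e" for n N e
  proof -
    have "AE x in leb01. ennreal ((s n x - g x)\<^sup>2) = liminf (\<lambda>i. ennreal ((s n x - s (r i) x)\<^sup>2))"
      using lim
    proof eventually_elim
      case (elim x)
      have "(\<lambda>i. ennreal ((s n x - s (r i) x)\<^sup>2)) \<longlonglongrightarrow> ennreal ((s n x - g x)\<^sup>2)"
        by (intro tendsto_ennrealI tendsto_intros elim)
      then show ?case by (rule lim_imp_Liminf[symmetric, OF sequentially_bot])
    qed
    then have "(\<integral>\<^sup>+x. ennreal ((s n x - g x)\<^sup>2) \<partial>leb01) =
        (\<integral>\<^sup>+x. liminf (\<lambda>i. ennreal ((s n x - s (r i) x)\<^sup>2)) \<partial>leb01)"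
      by (rule nn_integral_cong_AE)
    also have "\<dots> \<le> liminf (\<lambda>i. \<integral>\<^sup>+x. ennreal ((s n x - s (r i) x)\<^sup>2) \<partial>leb01)"
      by (rule nn_integral_liminf) measurable
    also have "\<dots> \<le> ennreal (e\<^sup>2)"
    proof (rule Liminf_le)
      show "\<forall>\<^sub>F i in sequentially. (\<integral>\<^sup>+x. ennreal ((s n x - s (r i) x)\<^sup>2) \<partial>leb01) \<le> ennreal (e\<^sup>2)"
        using eventually_ge_at_top[of N]
      proof eventually_elim
        case (elim i)
        have "N \<le> r i" using elim seq_suble[OF r, of i] by linarith
        then have "(norm (X n - X (r i)))\<^sup>2 \<le> e\<^sup>2"
          using e by (intro power_mono) auto
        then have "(\<integral>x. (s n x - s (r i) x)\<^sup>2 \<partial>leb01) \<le> e\<^sup>2"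
          using dX to_l2_norm_sq[OF sd] by simp
        then show ?case
          using sd[of n "r i"] by (subst nn_integral_eq_integral) (auto simp: sq_integrable_def intro: ennreal_leI)
      qed
    qed simp
    finally show ?thesis .
  qed
  have sg: "sq_integrable (\<lambda>x. s n x - g x)" and ng: "norm (to_l2 (\<lambda>x. s n x - g x)) \<le> e"
    if e: "0 \<le> e" "\<And>j. N \<le> j \<Longrightarrow> norm (X n - X j) \<le> e" for n N e
  proof -
    have fe: "(\<integral>\<^sup>+x. ennreal ((s n x - g x)\<^sup>2) \<partial>leb01) \<le> ennreal (e\<^sup>2)"
      using e by (rule fatou)
    have d: "(\<lambda>x. s n x - g x) \<in> borel_measurable leb01"
      by measurable
    have i: "integrable leb01 (\<lambda>x. (s n x - g x)\<^sup>2)"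
    proof (rule integrableI_nonneg)
      show "(\<integral>\<^sup>+x. ennreal ((s n x - g x)\<^sup>2) \<partial>leb01) < \<infinity>"
        using fe by (rule order.strict_trans1) simp
    qed (use d in auto)
    with d show sg: "sq_integrable (\<lambda>x. s n x - g x)" unfolding sq_integrable_def by blast
    have "ennreal (\<integral>x. (s n x - g x)\<^sup>2 \<partial>leb01) \<le> ennreal (e\<^sup>2)"
      using fe by (subst (asm) nn_integral_eq_integral[OF i]) auto
    then have "(norm (to_l2 (\<lambda>x. s n x - g x)))\<^sup>2 \<le> e\<^sup>2"
      using to_l2_norm_sq[OF sg] by simp
    then show "norm (to_l2 (\<lambda>x. s n x - g x)) \<le> e"
      using e(1) by (rule power2_le_imp_le)
  qed
  have bd: "\<exists>N. \<forall>n\<ge>N. \<forall>j\<ge>N. norm (X n - X j) \<le> e" if "0 < e" for e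
    using CauchyD[OF C that] less_imp_le by blast
  obtain N where "\<And>n j. N \<le> n \<Longrightarrow> N \<le> j \<Longrightarrow> norm (X n - X j) \<le> 1"
    using bd[of 1] by auto
  then have "sq_integrable (\<lambda>x. s N x - g x)" by (intro sg[where e = 1 and N = N]) auto
  from sq_integrable_diff[OF s[of N] this] have g: "sq_integrable g" by simp
  have "X \<longlonglongrightarrow> to_l2 g"
  proof (rule metric_LIMSEQ_I)
    fix e :: real assume e: "0 < e"
    obtain N where N: "\<And>n j. N \<le> n \<Longrightarrow> N \<le> j \<Longrightarrow> norm (X n - X j) \<le> e / 2"
      using bd[of "e / 2"] e by auto
    have "dist (X n) (to_l2 g) < e" if "N \<le> n" for n
    proof -
      have "norm (to_l2 (\<lambda>x. s n x - g x)) \<le> e / 2"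
        by (rule ng[where N = N]) (use e N that in auto)
      then show ?thesis using e to_l2_diff[OF s g] by (simp add: dist_norm X)
    qed
    then show "\<exists>N. \<forall>n\<ge>N. dist (X n) (to_l2 g) < e" by blast
  qed
  then show "convergent X" by (rule convergentI)
qed

instance l2 :: banach ..

section \<open>Orthonormal bases\<close>

text \<open>Kept abstract because it is used twice: for the modes in L^2 and for the rescaled modes
  in H^1_0. Completeness of the system is put as "only 0 is orthogonal to it", which is what can be
  shown directly in both cases.\<close>

locale orthonormal_basis =
  fixes e :: "nat \<Rightarrow> 'a::{real_inner, banach}"
  assumes inner_basis: "inner (e i) (e j) = (if i = j then 1 else 0)"
    and separating: "(\<And>k. inner v (e k) = 0) \<Longrightarrow> v = 0"
begin

lemma inner_sum_basis:
  "finite A \<Longrightarrow> inner (\<Sum>k\<in>A. c k *\<^sub>R e k) (e j) = (if j \<in> A then c j else 0)"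
  by (simp add: inner_sum_left inner_basis if_distrib cong: if_cong)

lemma norm_sum_basis:
  assumes "finite A"
  shows "(norm (\<Sum>k\<in>A. c k *\<^sub>R e k))\<^sup>2 = (\<Sum>k\<in>A. (c k)\<^sup>2)"
proof -
  have "inner (\<Sum>k\<in>A. c k *\<^sub>R e k) (\<Sum>j\<in>A. c j *\<^sub>R e j) = (\<Sum>j\<in>A. c j * c j)"
    using assms by (simp add: inner_sum_right inner_sum_basis)
  then show ?thesis unfolding power2_norm_eq_inner by (simp add: power2_eq_square)
qed

lemma bessel_partial: "(\<Sum>k<n. (inner v (e k))\<^sup>2) \<le> (norm v)\<^sup>2"
proof -
  let ?s = "\<Sum>k<n. inner v (e k) *\<^sub>R e k"
  have vs: "inner v ?s = (\<Sum>k<n. (inner v (e k))\<^sup>2)"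
    by (simp add: inner_sum_right power2_eq_square)
  have "0 \<le> (norm (v - ?s))\<^sup>2" by simp
  also have "\<dots> = (norm v)\<^sup>2 - 2 * inner v ?s + (norm ?s)\<^sup>2"
    by (simp add: power2_norm_eq_inner inner_diff_left inner_diff_right inner_commute)
  also have "\<dots> = (norm v)\<^sup>2 - (\<Sum>k<n. (inner v (e k))\<^sup>2)"
    unfolding vs by (simp add: norm_sum_basis)
  finally show ?thesis by simp
qed

lemma bessel_summable: "summable (\<lambda>k. (inner v (e k))\<^sup>2)"
proof (rule bounded_imp_summable)
  show "(\<Sum>k\<le>n. (inner v (e k))\<^sup>2) \<le> (norm v)\<^sup>2" for n
    using bessel_partial[of v "Suc n"] by (simp add: lessThan_Suc_atMost)
qed simp

text \<open>By Pythagoras the squared norm of a block is the block of squared coefficients, so the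
  Cauchy criterion transfers with \<open>r\<close> replaced by its square.\<close>

lemma summable_basis:
  assumes "summable (\<lambda>k. (c k)\<^sup>2)"
  shows "summable (\<lambda>k. c k *\<^sub>R e k)"
  unfolding summable_Cauchy
proof (intro allI impI)
  fix r :: real assume r: "0 < r"
  then obtain N where N: "\<And>m n. N \<le> m \<Longrightarrow> norm (\<Sum>k\<in>{m..<n}. (c k)\<^sup>2) < r\<^sup>2"
    using assms unfolding summable_Cauchy by (meson zero_less_power)
  have "norm (\<Sum>k\<in>{m..<n}. c k *\<^sub>R e k) < r" if "N \<le> m" for m n
  proof (rule power2_less_imp_less)
    show "(norm (\<Sum>k\<in>{m..<n}. c k *\<^sub>R e k))\<^sup>2 < r\<^sup>2"
      using N[OF that, of n] by (simp add: norm_sum_basis sum_nonneg)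
  qed (use r in simp)
  then show "\<exists>N. \<forall>m\<ge>N. \<forall>n. norm (\<Sum>k\<in>{m..<n}. c k *\<^sub>R e k) < r" by blast
qed

lemma inner_suminf_basis:
  assumes "summable (\<lambda>k. (c k)\<^sup>2)"
  shows "inner (\<Sum>k. c k *\<^sub>R e k) (e j) = c j"
proof -
  have "(\<lambda>k. inner (c k *\<^sub>R e k) (e j)) sums inner (\<Sum>k. c k *\<^sub>R e k) (e j)"
    by (rule bounded_linear.sums[OF bounded_linear_inner_left])
       (rule summable_sums[OF summable_basis[OF assms]])
  moreover have "(\<lambda>k. inner (c k *\<^sub>R e k) (e j)) sums inner (c j *\<^sub>R e j) (e j)"
    by (rule sums_finite[of "{j}", simplified]) (auto simp: inner_basis)
  ultimately show ?thesis
    by (metis (no_types, lifting) sums_unique2 inner_scaleR_left inner_basis mult.right_neutral)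
qed

lemma riesz_fischer:
  assumes "summable (\<lambda>k. (c k)\<^sup>2)"
  obtains v where "\<And>k. inner v (e k) = c k"
  using inner_suminf_basis[OF assms] by blast

lemma basis_eqI:
  assumes "\<And>k. inner v (e k) = inner w (e k)"
  shows "v = w"
  using separating[of "v - w"] assms by (simp add: inner_diff_left)

lemma expansion: "(\<lambda>k. inner v (e k) *\<^sub>R e k) sums v"
proof -
  have "(\<Sum>k. inner v (e k) *\<^sub>R e k) = v"
    by (rule basis_eqI) (rule inner_suminf_basis[OF bessel_summable])
  then show ?thesis
    using summable_sums[OF summable_basis[OF bessel_summable, of v]] by simp
qed

lemma parseval: "(\<lambda>k. (inner v (e k))\<^sup>2) sums (norm v)\<^sup>2"
  using bounded_linear.sums[OF bounded_linear_inner_right expansion, of v v]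
  unfolding power2_norm_eq_inner by (simp add: power2_eq_square)

end

section \<open>The Dirichlet modes\<close>

text \<open>The endpoints are a null set, so the Lebesgue integral over the open interval is the
  gauge integral over the closed one.\<close>

lemma integral_leb01_FTC:
  assumes F: "\<And>x. 0 \<le> x \<Longrightarrow> x \<le> 1 \<Longrightarrow> (F has_real_derivative f x) (at x within {0..1})"
    and f: "continuous_on {0..1} f"
  shows "(\<integral>x. f x \<partial>leb01) = F 1 - F 0"
proof -
  have "(\<integral>x. f x \<partial>leb01) = integral {0<..<1} f"
    by (rule lebesgue_integral_eq_integral[OF sq_integrable_integrable[OF sq_integrable_continuous[OF f]]]) simp
  also have "\<dots> = integral {0..1} f" by (rule integral_open_interval_real[symmetric])
  also have "\<dots> = F 1 - F 0"
    by (rule integral_unique, rule fundamental_theorem_of_calculus)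
       (auto simp: has_real_derivative_iff_has_vector_derivative[symmetric] F)
  finally show ?thesis .
qed

definition mode :: "nat \<Rightarrow> real \<Rightarrow> real" where
  "mode k x = sqrt 2 * sin (real (Suc k) * pi * x)"

lemma dirichlet_mode_eq: "dirichlet_mode k = to_l2 (mode k)"
  by (simp add: dirichlet_mode_def mode_def[abs_def])

lemma continuous_on_mode: "continuous_on S (mode k)"
  unfolding mode_def[abs_def] by (intro continuous_intros)

lemma sq_integrable_mode: "sq_integrable (mode k)"
  by (rule sq_integrable_continuous[OF continuous_on_mode])

text \<open>The product of sines is a difference of cosines whose frequencies are integer multiples
  of pi, so their antiderivatives vanish at both ends; only the zero frequency, for
  \<open>i = j\<close>, leaves a constant.\<close>

lemma integral_mode_mult: "(\<integral>x. mode i x * mode j x \<partial>leb01) = (if i = j then 1 else 0)"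
proof -
  define p where "p = real (Suc i) * pi"
  define q where "q = real (Suc j) * pi"
  have pos: "0 < p" "0 < q" unfolding p_def q_def by simp_all
  have prod: "mode i x * mode j x = cos ((p - q) * x) - cos ((p + q) * x)" for x
  proof -
    have "mode i x * mode j x = 2 * (sin (p * x) * sin (q * x))"
      unfolding mode_def p_def[symmetric] q_def[symmetric] by (simp add: algebra_simps)
    then show ?thesis by (simp add: sin_times_sin left_diff_distrib distrib_right)
  qed
  have "sin p = 0" "sin q = 0"
    unfolding p_def q_def by (rule sin_npi)+
  then have s: "sin (p + q) = 0" "sin (p - q) = 0"
    by (simp_all add: sin_add sin_diff)
  show ?thesis
  proof (cases "i = j")
    case True
    then have [simp]: "q = p" by (simp add: p_def q_def)
    have "(\<integral>x. 1 - cos ((p + p) * x) \<partial>leb01) = (1 - sin ((p + p) * 1) / (p + p)) - (0 - sin ((p + p) * 0) / (p + p))"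
      using pos by (intro integral_leb01_FTC)
        (auto intro!: derivative_eq_intros continuous_intros simp: field_simps)
    then show ?thesis using s True prod by simp
  next
    case False
    then have ne: "p - q \<noteq> 0" "p + q \<noteq> 0" using pos by (simp add: p_def q_def, linarith)
    have d: "((\<lambda>x. sin (c * x) / c) has_real_derivative cos (c * x)) (at x within {0..1})" if "c \<noteq> 0" for c x :: real
      using that by (auto intro!: derivative_eq_intros)
    have "(\<integral>x. cos ((p - q) * x) - cos ((p + q) * x) \<partial>leb01) =
        (sin ((p - q) * 1) / (p - q) - sin ((p + q) * 1) / (p + q)) -
        (sin ((p - q) * 0) / (p - q) - sin ((p + q) * 0) / (p + q))"
      using ne by (intro integral_leb01_FTC DERIV_diff d continuous_intros)
    then show ?thesis using s False prod by simp
  qed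
qed

lemma inner_dirichlet_mode: "inner (dirichlet_mode i) (dirichlet_mode j) = (if i = j then 1 else 0)"
  by (simp add: dirichlet_mode_eq to_l2_inner sq_integrable_mode integral_mode_mult)

text \<open>By the Weierstrass theorem every test function is uniformly close to
  \<open>sin (\<pi> x) P(cos (\<pi> x))\<close> for some polynomial \<open>P\<close>, and \<open>sin (\<pi> x) (cos (\<pi> x))\<^sup>j\<close> is a
  combination of the modes.\<close>

lemma dirichlet_mode_separating:
  assumes "\<And>k. inner v (dirichlet_mode k) = 0"
  shows "v = 0"
proof -
  obtain g where g: "sq_integrable g" and v: "v = to_l2 g" by (rule to_l2_cases)
  have sqc: "sq_integrable p" if "continuous_on UNIV p" for p
    by (rule sq_integrable_continuous) (rule continuous_on_subset[OF that subset_UNIV])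
  have int: "integrable leb01 (\<lambda>x. g x * p x)" if "continuous_on UNIV p" for p
    by (rule sq_integrable_mult[OF g sqc[OF that]])
  have sin0: "(\<integral>x. g x * sin (real k * pi * x) \<partial>leb01) = 0" for k
  proof (cases k)
    case (Suc n)
    have "(\<integral>x. g x * (sqrt 2 * sin (real k * pi * x)) \<partial>leb01) = 0"
      using assms[of n] to_l2_inner[OF g sq_integrable_mode[of n]] Suc
      by (simp add: v dirichlet_mode_eq mode_def)
    then have "sqrt 2 * (\<integral>x. g x * sin (real k * pi * x) \<partial>leb01) = 0"
      by (subst (asm) mult.left_commute) simp
    then show ?thesis by simp
  qed simp
  let ?I = "\<lambda>j k. \<integral>x. g x * (sin (real k * pi * x) * cos (pi * x) ^ j) \<partial>leb01"
  \<comment> \<open>A factor \<open>cos (pi * x)\<close> moves the frequency \<open>k\<close> to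
    \<open>k + 1\<close> and \<open>k - 1\<close>, so the induction on the power has to cover all
    frequencies at once; \<open>k = 0\<close> is the zero function and ends the descent.\<close>
  have trig: "?I j k = 0" for j k
  proof (induction j arbitrary: k)
    case 0
    then show ?case using sin0 by simp
  next
    case (Suc j)
    show ?case
    proof (cases k)
      case (Suc n)
      have eq: "sin (real k * pi * x) * cos (pi * x) ^ Suc j =
          1/2 * (sin (real (Suc k) * pi * x) * cos (pi * x) ^ j) + 1/2 * (sin (real n * pi * x) * cos (pi * x) ^ j)" for x
      proof -
        have "sin (real k * pi * x) * cos (pi * x) = (sin (real k * pi * x + pi * x) + sin (real k * pi * x - pi * x)) / 2"
          by (rule sin_times_cos)
        moreover have "real k * pi * x + pi * x = real (Suc k) * pi * x" "real k * pi * x - pi * x = real n * pi * x"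
          by (simp_all add: Suc algebra_simps)
        ultimately have "sin (real k * pi * x) * cos (pi * x) = 1/2 * sin (real (Suc k) * pi * x) + 1/2 * sin (real n * pi * x)"
          by simp
        then have "(sin (real k * pi * x) * cos (pi * x)) * cos (pi * x) ^ j =
            (1/2 * sin (real (Suc k) * pi * x) + 1/2 * sin (real n * pi * x)) * cos (pi * x) ^ j"
          by (rule arg_cong)
        then show ?thesis unfolding power_Suc distrib_right mult.assoc .
      qed
      have "?I (Suc j) k =
          (\<integral>x. 1/2 * (g x * (sin (real (Suc k) * pi * x) * cos (pi * x) ^ j)) +
                1/2 * (g x * (sin (real n * pi * x) * cos (pi * x) ^ j)) \<partial>leb01)"
        unfolding eq by (rule Bochner_Integration.integral_cong) (auto simp: algebra_simps)
      also have "\<dots> = 1/2 * ?I j (Suc k) +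
          1/2 * ?I j n"
        by (subst Bochner_Integration.integral_add)
           (auto intro!: integrable_mult_right int continuous_intros simp del: mult_Suc_right)
      also have "\<dots> = 0" unfolding Suc.IH by simp
      finally show ?thesis .
    qed simp
  qed
  have poly: "(\<integral>x. g x * (sin (pi * x) * P (cos (pi * x))) \<partial>leb01) = 0"
    if "real_polynomial_function P" for P
  proof -
    obtain a n where P: "P = (\<lambda>x. \<Sum>i\<le>n. a i * x ^ i)"
      using \<open>real_polynomial_function P\<close> unfolding real_polynomial_function_iff_sum by blast
    have "(\<integral>x. g x * (sin (pi * x) * P (cos (pi * x))) \<partial>leb01) =
        (\<integral>x. (\<Sum>i\<le>n. a i * (g x * (sin (real 1 * pi * x) * cos (pi * x) ^ i))) \<partial>leb01)"
      unfolding P by (rule Bochner_Integration.integral_cong)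
        (auto simp: sum_distrib_left algebra_simps intro!: sum.cong)
    also have "\<dots> = (\<Sum>i\<le>n. a i * ?I i 1)"
      by (subst Bochner_Integration.integral_sum)
         (auto intro!: integrable_mult_right int continuous_intros)
    also have "\<dots> = 0" unfolding trig by simp
    finally show ?thesis .
  qed
  have "AE x in leb01. g x = 0"
  proof (rule test_function_separation[OF g])
    fix \<phi> \<phi>' assume t: "test_function \<phi> \<phi>'"
    then obtain a b where ab: "0 < a" "b < 1" "\<And>x. x \<notin> {a..b} \<Longrightarrow> \<phi> x = 0"
      unfolding test_function_def by blast
    obtain c where c: "0 < c" "\<And>x. x \<in> {a..b} \<Longrightarrow> c \<le> sin (pi * x)"
    proof (cases "a \<le> b")
      case True
      have "\<exists>z\<in>{a..b}. \<forall>x\<in>{a..b}. sin (pi * z) \<le> sin (pi * x)"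
        using True by (intro continuous_attains_inf continuous_intros) auto
      then obtain z where z: "z \<in> {a..b}" "\<And>x. x \<in> {a..b} \<Longrightarrow> sin (pi * z) \<le> sin (pi * x)" by blast
      have "0 < sin (pi * z)" using z(1) ab by (intro sin_gt_zero) auto
      with z that show ?thesis by blast
    next
      case False
      then show ?thesis using that[of 1] by auto
    qed
    \<comment> \<open>The quotient of \<phi> by \<open>sin (pi * x)\<close>, with the denominator
      cut off below at \<open>c\<close>: inactive on the support of \<phi>, harmless elsewhere
      because \<phi> is zero there, and continuous up to the endpoints.\<close>
    define \<psi> where "\<psi> x = \<phi> x / max c (sin (pi * x))" for x
    have \<psi>c: "continuous_on S \<psi>" for S
      unfolding \<psi>_def[abs_def] using c(1)
      by (intro continuous_intros test_function_continuous[OF t]) auto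
    have \<psi>s: "sin (pi * x) * \<psi> x = \<phi> x" for x
      using c(1) c(2)[of x] ab(3)[of x] by (cases "x \<in> {a..b}") (auto simp: \<psi>_def max_def)
    have "\<bar>\<integral>x. g x * \<phi> x \<partial>leb01\<bar> \<le> norm v * r" if r: "0 < r" for r
    proof -
      \<comment> \<open>The substitution y = cos(pi x) maps [0,1] onto [-1,1] and makes polynomial
        approximation in y applicable.\<close>
      have qc: "continuous_on {-1..1} (\<lambda>y. \<psi> (arccos y / pi))"
        by (rule continuous_on_compose2[OF \<psi>c]) (auto intro!: continuous_intros continuous_on_arccos')
      obtain P where P: "real_polynomial_function P"
          "\<And>y. y \<in> {-1..1} \<Longrightarrow> \<bar>\<psi> (arccos y / pi) - P y\<bar> < r"
        using Stone_Weierstrass_real_polynomial_function[OF _ qc r] by (metis compact_Icc)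
      have Pc: "continuous_on S P" for S
        using P(1) by (simp add: continuous_on_polymonial_function real_polynomial_function_eq)
      define d where "d x = \<phi> x - sin (pi * x) * P (cos (pi * x))" for x
      have dc: "continuous_on UNIV d"
        unfolding d_def[abs_def]
        by (intro continuous_intros test_function_continuous[OF t] continuous_on_compose2[OF Pc[of UNIV]]) auto
      have "\<bar>d x\<bar> \<le> r" if "0 < x" "x < 1" for x
      proof -
        have "arccos (cos (pi * x)) = pi * x" using that by (intro arccos_cos) auto
        then have "\<bar>\<psi> x - P (cos (pi * x))\<bar> < r" using P(2)[of "cos (pi * x)"] by simp
        then have "\<bar>sin (pi * x)\<bar> * \<bar>\<psi> x - P (cos (pi * x))\<bar> \<le> 1 * r"
          by (intro mult_mono) auto
        then show ?thesis by (simp add: d_def \<psi>s[symmetric] abs_mult[symmetric] right_diff_distrib)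
      qed
      then have n: "norm (to_l2 d) \<le> r" using r by (intro to_l2_norm_le sqc dc) auto
      have pc: "continuous_on UNIV (\<lambda>x. sin (pi * x) * P (cos (pi * x)))"
        by (intro continuous_intros continuous_on_compose2[OF Pc[of UNIV]]) auto
      have "inner v (to_l2 d) = (\<integral>x. g x * d x \<partial>leb01)"
        unfolding v by (rule to_l2_inner[OF g sqc[OF dc]])
      also have "\<dots> = (\<integral>x. g x * \<phi> x \<partial>leb01)"
        unfolding d_def right_diff_distrib
        using int[OF test_function_continuous[OF t]] int[OF pc] poly[OF P(1)] by simp
      finally show ?thesis
        using Cauchy_Schwarz_ineq2[of v "to_l2 d"] n
        by (metis mult_left_mono norm_ge_zero order_trans)
    qed
    note small = this
    have "\<bar>\<integral>x. g x * \<phi> x \<partial>leb01\<bar> \<le> 0 + r" if "0 < r" for r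
    proof -
      have "\<bar>\<integral>x. g x * \<phi> x \<partial>leb01\<bar> \<le> norm v * (r / (norm v + 1))"
        using that by (intro small divide_pos_pos) (auto intro: add_nonneg_pos)
      also have "\<dots> \<le> r"
      proof -
        have "0 < norm v + 1" using norm_ge_zero[of v] by linarith
        then show ?thesis using that by (simp add: pos_divide_le_eq algebra_simps)
      qed
      finally show ?thesis by simp
    qed
    then have "\<bar>\<integral>x. g x * \<phi> x \<partial>leb01\<bar> \<le> 0" by (rule field_le_epsilon)
    then show "(\<integral>x. g x * \<phi> x \<partial>leb01) = 0" by simp
  qed
  then show ?thesis
    unfolding v to_l2_zero[symmetric] to_l2_eq_iff[OF g sq_integrable_zero] .
qed

interpretation dirichlet: orthonormal_basis dirichlet_mode
  by standard (rule inner_dirichlet_mode, rule dirichlet_mode_separating)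

abbreviation cf :: "l2 \<Rightarrow> nat \<Rightarrow> real" where
  "cf v k \<equiv> inner v (dirichlet_mode k)"

section \<open>Completeness of \<open>H\<^sup>1\<^sub>0(0,1)\<close>\<close>

text \<open>A C^1 transition from 0 to 1 across [0,1]. Squared positive parts are C^1 and the two in
  the denominator never vanish together, so the derivative \<open>step'\<close> is explicit and
  continuous.\<close>

definition step :: "real \<Rightarrow> real" where
  "step x = (max 0 x)\<^sup>2 / ((max 0 x)\<^sup>2 + (max 0 (1 - x))\<^sup>2)"

definition step' :: "real \<Rightarrow> real" where
  "step' x = (2 * max 0 x * (max 0 (1 - x))\<^sup>2 + (max 0 x)\<^sup>2 * (2 * max 0 (1 - x))) /
     ((max 0 x)\<^sup>2 + (max 0 (1 - x))\<^sup>2)\<^sup>2"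

lemma step_denominator: "0 < (max 0 x)\<^sup>2 + (max 0 (1 - x))\<^sup>2" for x :: real
proof (cases "0 < x")
  case True
  then show ?thesis by (intro add_pos_nonneg) auto
next
  case False
  then show ?thesis by (intro add_nonneg_pos) auto
qed

lemma step_eq_0: "x \<le> 0 \<Longrightarrow> step x = 0" and step_eq_1: "1 \<le> x \<Longrightarrow> step x = 1"
  and step'_eq_0: "x \<le> 0 \<or> 1 \<le> x \<Longrightarrow> step' x = 0"
  by (auto simp: step_def step'_def max_def)

lemma step_nonneg: "0 \<le> step x" and step_le_1: "step x \<le> 1" and step'_nonneg: "0 \<le> step' x"
  using step_denominator[of x] by (auto simp: step_def step'_def)

lemma DERIV_step: "(step has_real_derivative step' x) (at x)"
proof -
  have q: "((\<lambda>x. (max 0 (1 - x))\<^sup>2) has_real_derivative (2 * max 0 (1 - x) * - 1)) (at x)"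
    by (rule DERIV_chain2[OF sq_max_deriv]) (auto intro!: derivative_eq_intros)
  have "(step has_real_derivative
      (2 * max 0 x * ((max 0 x)\<^sup>2 + (max 0 (1 - x))\<^sup>2) - (max 0 x)\<^sup>2 * (2 * max 0 x + 2 * max 0 (1 - x) * - 1)) /
      (((max 0 x)\<^sup>2 + (max 0 (1 - x))\<^sup>2) * ((max 0 x)\<^sup>2 + (max 0 (1 - x))\<^sup>2))) (at x)"
    unfolding step_def[abs_def]
    by (rule DERIV_divide[OF sq_max_deriv DERIV_add[OF sq_max_deriv q]]) (use step_denominator[of x] in linarith)
  then show ?thesis
    by (rule DERIV_cong) (simp add: step'_def algebra_simps power2_eq_square)
qed

lemma continuous_on_step': "continuous_on S step'"
  unfolding step'_def[abs_def] using step_denominator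
  by (intro continuous_intros) (metis less_irrefl zero_eq_power2)

lemma continuous_on_step: "continuous_on S step"
  by (intro continuous_at_imp_continuous_on ballI DERIV_isCont[OF DERIV_step])

lemma DERIV_step_affine: "((\<lambda>x. step (p * x + q)) has_real_derivative step' (p * x + q) * p) (at x within S)"
  by (rule DERIV_subset[OF DERIV_chain2[OF DERIV_step]]) (auto intro!: derivative_eq_intros)

lemma continuous_on_step_affine:
  "continuous_on S (\<lambda>x. step (p * x + q))" "continuous_on S (\<lambda>x. step' (p * x + q))"
  by (auto intro!: continuous_on_compose2[OF continuous_on_step[of UNIV]]
      continuous_on_compose2[OF continuous_on_step'[of UNIV]] continuous_intros)

lemma integral_step'_affine:
  "(\<integral>x. step' (p * x + q) * p \<partial>leb01) = step (p + q) - step q"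
  using integral_leb01_FTC[OF DERIV_step_affine, of p q]
  by (simp add: continuous_on_mult continuous_on_step_affine)

text \<open>Cutting \<phi> off near both ends makes it a test function. Each cutoff has a derivative
  of total mass 1, concentrated where \<open>u\<close> is close to its boundary value 0, so the
  error it causes disappears in the limit; \<phi> itself need not vanish at the endpoints.\<close>

lemma weak_derivative_C1:
  assumes u: "continuous_on UNIV u" "\<And>x. x \<notin> {0<..<1} \<Longrightarrow> u x = 0"
    and g: "sq_integrable g" "weak_derivative u g"
    and \<phi>: "\<And>x. (\<phi> has_real_derivative \<phi>' x) (at x)" "continuous_on UNIV \<phi>'"
  shows "(\<integral>x. u x * \<phi>' x \<partial>leb01) = - (\<integral>x. g x * \<phi> x \<partial>leb01)"
proof -
  define N where "N n = real n + 4" for n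
  have N: "4 \<le> N n" for n by (simp add: N_def)
  \<comment> \<open>The shift by 1 makes \<open>L n\<close> zero up to 1/N and one from 2/N on,
    which keeps the support of the product inside the open interval. \<open>R n\<close> is its
    mirror image at 1.\<close>
  define L where "L n x = step (N n * x + - 1)" for n x
  define R where "R n x = step ((- N n) * x + (N n - 1))" for n x
  define L' where "L' n x = step' (N n * x + - 1) * N n" for n x
  define R' where "R' n x = step' ((- N n) * x + (N n - 1)) * N n" for n x
  have \<phi>c: "continuous_on S \<phi>" for S
    by (intro continuous_at_imp_continuous_on ballI DERIV_isCont[OF \<phi>(1)])
  have \<phi>'c: "continuous_on S \<phi>'" for S by (rule continuous_on_subset[OF \<phi>(2)]) simp
  have uc: "continuous_on S u" for S by (rule continuous_on_subset[OF u(1)]) simp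
  have Lc: "continuous_on S (L n)" "continuous_on S (R n)" "continuous_on S (L' n)" "continuous_on S (R' n)" for S n
    unfolding L_def[abs_def] R_def[abs_def] L'_def[abs_def] R'_def[abs_def]
    by (intro continuous_intros continuous_on_step_affine)+
  have dL: "(L n has_real_derivative L' n x) (at x)" and dR: "(R n has_real_derivative - R' n x) (at x)" for n x
    unfolding L_def[abs_def] R_def[abs_def] L'_def R'_def
    using DERIV_step_affine[of "N n" "-1" x UNIV] DERIV_step_affine[of "- N n" "N n - 1" x UNIV] by simp_all
  have bnd: "0 \<le> L n x" "L n x \<le> 1" "0 \<le> R n x" "R n x \<le> 1" "0 \<le> L' n x" "0 \<le> R' n x" for n x
    using N[of n] by (auto simp: L_def R_def L'_def R'_def step_nonneg step_le_1 step'_nonneg)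
  define D where "D n x = (L' n x * R n x - L n x * R' n x) * \<phi> x + L n x * R n x * \<phi>' x" for n x
  have test: "test_function (\<lambda>x. L n x * R n x * \<phi> x) (D n)" for n
    unfolding test_function_def
  proof (intro conjI allI)
    show "((\<lambda>x. L n x * R n x * \<phi> x) has_real_derivative D n x) (at x)" for x
      using DERIV_mult[OF DERIV_mult[OF dL[of n x] dR[of n x]] \<phi>(1)[of x]]
      by (rule DERIV_cong) (simp add: D_def algebra_simps)
    show "continuous_on UNIV (D n)"
      unfolding D_def[abs_def] by (intro continuous_intros Lc \<phi>c \<phi>'c)
    have "L n x * R n x * \<phi> x = 0" if "x \<notin> {1 / N n .. 1 - 1 / N n}" for x
    proof -
      have "x < 1 / N n \<or> 1 - 1 / N n < x" using that by auto
      then have "N n * x - 1 \<le> 0 \<or> - N n * x + (N n - 1) \<le> 0"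
        using N[of n] by (auto simp: field_simps)
      then show ?thesis unfolding L_def R_def by (auto simp: step_eq_0)
    qed
    then show "\<exists>a b. 0 < a \<and> b < 1 \<and> (\<forall>x. x \<notin> {a..b} \<longrightarrow> L n x * R n x * \<phi> x = 0)"
      using N[of n] by (intro exI[of _ "1 / N n"] exI[of _ "1 - 1 / N n"]) auto
  qed
  let ?E = "\<lambda>n x. (L' n x * R n x - L n x * R' n x) * \<phi> x"
  let ?J = "\<lambda>n. \<integral>x. u x * ?E n x \<partial>leb01"
  have sqc: "sq_integrable p" if "\<And>S. continuous_on S p" for p
    by (rule sq_integrable_continuous) (rule that)
  have su: "sq_integrable u" by (rule sqc[OF uc])
  have lim1: "(\<lambda>n. L n x * R n x) \<longlonglongrightarrow> 1" if x: "0 < x" "x < 1" for x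
  proof (rule tendsto_eventually)
    obtain n0 where n0: "2 / min x (1 - x) \<le> real n0" using real_arch_simple by blast
    show "\<forall>\<^sub>F n in sequentially. L n x * R n x = 1"
      using eventually_ge_at_top[of n0]
    proof eventually_elim
      case (elim n)
      have "2 / min x (1 - x) \<le> N n" using n0 elim by (simp add: N_def)
      then have "2 \<le> N n * min x (1 - x)" using x by (simp add: divide_le_eq)
      moreover have "N n * min x (1 - x) \<le> N n * x" "N n * min x (1 - x) \<le> N n * (1 - x)"
        using N[of n] by (auto intro!: mult_left_mono)
      ultimately have "2 \<le> N n * x" "2 \<le> N n * (1 - x)" by auto
      then show ?case by (simp add: L_def R_def step_eq_1 algebra_simps)
    qed
  qed
  have dom: "(\<lambda>n. \<integral>x. (p x * q x) * (L n x * R n x) \<partial>leb01) \<longlonglongrightarrow> (\<integral>x. p x * q x \<partial>leb01)"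
    if p: "sq_integrable p" and q: "sq_integrable q" for p q
  proof (rule integral_dominated_convergence[where w = "\<lambda>x. \<bar>p x * q x\<bar>"])
    note [measurable] = sq_integrable_measurable[OF p] sq_integrable_measurable[OF q]
      sq_integrable_measurable[OF sqc[OF Lc(1)]] sq_integrable_measurable[OF sqc[OF Lc(2)]]
    show "(\<lambda>x. p x * q x) \<in> borel_measurable leb01" by measurable
    show "(\<lambda>x. p x * q x * (L n x * R n x)) \<in> borel_measurable leb01" for n by measurable
    show "integrable leb01 (\<lambda>x. \<bar>p x * q x\<bar>)"
      by (intro integrable_abs sq_integrable_mult[OF p q])
    show "AE x in leb01. (\<lambda>n. p x * q x * (L n x * R n x)) \<longlonglongrightarrow> p x * q x"
      using tendsto_mult[OF tendsto_const lim1] by (auto intro!: AE_I2 simp: space_restrict_space)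
    have "\<bar>L n x * R n x\<bar> \<le> 1" for n x
      using bnd[of n x] by (simp add: mult_le_one)
    then show "AE x in leb01. norm (p x * q x * (L n x * R n x)) \<le> \<bar>p x * q x\<bar>" for n
      unfolding real_norm_def abs_mult[of "p x * q x" for x] by (intro AE_I2 mult_left_le) auto
  qed
  have lim0: "?J \<longlonglongrightarrow> 0"
  proof (rule LIMSEQ_I)
    fix r :: real assume r: "0 < r"
    have "compact (\<phi> ` {0..1})" by (intro compact_continuous_image \<phi>c) auto
    then obtain C where C: "0 < C" "\<And>x. 0 \<le> x \<Longrightarrow> x \<le> 1 \<Longrightarrow> \<bar>\<phi> x\<bar> \<le> C"
      by (metis compact_imp_bounded bounded_pos imageI real_norm_def atLeastAtMost_iff)
    \<comment> \<open>The two cutoff derivatives have mass 1 each, so the error is at most 2 \<eta>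
      C = r/2.\<close>
    define \<eta> where "\<eta> = r / (4 * C)"
    have \<eta>: "0 < \<eta>" using r C by (simp add: \<eta>_def)
    have "\<exists>d>0. \<forall>x. \<bar>x - z\<bar> < d \<longrightarrow> \<bar>u x - u z\<bar> < \<eta>" for z
      using uc[of UNIV] \<eta> unfolding continuous_on_iff by (auto simp: dist_real_def)
    then obtain d0 d1 where d: "0 < d0" "0 < d1" "\<And>x. \<bar>x\<bar> < d0 \<Longrightarrow> \<bar>u x\<bar> < \<eta>" "\<And>x. \<bar>x - 1\<bar> < d1 \<Longrightarrow> \<bar>u x\<bar> < \<eta>"
      using u(2)[of 0] u(2)[of 1] by (metis diff_zero greaterThanLessThan_iff less_irrefl)
    obtain n0 where n0: "2 / min d0 d1 \<le> real n0" using real_arch_simple by blast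
    have "norm (?J n - 0) < r" if n: "n0 \<le> n" for n
    proof -
      have "2 / min d0 d1 < N n" using n0 n by (simp add: N_def)
      then have "2 < N n * min d0 d1" using d by (simp add: divide_less_eq)
      moreover have "N n * min d0 d1 \<le> N n * d0" "N n * min d0 d1 \<le> N n * d1"
        using N[of n] by (auto intro!: mult_left_mono)
      ultimately have Nd: "2 < N n * d0" "2 < N n * d1" by auto
      have pt: "\<bar>u x * ?E n x\<bar> \<le> (\<eta> * C) * (L' n x + R' n x)"
        if x: "0 < x" "x < 1" for x
      proof (cases "L' n x + R' n x = 0")
        case True
        then have "L' n x = 0" "R' n x = 0" using bnd[of n x] by auto
        then show ?thesis by simp
      next
        case False
        then consider "L' n x \<noteq> 0" | "R' n x \<noteq> 0" by linarith
        then have "\<bar>u x\<bar> < \<eta>"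
        proof cases
          case 1
          then have "N n * x < 2" using step'_eq_0[of "N n * x + - 1"] by (force simp: L'_def)
          then have "N n * x < N n * d0" using Nd by linarith
          then have "x < d0" using N[of n] by simp
          then show ?thesis using d(3) x by simp
        next
          case 2
          then have "N n * (1 - x) < 2"
            using step'_eq_0[of "- N n * x + (N n - 1)"] by (force simp: R'_def algebra_simps)
          then have "N n * (1 - x) < N n * d1" using Nd by linarith
          then have "1 - x < d1" using N[of n] by simp
          then show ?thesis using d(4) x by simp
        qed
        moreover have "\<bar>L' n x * R n x - L n x * R' n x\<bar> \<le> L' n x + R' n x"
        proof -
          have "L' n x * R n x \<le> L' n x * 1" "L n x * R' n x \<le> 1 * R' n x"
            by (rule mult_left_mono[OF bnd(4) bnd(5)], rule mult_right_mono[OF bnd(2) bnd(6)])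
          moreover have "0 \<le> L' n x * R n x" "0 \<le> L n x * R' n x" using bnd[of n x] by auto
          ultimately show ?thesis by (simp add: abs_le_iff)
        qed
        moreover have "\<bar>\<phi> x\<bar> \<le> C" using C x by simp
        ultimately have "\<bar>u x\<bar> * (\<bar>L' n x * R n x - L n x * R' n x\<bar> * \<bar>\<phi> x\<bar>) \<le> \<eta> * ((L' n x + R' n x) * C)"
          using \<eta> C bnd[of n x] by (intro mult_mono) auto
        then show ?thesis by (simp add: abs_mult mult_ac)
      qed
      have iL: "integrable leb01 (L' n)" "integrable leb01 (R' n)"
        by (intro sq_integrable_integrable sqc Lc)+
      have "\<bar>?J n\<bar> \<le> (\<integral>x. (\<eta> * C) * (L' n x + R' n x) \<partial>leb01)"
      proof -
        have i1: "integrable leb01 (\<lambda>x. u x * ?E n x)"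
          by (intro sq_integrable_mult su sqc continuous_intros Lc \<phi>c)
        have "norm (?J n) \<le> (\<integral>x. (\<eta> * C) * (L' n x + R' n x) \<partial>leb01)"
          by (rule Bochner_Integration.integral_norm_bound_integral[OF i1]) (use iL pt in \<open>auto simp: space_restrict_space\<close>)
        then show ?thesis by simp
      qed
      also have "\<dots> = (\<eta> * C) * ((\<integral>x. L' n x \<partial>leb01) + (\<integral>x. R' n x \<partial>leb01))"
        using iL by simp
      also have "(\<integral>x. L' n x \<partial>leb01) = 1"
        unfolding L'_def using N[of n] integral_step'_affine[of "N n" "-1"] by (simp add: step_eq_0 step_eq_1)
      also have "(\<integral>x. R' n x \<partial>leb01) = 1"
        unfolding R'_def using N[of n] integral_step'_affine[of "- N n" "N n - 1"] by (simp add: step_eq_0 step_eq_1)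
      also have "(\<eta> * C) * (1 + 1) < r" using r C by (simp add: \<eta>_def field_simps)
      finally show ?thesis by simp
    qed
    then show "\<exists>n0. \<forall>n\<ge>n0. norm (?J n - 0) < r" by blast
  qed
  have "?J n + (\<integral>x. (u x * \<phi>' x) * (L n x * R n x) \<partial>leb01)
      = - (\<integral>x. (g x * \<phi> x) * (L n x * R n x) \<partial>leb01)" for n
  proof -
    have i1: "integrable leb01 (\<lambda>x. u x * ?E n x)"
      by (intro sq_integrable_mult su sqc continuous_intros Lc \<phi>c)
    have i2: "integrable leb01 (\<lambda>x. u x * (\<phi>' x * (L n x * R n x)))"
      by (intro sq_integrable_mult su sqc continuous_intros Lc \<phi>'c)
    have "(\<integral>x. u x * D n x \<partial>leb01) = - (\<integral>x. g x * (L n x * R n x * \<phi> x) \<partial>leb01)"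
      using g(2) test[of n] unfolding weak_derivative_def by blast
    moreover have "(\<integral>x. u x * D n x \<partial>leb01) = (\<integral>x. u x * ?E n x + u x * (\<phi>' x * (L n x * R n x)) \<partial>leb01)"
      by (rule Bochner_Integration.integral_cong) (auto simp: D_def algebra_simps)
    ultimately show ?thesis
      using i1 i2 by (simp add: mult_ac)
  qed
  then have "(\<lambda>n. - (\<integral>x. (g x * \<phi> x) * (L n x * R n x) \<partial>leb01)) \<longlonglongrightarrow> 0 + (\<integral>x. u x * \<phi>' x \<partial>leb01)"
    using tendsto_add[OF lim0 dom[OF su sqc[OF \<phi>'c]]] by simp
  moreover have "(\<lambda>n. - (\<integral>x. (g x * \<phi> x) * (L n x * R n x) \<partial>leb01)) \<longlonglongrightarrow> - (\<integral>x. g x * \<phi> x \<partial>leb01)"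
    by (intro tendsto_minus dom g sqc \<phi>c)
  ultimately show ?thesis using LIMSEQ_unique by fastforce
qed

section \<open>The norm of H^1_0 dominates the supremum norm, and H^1_0 is complete\<close>

lemma h10_norm_sq: "(norm u)\<^sup>2 = (norm (h10_to_l2 u))\<^sup>2 + (norm (h10_deriv u))\<^sup>2" for u :: h10
  unfolding power2_norm_eq_inner inner_h10_def ..

lemma h10_norm_bounds: "norm (h10_to_l2 u) \<le> norm u" "norm (h10_deriv u) \<le> norm u" for u :: h10
  by (rule power2_le_imp_le; simp add: h10_norm_sq)+

lemma bounded_linear_h10_to_l2: "bounded_linear h10_to_l2"
  by (rule bounded_linear_intro[where K = 1])
     (simp_all add: h10_to_l2_add h10_to_l2_scale h10_norm_bounds)

lemma bounded_linear_h10_deriv: "bounded_linear h10_deriv"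
  by (rule bounded_linear_intro[where K = 1])
     (simp_all add: h10_deriv_add h10_deriv_scale h10_norm_bounds)

lemma h10_to_l2_diff: "h10_to_l2 (u - v) = h10_to_l2 u - h10_to_l2 v"
  unfolding minus_h10_def h10_to_l2_add h10_to_l2_scale by simp

lemma h10_deriv_diff: "h10_deriv (u - v) = h10_deriv u - h10_deriv v"
  unfolding minus_h10_def h10_deriv_add h10_deriv_scale by simp

lemma fun_of_diff: "fun_of (u - v) x = fun_of u x - fun_of v x"
  unfolding minus_h10_def plus_h10.rep_eq scaleR_h10.rep_eq by simp

text \<open>In the limit this is u(x) = - (integral of u' from x to 1) with Cauchy-Schwarz. A
  transition from 0 to 1 across [x, x + e] replaces the indicator of [x,1]: its derivative is an
  approximate identity at x and its L^2 norm is at most 1.\<close>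

lemma fun_of_bound: "\<bar>fun_of u x\<bar> \<le> norm u"
proof (cases "x \<in> {0<..<1}")
  case True
  obtain g where g: "sq_integrable g" "weak_derivative (fun_of u) g" "h10_deriv u = to_l2 g"
    by (rule h10_derivE)
  have sqc: "sq_integrable p" if "\<And>S. continuous_on S p" for p
    by (rule sq_integrable_continuous) (rule that)
  have "\<bar>fun_of u x\<bar> \<le> norm u + r" if r: "0 < r" for r
  proof -
    have "\<exists>d>0. \<forall>y. \<bar>y - x\<bar> < d \<longrightarrow> \<bar>fun_of u y - fun_of u x\<bar> < r"
      using fun_of_continuous[of UNIV u] r unfolding continuous_on_iff by (auto simp: dist_real_def)
    then obtain d where d: "0 < d" "\<And>y. \<bar>y - x\<bar> < d \<Longrightarrow> \<bar>fun_of u y - fun_of u x\<bar> < r" by blast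
    \<comment> \<open>Besides continuity, \<open>e \<le> 1 - x\<close> completes the transition
      before 1, so that the derivative has mass exactly 1.\<close>
    define e where "e = min d (1 - x)"
    have e: "0 < e" "e \<le> d" "e \<le> 1 - x" using d True by (auto simp: e_def)
    define p where "p = 1 / e"
    define q where "q = - x / e"
    have p: "0 < p" using e by (simp add: p_def)
    have arg: "p * y + q = (y - x) / e" for y by (simp add: p_def q_def diff_divide_distrib)
    let ?s = "\<lambda>y. step' (p * y + q) * p"
    have eq: "(\<integral>y. fun_of u y * (?s y) \<partial>leb01) = - (\<integral>y. g y * step (p * y + q) \<partial>leb01)"
      by (rule weak_derivative_C1[OF fun_of_continuous fun_of_outside g(1,2) DERIV_step_affine])
         (auto intro!: continuous_intros continuous_on_step_affine)
    have int: "(\<integral>y. ?s y \<partial>leb01) = 1"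
      unfolding integral_step'_affine using e True arg[of 1] by (simp add: q_def step_eq_0 step_eq_1)
    have sS: "sq_integrable (\<lambda>y. ?s y)"
      by (intro sqc continuous_intros continuous_on_step_affine)
    have iS: "integrable leb01 (\<lambda>y. ?s y)"
      by (rule sq_integrable_integrable[OF sS])
    have i1: "integrable leb01 (\<lambda>y. fun_of u y * (?s y))"
      by (rule sq_integrable_mult[OF fun_of_sq_integrable sS])
    have i2: "integrable leb01 (\<lambda>y. (fun_of u y - fun_of u x) * (?s y))"
      using i1 iS by (simp add: left_diff_distrib)
    have "\<bar>(fun_of u y - fun_of u x) * (?s y)\<bar> \<le> r * (?s y)" for y
    proof (cases "step' (p * y + q) = 0")
      case False
      then have "0 < (y - x) / e" "(y - x) / e < 1" using step'_eq_0[of "p * y + q"] arg[of y] by force+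
      then have "\<bar>y - x\<bar> < d" using e by (auto simp: field_simps)
      then have "\<bar>fun_of u y - fun_of u x\<bar> \<le> r" using d(2) by (simp add: less_imp_le)
      then show ?thesis using p by (simp add: abs_mult step'_nonneg mult_right_mono)
    qed simp
    then have "norm (\<integral>y. (fun_of u y - fun_of u x) * (?s y) \<partial>leb01)
        \<le> (\<integral>y. r * (?s y) \<partial>leb01)"
      using iS by (intro Bochner_Integration.integral_norm_bound_integral[OF i2]) auto
    also have "\<dots> = r" using int by simp
    finally have "norm (\<integral>y. (fun_of u y - fun_of u x) * (?s y) \<partial>leb01) \<le> r" .
    moreover have "(\<integral>y. (fun_of u y - fun_of u x) * (?s y) \<partial>leb01) =
        (\<integral>y. fun_of u y * (?s y) \<partial>leb01) - fun_of u x"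
      unfolding left_diff_distrib using i1 iS int by simp
    moreover have "\<bar>\<integral>y. g y * step (p * y + q) \<partial>leb01\<bar> \<le> norm u"
    proof -
      have sst: "sq_integrable (\<lambda>y. step (p * y + q))" by (intro sqc continuous_on_step_affine)
      have "\<bar>inner (h10_deriv u) (to_l2 (\<lambda>y. step (p * y + q)))\<bar> \<le> norm (h10_deriv u) * norm (to_l2 (\<lambda>y. step (p * y + q)))"
        by (rule Cauchy_Schwarz_ineq2)
      also have "\<dots> \<le> norm u * 1"
        by (intro mult_mono h10_norm_bounds to_l2_norm_le sst) (auto simp: step_nonneg step_le_1)
      finally show ?thesis using g by (simp add: to_l2_inner sst)
    qed
    ultimately show ?thesis using eq by (simp add: abs_le_iff)
  qed
  then show ?thesis by (rule field_le_epsilon)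
qed (simp add: fun_of_outside)

text \<open>The supremum bound makes the functions converge uniformly, which preserves continuity
  and the zero values outside (0,1). The derivatives converge in L^2, and the weak derivative
  identity, written with inner products, passes to the limit.\<close>

instance h10 :: complete_space
proof
  fix X :: "nat \<Rightarrow> h10" assume C: "Cauchy X"
  have "Cauchy (\<lambda>n. h10_deriv (X n))"
    by (rule bounded_linear.Cauchy[OF bounded_linear_h10_deriv C])
  then obtain G where G: "(\<lambda>n. h10_deriv (X n)) \<longlonglongrightarrow> G"
    using Cauchy_convergent_iff convergent_def by blast
  obtain g where g: "sq_integrable g" "G = to_l2 g" by (rule to_l2_cases)
  have "uniformly_Cauchy_on UNIV (\<lambda>n. fun_of (X n))"
  proof (rule uniformly_Cauchy_onI)
    fix e :: real assume "0 < e"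
    then obtain M where "\<And>m n. M \<le> m \<Longrightarrow> M \<le> n \<Longrightarrow> norm (X m - X n) < e"
      using CauchyD[OF C] by blast
    then have "\<forall>x\<in>UNIV. \<forall>m\<ge>M. \<forall>n\<ge>M. dist (fun_of (X m) x) (fun_of (X n) x) < e"
      using fun_of_bound fun_of_diff by (metis dist_real_def le_less_trans)
    then show "\<exists>M. \<forall>x\<in>UNIV. \<forall>m\<ge>M. \<forall>n\<ge>M. dist (fun_of (X m) x) (fun_of (X n) x) < e" by blast
  qed
  then have "uniformly_convergent_on UNIV (\<lambda>n. fun_of (X n))"
    by (rule Cauchy_uniformly_convergent)
  then obtain v where v: "uniform_limit UNIV (\<lambda>n. fun_of (X n)) v sequentially"
    unfolding uniformly_convergent_on_def by blast
  have vc: "continuous_on UNIV v"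
    by (rule uniform_limit_theorem[OF _ v]) (auto simp: fun_of_continuous)
  have v0: "v x = 0" if "x \<notin> {0<..<1}" for x
    using tendsto_uniform_limitI[OF v, of x] fun_of_outside[OF that] by (simp add: LIMSEQ_const_iff)
  have sv: "sq_integrable v"
    by (rule sq_integrable_continuous) (rule continuous_on_subset[OF vc subset_UNIV])
  have Xv: "(\<lambda>n. h10_to_l2 (X n)) \<longlonglongrightarrow> to_l2 v"
  proof (rule metric_LIMSEQ_I)
    fix r :: real assume r: "0 < r"
    then have "\<forall>\<^sub>F n in sequentially. \<forall>x. dist (fun_of (X n) x) (v x) < r / 2"
      using uniform_limitD[OF v, of "r/2"] by simp
    then obtain n0 where n0: "\<And>n x. n0 \<le> n \<Longrightarrow> \<bar>fun_of (X n) x - v x\<bar> < r / 2"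
      unfolding eventually_sequentially dist_real_def by blast
    have "dist (h10_to_l2 (X n)) (to_l2 v) < r" if "n0 \<le> n" for n
    proof -
      have "norm (to_l2 (\<lambda>x. fun_of (X n) x - v x)) \<le> r / 2"
        by (intro to_l2_norm_le sq_integrable_diff fun_of_sq_integrable sv)
           (use n0[OF that] r in \<open>auto simp: less_imp_le\<close>)
      then show ?thesis
        using r by (simp add: dist_norm h10_to_l2_def to_l2_diff[OF fun_of_sq_integrable sv])
    qed
    then show "\<exists>n0. \<forall>n\<ge>n0. dist (h10_to_l2 (X n)) (to_l2 v) < r" by blast
  qed
  have wd: "weak_derivative v g"
    unfolding weak_derivative_def
  proof (intro allI impI)
    fix \<phi> \<phi>' assume t: "test_function \<phi> \<phi>'"
    note s = test_function_sq_integrable[OF t]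
    have eq: "inner (h10_to_l2 (X n)) (to_l2 \<phi>') = - inner (h10_deriv (X n)) (to_l2 \<phi>)" for n
    proof -
      obtain k where k: "sq_integrable k" "weak_derivative (fun_of (X n)) k" "h10_deriv (X n) = to_l2 k"
        by (rule h10_derivE)
      show ?thesis
        using k(2) t by (simp add: h10_to_l2_def k to_l2_inner s fun_of_sq_integrable weak_derivative_def)
    qed
    have "(\<lambda>n. inner (h10_to_l2 (X n)) (to_l2 \<phi>')) \<longlonglongrightarrow> inner (to_l2 v) (to_l2 \<phi>')"
      by (intro tendsto_intros Xv)
    moreover have "(\<lambda>n. inner (h10_to_l2 (X n)) (to_l2 \<phi>')) \<longlonglongrightarrow> - inner G (to_l2 \<phi>)"
      unfolding eq by (intro tendsto_intros G)
    ultimately have "inner (to_l2 v) (to_l2 \<phi>') = - inner G (to_l2 \<phi>)"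
      by (rule LIMSEQ_unique)
    then show "(\<integral>x. v x * \<phi>' x \<partial>leb01) = - (\<integral>x. g x * \<phi> x \<partial>leb01)"
      by (simp add: g to_l2_inner s sv)
  qed
  define V where "V = h10_of v"
  have V: "fun_of V = v"
    unfolding V_def using vc v0 g(1) wd by (intro h10_of_inverse) auto
  have VG: "h10_deriv V = G"
    unfolding g(2) by (rule h10_deriv_eqI) (auto simp: V g wd)
  have "(\<lambda>n. (norm (h10_to_l2 (X n) - to_l2 v))\<^sup>2 + (norm (h10_deriv (X n) - G))\<^sup>2) \<longlonglongrightarrow> 0\<^sup>2 + 0\<^sup>2"
    by (intro tendsto_intros tendsto_norm_zero LIM_zero Xv G)
  moreover have "(norm (X n - V))\<^sup>2 = (norm (h10_to_l2 (X n) - to_l2 v))\<^sup>2 + (norm (h10_deriv (X n) - G))\<^sup>2" for n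
    by (simp add: h10_norm_sq h10_to_l2_diff h10_deriv_diff VG h10_to_l2_def[of V] V)
  ultimately have "(\<lambda>n. (norm (X n - V))\<^sup>2) \<longlonglongrightarrow> 0" by simp
  then have "(\<lambda>n. sqrt ((norm (X n - V))\<^sup>2)) \<longlonglongrightarrow> sqrt 0" by (rule tendsto_real_sqrt)
  then have "X \<longlonglongrightarrow> V" by (simp add: tendsto_norm_zero_iff LIM_zero_iff)
  then show "convergent X" by (rule convergentI)
qed

instance h10 :: banach ..

section \<open>Sine coefficients in \<open>H\<^sup>1\<^sub>0(0,1)\<close>\<close>

abbreviation lapl :: "nat \<Rightarrow> real" where
  "lapl k \<equiv> (real (Suc k) * pi)\<^sup>2"

declare of_nat_Suc [simp del]

definition coef :: "h10 \<Rightarrow> nat \<Rightarrow> real" where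
  "coef u k = cf (h10_to_l2 u) k"

abbreviation h1_term :: "h10 \<Rightarrow> nat \<Rightarrow> real" where
  "h1_term u k \<equiv> (1 + lapl k) * (coef u k)\<^sup>2"

lemma coef_diff: "coef (u - v) k = coef u k - coef v k"
  by (simp add: coef_def h10_to_l2_diff inner_diff_left)

lemma coef_scale: "coef (c *\<^sub>R u) k = c * coef u k"
  by (simp add: coef_def h10_to_l2_scale)

definition mode' :: "nat \<Rightarrow> real \<Rightarrow> real" where
  "mode' k x = sqrt 2 * (real (Suc k) * pi) * cos (real (Suc k) * pi * x)"

lemma DERIV_mode: "(mode k has_real_derivative mode' k x) (at x within S)"
  unfolding mode_def[abs_def] mode'_def by (auto intro!: derivative_eq_intros)

lemma DERIV_mode': "(mode' k has_real_derivative - (lapl k * mode k x)) (at x within S)"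
  unfolding mode'_def[abs_def] mode_def
  by (auto intro!: derivative_eq_intros simp: power2_eq_square)

lemma continuous_on_mode': "continuous_on S (mode' k)"
  unfolding mode'_def[abs_def] by (intro continuous_intros)

lemma mode_boundary: "mode k 0 = 0" "mode k 1 = 0"
  using sin_npi[of "Suc k"] by (simp_all add: mode_def)

text \<open>Clamping the argument to [0,1] is extension by zero, because the sine vanishes at both
  ends; continuity on the line then comes from a composition.\<close>

definition h10_mode :: "nat \<Rightarrow> h10" where
  "h10_mode k = h10_of (\<lambda>x. mode k (max 0 (min 1 x)))"

lemma weak_derivative_mode: "weak_derivative (\<lambda>x. mode k (max 0 (min 1 x))) (mode' k)"
  unfolding weak_derivative_def
proof (intro allI impI)
  fix \<phi> \<phi>' assume t: "test_function \<phi> \<phi>'"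
  have d: "(\<phi> has_real_derivative \<phi>' x) (at x within S)" for x S
    using t unfolding test_function_def by (blast intro: DERIV_subset)
  have c: "continuous_on S \<phi>'" for S
    using t unfolding test_function_def by (blast intro: continuous_on_subset)
  have "(\<integral>x. mode' k x * \<phi> x + \<phi>' x * mode k x \<partial>leb01) = mode k 1 * \<phi> 1 - mode k 0 * \<phi> 0"
    by (rule integral_leb01_FTC)
       (auto intro!: DERIV_mult DERIV_mode d continuous_intros continuous_on_mode continuous_on_mode' c
         test_function_continuous[OF t])
  moreover have "integrable leb01 (\<lambda>x. mode' k x * \<phi> x)" "integrable leb01 (\<lambda>x. \<phi>' x * mode k x)"
    by (intro sq_integrable_mult sq_integrable_mode test_function_sq_integrable[OF t]
        sq_integrable_continuous continuous_on_mode')+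
  moreover have "(\<integral>x. mode k (max 0 (min 1 x)) * \<phi>' x \<partial>leb01) = (\<integral>x. \<phi>' x * mode k x \<partial>leb01)"
    by (rule Bochner_Integration.integral_cong) (auto simp: space_restrict_space)
  ultimately show "(\<integral>x. mode k (max 0 (min 1 x)) * \<phi>' x \<partial>leb01) = - (\<integral>x. mode' k x * \<phi> x \<partial>leb01)"
    by (simp add: mode_boundary)
qed

lemma fun_of_mode: "fun_of (h10_mode k) = (\<lambda>x. mode k (max 0 (min 1 x)))"
  unfolding h10_mode_def
proof (rule h10_of_inverse, rule CollectI, intro conjI)
  show "continuous_on UNIV (\<lambda>x. mode k (max 0 (min 1 x)))"
    by (rule continuous_on_compose2[OF continuous_on_mode[of UNIV]]) (auto intro!: continuous_intros)
  show "\<forall>x. x \<notin> {0<..<1} \<longrightarrow> mode k (max 0 (min 1 x)) = 0"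
    by (auto simp: mode_boundary max_def min_def)
  show "\<exists>g. sq_integrable g \<and> weak_derivative (\<lambda>x. mode k (max 0 (min 1 x))) g"
    using weak_derivative_mode sq_integrable_continuous[OF continuous_on_mode'] by blast
qed

lemma h10_to_l2_mode: "h10_to_l2 (h10_mode k) = dirichlet_mode k"
  unfolding h10_to_l2_def dirichlet_mode_eq
  by (rule to_l2_cong[OF fun_of_sq_integrable sq_integrable_mode]) (auto simp: fun_of_mode)

lemma h10_deriv_mode: "h10_deriv (h10_mode k) = to_l2 (mode' k)"
  by (rule h10_deriv_eqI) (auto simp: fun_of_mode weak_derivative_mode
      intro: sq_integrable_continuous[OF continuous_on_mode'])

text \<open>The weak form of -e'' = \<mu> e for the mode e. Here \<open>mode'\<close> plays the part
  of the test function, and as a cosine it does not vanish at the endpoints; this is what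
  \<open>weak_derivative_C1\<close> is for.\<close>

lemma inner_h10_mode: "inner u (h10_mode k) = (1 + lapl k) * coef u k"
proof -
  obtain g where g: "sq_integrable g" "weak_derivative (fun_of u) g" "h10_deriv u = to_l2 g"
    by (rule h10_derivE)
  have "(\<integral>x. fun_of u x * - (lapl k * mode k x) \<partial>leb01) = - (\<integral>x. g x * mode' k x \<partial>leb01)"
    by (rule weak_derivative_C1[OF fun_of_continuous fun_of_outside g(1,2) DERIV_mode'])
       (auto intro!: continuous_intros continuous_on_mode)
  moreover have "(\<integral>x. fun_of u x * - (lapl k * mode k x) \<partial>leb01) = - (lapl k * (\<integral>x. fun_of u x * mode k x \<partial>leb01))"
  proof -
    have "(\<integral>x. fun_of u x * - (lapl k * mode k x) \<partial>leb01) = (\<integral>x. - lapl k * (fun_of u x * mode k x) \<partial>leb01)"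
      by (rule Bochner_Integration.integral_cong) (simp_all add: mult.left_commute)
    also have "\<dots> = - lapl k * (\<integral>x. fun_of u x * mode k x \<partial>leb01)"
      by (rule integral_mult_right_zero)
    finally show ?thesis by simp
  qed
  ultimately have "inner (h10_deriv u) (to_l2 (mode' k)) = lapl k * coef u k"
    by (simp add: g to_l2_inner coef_def h10_to_l2_def dirichlet_mode_eq sq_integrable_mode fun_of_sq_integrable
        sq_integrable_continuous[OF continuous_on_mode'])
  then show ?thesis
    by (simp add: inner_h10_def h10_to_l2_mode h10_deriv_mode coef_def distrib_right)
qed

lemma coef_mode: "coef (h10_mode i) j = (if i = j then 1 else 0)"
  by (simp add: coef_def h10_to_l2_mode inner_dirichlet_mode)

lemma lapl_pos: "0 < lapl k"
  by simp

lemma coef_eqI: "(\<And>k. coef u k = coef v k) \<Longrightarrow> u = v"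
proof -
  assume "\<And>k. coef u k = coef v k"
  then have "h10_to_l2 (u - v) = 0"
    by (intro dirichlet_mode_separating)
       (simp add: h10_to_l2_diff inner_diff_left coef_def)
  then show "u = v" using h10_to_l2_eq_0 by force
qed

lemma inner_h10_basis: "inner u (h10_mode k /\<^sub>R sqrt (1 + lapl k)) = sqrt (1 + lapl k) * coef u k"
proof -
  have "0 \<le> 1 + lapl k" using lapl_pos[of k] by linarith
  then have "(1 + lapl k) / sqrt (1 + lapl k) = sqrt (1 + lapl k)" by (rule real_div_sqrt)
  moreover have "inner u (h10_mode k /\<^sub>R sqrt (1 + lapl k)) = (1 + lapl k) / sqrt (1 + lapl k) * coef u k"
    unfolding inner_scaleR_right inner_h10_mode by (simp only: divide_inverse mult_ac)
  ultimately show ?thesis by simp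
qed

text \<open>The mode has squared norm \<open>1 + lapl k\<close> in H^1_0, hence the rescaling.
  Orthogonality to all modes forces all L^2 coefficients to vanish, so completeness is inherited
  from L^2.\<close>

interpretation h10: orthonormal_basis "\<lambda>k. h10_mode k /\<^sub>R sqrt (1 + lapl k)"
proof
  fix i j
  have "sqrt (1 + lapl j) \<noteq> 0" using lapl_pos[of j] by (metis add_pos_pos less_irrefl real_sqrt_eq_zero_cancel_iff zero_less_one)
  then show "inner (h10_mode i /\<^sub>R sqrt (1 + lapl i)) (h10_mode j /\<^sub>R sqrt (1 + lapl j)) = (if i = j then 1 else 0)"
    unfolding inner_h10_basis coef_scale coef_mode by simp
next
  fix v assume v: "\<And>k. inner v (h10_mode k /\<^sub>R sqrt (1 + lapl k)) = 0"
  have "coef v k = coef 0 k" for k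
  proof -
    have "sqrt (1 + lapl k) \<noteq> 0" using lapl_pos[of k] by (metis add_pos_pos less_irrefl real_sqrt_eq_zero_cancel_iff zero_less_one)
    then show ?thesis
      using v[of k] coef_scale[of 0 0 k] unfolding inner_h10_basis by simp
  qed
  then show "v = 0" by (rule coef_eqI)
qed

lemma h10_parseval: "(\<lambda>k. (1 + lapl k) * (coef u k)\<^sup>2) sums (norm u)\<^sup>2"
proof -
  have "(sqrt (1 + lapl k) * coef u k)\<^sup>2 = (1 + lapl k) * (coef u k)\<^sup>2" for k
    using lapl_pos[of k] by (simp add: power_mult_distrib)
  then show ?thesis using h10.parseval[of u] unfolding inner_h10_basis by simp
qed

lemma h10_riesz_fischer:
  assumes "summable (\<lambda>k. (1 + lapl k) * (c k)\<^sup>2)"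
  obtains u where "\<And>k. coef u k = c k"
proof -
  have pos: "0 < sqrt (1 + lapl k)" for k using lapl_pos[of k] by (simp only: real_sqrt_gt_zero add_pos_pos zero_less_one)
  have "(sqrt (1 + lapl k) * c k)\<^sup>2 = (1 + lapl k) * (c k)\<^sup>2" for k
    using lapl_pos[of k] by (simp add: power_mult_distrib)
  then have "summable (\<lambda>k. (sqrt (1 + lapl k) * c k)\<^sup>2)" using assms by simp
  then obtain u where u: "\<And>k. inner u (h10_mode k /\<^sub>R sqrt (1 + lapl k)) = sqrt (1 + lapl k) * c k"
    by (rule h10.riesz_fischer) blast
  have "coef u k = c k" for k
    using u[of k] pos[of k] unfolding inner_h10_basis by simp
  then show thesis by (rule that)
qed

text \<open>Tannery's theorem, that is dominated convergence for series, applied to the Parseval sum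
  of \<open>x i - y\<close>; the factor 4 covers the square of the sum of the two bounds
  \<open>M k\<close>. It yields time continuity of the semigroup and its approximation by
  resolvents.\<close>

lemma (in orthonormal_basis) dominated_convergence_basis:
  assumes F: "F \<noteq> bot"
    and lim: "\<And>k. ((\<lambda>i. inner (x i) (e k)) \<longlongrightarrow> inner y (e k)) F"
    and bound: "\<forall>\<^sub>F i in F. \<forall>k. \<bar>inner (x i) (e k)\<bar> \<le> M k"
    and M: "summable (\<lambda>k. (M k)\<^sup>2)"
  shows "(x \<longlongrightarrow> y) F"
proof -
  have y: "\<bar>inner y (e k)\<bar> \<le> M k" for k
    by (rule tendsto_upperbound[OF tendsto_rabs[OF lim] _ F]) (use bound in \<open>auto elim: eventually_mono\<close>)
  have "((\<lambda>i. \<Sum>k. (inner (x i - y) (e k))\<^sup>2) \<longlongrightarrow> (\<Sum>k::nat. (0::real))) F"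
  proof (rule tannerys_theorem[where M = "\<lambda>k. 4 * (M k)\<^sup>2", THEN conjunct2, THEN conjunct2])
    show "((\<lambda>i. (inner (x i - y) (e k))\<^sup>2) \<longlongrightarrow> 0) F" for k
      using tendsto_power[OF LIM_zero[OF lim[of k]], of 2] by (simp add: inner_diff_left)
    have "\<forall>\<^sub>F i in F. \<forall>k. norm ((inner (x i - y) (e k))\<^sup>2) \<le> 4 * (M k)\<^sup>2"
      using bound
    proof eventually_elim
      case (elim i)
      show ?case
      proof
        fix k
        have "\<bar>inner (x i - y) (e k)\<bar> \<le> \<bar>2 * M k\<bar>"
          using elim[rule_format, of k] y[of k] by (simp add: inner_diff_left)
        then have "(inner (x i - y) (e k))\<^sup>2 \<le> (2 * M k)\<^sup>2" by (rule abs_le_square_iff[THEN iffD1])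
        then show "norm ((inner (x i - y) (e k))\<^sup>2) \<le> 4 * (M k)\<^sup>2" by (simp add: power_mult_distrib)
      qed
    qed
    then show "\<forall>\<^sub>F (k, i) in at_top \<times>\<^sub>F F. norm ((inner (x i - y) (e k))\<^sup>2) \<le> 4 * (M k)\<^sup>2"
      unfolding eventually_prod_filter
      by (intro exI[of _ "\<lambda>_. True"] exI[of _ "\<lambda>i. \<forall>k. norm ((inner (x i - y) (e k))\<^sup>2) \<le> 4 * (M k)\<^sup>2"]) auto
  qed (use M F in \<open>auto intro: summable_mult\<close>)
  then have "((\<lambda>i. (norm (x i - y))\<^sup>2) \<longlongrightarrow> 0) F"
    using sums_unique[OF parseval] by simp
  then have "((\<lambda>i. sqrt ((norm (x i - y))\<^sup>2)) \<longlongrightarrow> sqrt 0) F"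
    by (rule tendsto_real_sqrt)
  then show ?thesis by (simp add: tendsto_norm_zero_iff LIM_zero_iff)
qed

text \<open>This takes the place of a compact embedding into \<open>H\<^sup>1\<^sub>0\<close>.\<close>

lemma h10_tail_convergence:
  fixes u :: "'i \<Rightarrow> h10"
  assumes F: "F \<noteq> bot" and \<tau>: "\<tau> \<longlonglongrightarrow> 0"
    and tail: "\<forall>\<^sub>F i in F. \<forall>N n. (\<Sum>k\<in>{N..<n}. h1_term (u i) k) \<le> \<tau> N"
    and lim: "\<And>k. ((\<lambda>i. coef (u i) k) \<longlongrightarrow> c k) F"
  obtains v where "\<And>k. coef v k = c k" "(u \<longlongrightarrow> v) F"
proof -
  let ?d = "\<lambda>i k. (1 + lapl k) * (coef (u i) k - c k)\<^sup>2" and ?c = "\<lambda>k. (1 + lapl k) * (c k)\<^sup>2"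
  have pos: "0 \<le> 1 + lapl k" for k using lapl_pos[of k] by linarith
  \<comment> \<open>Finite blocks pass to the limit, so the limiting coefficients obey the same tail
    bound and, with \<open>N = 0\<close>, belong to an element of H^1_0.\<close>
  have ctail: "(\<Sum>k\<in>{N..<n}. ?c k) \<le> \<tau> N" for N n
  proof (rule tendsto_upperbound[OF _ _ F])
    show "((\<lambda>i. \<Sum>k\<in>{N..<n}. h1_term (u i) k) \<longlongrightarrow> (\<Sum>k\<in>{N..<n}. ?c k)) F"
      by (intro tendsto_intros lim)
    show "\<forall>\<^sub>F i in F. (\<Sum>k\<in>{N..<n}. h1_term (u i) k) \<le> \<tau> N"
      using tail by eventually_elim simp
  qed
  have "summable (\<lambda>k. ?c k)"
  proof (rule bounded_imp_summable)
    show "0 \<le> ?c k" for k using pos[of k] by (intro mult_nonneg_nonneg) auto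
    show "(\<Sum>k\<le>n. ?c k) \<le> \<tau> 0" for n
      using ctail[of 0 "Suc n"] by (simp add: atLeast0LessThan lessThan_Suc_atMost)
  qed
  then obtain v where v: "\<And>k. coef v k = c k" by (rule h10_riesz_fischer) blast
  \<comment> \<open>Split at \<open>N\<close>: the head is a finite sum that tends to 0, and in the
    tail (p - q)^2 is at most 2 p^2 + 2 q^2, each square contributing at most
    \<open>\<tau> N\<close>.\<close>
  have bound: "(norm (u i - v))\<^sup>2 \<le> (\<Sum>k<N. ?d i k) + 4 * \<tau> N"
    if i: "\<forall>N n. (\<Sum>k\<in>{N..<n}. h1_term (u i) k) \<le> \<tau> N" for i N
  proof (rule LIMSEQ_le_const2)
    show "(\<lambda>n. \<Sum>k<n. h1_term (u i - v) k) \<longlonglongrightarrow> (norm (u i - v))\<^sup>2"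
      using h10_parseval[of "u i - v"] by (simp add: sums_def)
    have "(\<Sum>k<n. h1_term (u i - v) k) \<le> (\<Sum>k<N. ?d i k) + 4 * \<tau> N"
      if "N \<le> n" for n
    proof -
      have "(\<Sum>k\<in>{N..<n}. ?d i k) \<le>
          (\<Sum>k\<in>{N..<n}. 2 * (h1_term (u i) k) + 2 * (?c k))"
      proof (rule sum_mono)
        fix k
        have "(coef (u i) k - c k)\<^sup>2 \<le> 2 * (coef (u i) k)\<^sup>2 + 2 * (c k)\<^sup>2"
          using zero_le_power2[of "coef (u i) k + c k"] by (simp add: power2_sum power2_diff)
        then have "?d i k \<le> (1 + lapl k) * (2 * (coef (u i) k)\<^sup>2 + 2 * (c k)\<^sup>2)"
          by (rule mult_left_mono[OF _ pos])
        then show "?d i k \<le> 2 * (h1_term (u i) k) + 2 * (?c k)"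
          by (simp only: distrib_left mult.left_commute)
      qed
      also have "\<dots> \<le> 4 * \<tau> N"
        using i[rule_format, of N n] ctail[of N n] unfolding sum.distrib sum_distrib_left[symmetric] by linarith
      finally have "(\<Sum>k\<in>{N..<n}. ?d i k) \<le> 4 * \<tau> N" .
      moreover have "(\<Sum>k<n. ?d i k) =
          (\<Sum>k<N. ?d i k) + (\<Sum>k\<in>{N..<n}. ?d i k)"
        using sum.atLeastLessThan_concat[of 0 N n "\<lambda>k. ?d i k"] that
        by (simp only: atLeast0LessThan le0)
      ultimately show ?thesis unfolding coef_diff v by linarith
    qed
    then show "\<exists>n0. \<forall>n\<ge>n0. (\<Sum>k<n. h1_term (u i - v) k) \<le>
        (\<Sum>k<N. ?d i k) + 4 * \<tau> N" by blast
  qed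
  have "(u \<longlongrightarrow> v) F"
  proof (rule tendstoI)
    fix r :: real assume r: "0 < r"
    then have "\<forall>\<^sub>F N in sequentially. \<tau> N < r\<^sup>2 / 8"
      by (intro order_tendstoD(2)[OF \<tau>]) simp
    then obtain N where N: "\<tau> N < r\<^sup>2 / 8" by (auto simp: eventually_sequentially)
    have "((\<lambda>i. \<Sum>k<N. ?d i k) \<longlongrightarrow> (\<Sum>k<N. (1 + lapl k) * 0\<^sup>2)) F"
      by (intro tendsto_intros LIM_zero lim)
    then have "\<forall>\<^sub>F i in F. (\<Sum>k<N. ?d i k) < r\<^sup>2 / 2"
      by (rule order_tendstoD(2)) (use r in simp)
    with tail show "\<forall>\<^sub>F i in F. dist (u i) v < r"
    proof eventually_elim
      case (elim i)
      have "(norm (u i - v))\<^sup>2 < r\<^sup>2" using bound[OF elim(1), of N] elim(2) N by linarith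
      then show ?case unfolding dist_norm by (rule power2_less_imp_less) (use r in simp)
    qed
  qed
  with v show thesis by (rule that)
qed

lemma sum_coef_le_norm: "(\<Sum>k\<in>A. (cf v k)\<^sup>2) \<le> (norm v)\<^sup>2" if "finite A"
  using sum_le_suminf[OF sums_summable[OF dirichlet.parseval[of v]] that] sums_unique[OF dirichlet.parseval[of v]] by simp

section \<open>The variation of constants formula in coefficients\<close>

lemma inner_mode_le: "\<bar>cf v k\<bar> \<le> norm v"
  using Cauchy_Schwarz_ineq2[of v "dirichlet_mode k"] inner_dirichlet_mode[of k k]
  by (simp add: norm_eq_sqrt_inner)

lemma exp_lapl_le_1: "0 \<le> t \<Longrightarrow> exp (- (lapl k * t)) \<le> 1"
  using lapl_pos[of k] by simp

lemma exp_lapl_cancel: "exp (- (lapl k * t)) * (exp (lapl k * t) * x) = x"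
  by (simp add: mult.assoc[symmetric] exp_add[symmetric])

lemma exp_lapl_mult_sq_le:
  assumes "0 \<le> t"
  shows "(exp (- (lapl k * t)) * x)\<^sup>2 \<le> x\<^sup>2"
proof -
  have "exp (- (lapl k * t)) * \<bar>x\<bar> \<le> 1 * \<bar>x\<bar>"
    by (rule mult_right_mono[OF exp_lapl_le_1[OF assms]]) simp
  then show ?thesis
    by (intro abs_le_square_iff[THEN iffD1]) (simp only: abs_mult abs_exp_cancel mult_1)
qed

lemma inner_heat_semigroup:
  assumes "0 \<le> t"
  shows "cf (heat_semigroup t v) k = exp (- (lapl k * t)) * cf v k"
  unfolding heat_semigroup_def
proof (rule dirichlet.inner_suminf_basis)
  show "summable (\<lambda>k. (exp (- (lapl k * t)) * cf v k)\<^sup>2)"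
  proof (rule summable_comparison_test')
    show "summable (\<lambda>k. (cf v k)\<^sup>2)" by (rule dirichlet.bessel_summable)
    show "norm ((exp (- (lapl k * t)) * cf v k)\<^sup>2) \<le> (cf v k)\<^sup>2" if "0 \<le> k" for k
      using exp_lapl_mult_sq_le[OF assms] by simp
  qed
qed

lemma heat_semigroup_0: "heat_semigroup 0 v = v"
  by (rule dirichlet.basis_eqI) (simp add: inner_heat_semigroup)

lemma heat_semigroup_diff: "0 \<le> t \<Longrightarrow> heat_semigroup t (v - w) = heat_semigroup t v - heat_semigroup t w"
  by (rule dirichlet.basis_eqI) (simp add: inner_heat_semigroup inner_diff_left right_diff_distrib)

lemma norm_heat_semigroup_le:
  assumes "0 \<le> t"
  shows "norm (heat_semigroup t v) \<le> norm v"
proof -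
  have "(norm (heat_semigroup t v))\<^sup>2 \<le> (norm v)\<^sup>2"
    by (rule sums_le[OF _ dirichlet.parseval dirichlet.parseval])
       (simp only: inner_heat_semigroup[OF assms] exp_lapl_mult_sq_le[OF assms])
  then show ?thesis by (rule power2_le_imp_le) simp
qed

text \<open>For a fixed vector, strong continuity is dominated convergence of the coefficients;
  moving the vector costs at most \<open>norm (V i - v)\<close> because the semigroup
  contracts.\<close>

lemma tendsto_heat_semigroup:
  assumes F: "F \<noteq> bot" and T: "(T \<longlongrightarrow> t) F" "\<forall>\<^sub>F i in F. 0 \<le> T i" and V: "(V \<longlongrightarrow> v) F"
  shows "((\<lambda>i. heat_semigroup (T i) (V i)) \<longlongrightarrow> heat_semigroup t v) F"
proof -
  have t: "0 \<le> t" using tendsto_lowerbound[OF T(1) T(2) F] .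
  have 1: "((\<lambda>i. heat_semigroup (T i) v) \<longlongrightarrow> heat_semigroup t v) F"
  proof (rule dirichlet.dominated_convergence_basis[OF F])
    fix k
    have "((\<lambda>i. exp (- (lapl k * T i)) * cf v k) \<longlongrightarrow> exp (- (lapl k * t)) * cf v k) F"
      by (intro tendsto_intros T)
    then show "((\<lambda>i. cf (heat_semigroup (T i) v) k) \<longlongrightarrow> cf (heat_semigroup t v) k) F"
      unfolding inner_heat_semigroup[OF t]
      by (rule Lim_transform_eventually) (use T(2) in eventually_elim, simp add: inner_heat_semigroup)
    show "\<forall>\<^sub>F i in F. \<forall>k. \<bar>cf (heat_semigroup (T i) v) k\<bar> \<le> \<bar>cf v k\<bar>"
      using T(2)
    proof eventually_elim
      case (elim i)
      then show ?case
        using mult_right_mono[OF exp_lapl_le_1[OF elim] abs_ge_zero]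
        by (simp add: inner_heat_semigroup abs_mult)
    qed
    show "summable (\<lambda>k. \<bar>cf v k\<bar>\<^sup>2)"
      using dirichlet.bessel_summable by simp
  qed
  have 2: "((\<lambda>i. heat_semigroup (T i) (V i) - heat_semigroup (T i) v) \<longlongrightarrow> 0) F"
  proof (rule Lim_null_comparison)
    show "\<forall>\<^sub>F i in F. norm (heat_semigroup (T i) (V i) - heat_semigroup (T i) v) \<le> norm (V i - v)"
      using T(2) by eventually_elim (metis heat_semigroup_diff norm_heat_semigroup_le)
    show "((\<lambda>i. norm (V i - v)) \<longlongrightarrow> 0) F" by (intro tendsto_norm_zero LIM_zero V)
  qed
  show ?thesis using tendsto_add[OF 1 2] by simp
qed

lemma continuous_on_heat_semigroup:
  assumes F: "continuous_on {s..t} F"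
  shows "continuous_on {s..t} (\<lambda>r. heat_semigroup (t - r) (F r))"
  unfolding continuous_on_def
proof
  fix r assume r: "r \<in> {s..t}"
  show "((\<lambda>r. heat_semigroup (t - r) (F r)) \<longlongrightarrow> heat_semigroup (t - r) (F r)) (at r within {s..t})"
  proof (cases "at r within {s..t} = bot")
    case False
    show ?thesis
    proof (rule tendsto_heat_semigroup[OF False])
      show "(F \<longlongrightarrow> F r) (at r within {s..t})" using F r by (simp add: continuous_on_def)
      show "\<forall>\<^sub>F r in at r within {s..t}. 0 \<le> t - r" by (auto simp: eventually_at_filter)
    qed (intro tendsto_intros)
  qed simp
qed

text \<open>The integral commutes with inner products, and an identity in L^2 holds iff it holds for
  every coefficient. The parameter \<gamma> serves the operator shifted by -\<gamma>; \<gamma> = 0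
  is the original formula.\<close>

lemma has_integral_heat_iff:
  assumes st: "s \<le> t" and F: "continuous_on {s..t} F"
  shows "((\<lambda>r. exp (- (\<gamma> * (t - r))) *\<^sub>R heat_semigroup (t - r) (F r)) has_integral
            y - exp (- (\<gamma> * (t - s))) *\<^sub>R heat_semigroup (t - s) x) {s..t} \<longleftrightarrow>
         (\<forall>k. exp ((lapl k + \<gamma>) * t) * cf y k =
              exp ((lapl k + \<gamma>) * s) * cf x k +
              integral {s..t} (\<lambda>r. exp ((lapl k + \<gamma>) * r) * cf (F r) k))"
    (is "(?G has_integral ?Y) _ \<longleftrightarrow> _")
proof -
  let ?x = "\<lambda>k r. exp ((lapl k + \<gamma>) * r)"
  have "continuous_on {s..t} ?G"
    by (intro continuous_intros continuous_on_heat_semigroup F)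
  then have G: "(?G has_integral integral {s..t} ?G) {s..t}"
    by (intro integrable_integral integrable_continuous_real)
  have "(?G has_integral ?Y) {s..t} \<longleftrightarrow> integral {s..t} ?G = ?Y"
    by (rule iffI) (rule integral_unique, assumption, use G in simp)
  also have "\<dots> \<longleftrightarrow> (\<forall>k. cf (integral {s..t} ?G) k = cf ?Y k)"
    by (rule iffI) (simp, rule dirichlet.basis_eqI, blast)
  also have "\<dots> \<longleftrightarrow> (\<forall>k. ?x k t * cf y k =
              ?x k s * cf x k +
              integral {s..t} (\<lambda>r. ?x k r * cf (F r) k))"
  proof (rule all_cong1)
    fix k
    let ?I = "integral {s..t} (\<lambda>r. ?x k r * cf (F r) k)"
    have e: "exp (- (\<gamma> * (t - r))) * exp (- (lapl k * (t - r))) = exp (- ((lapl k + \<gamma>) * t)) * ?x k r" for r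
      by (simp add: exp_add[symmetric] algebra_simps)
    have "cf (integral {s..t} ?G) k = integral {s..t} (\<lambda>r. cf (?G r) k)"
      using has_integral_linear[OF G bounded_linear_inner_left[of "dirichlet_mode k"]]
      by (simp add: o_def integral_unique)
    also have "\<dots> = integral {s..t} (\<lambda>r. exp (- ((lapl k + \<gamma>) * t)) * (?x k r * cf (F r) k))"
      by (rule integral_cong)
         (simp add: inner_heat_semigroup mult.assoc[symmetric] e)
    also have "\<dots> = exp (- ((lapl k + \<gamma>) * t)) * ?I" by (rule integral_mult_right)
    finally have 1: "cf (integral {s..t} ?G) k = exp (- ((lapl k + \<gamma>) * t)) * ?I" .
    have 2: "cf ?Y k = cf y k -
        exp (- ((lapl k + \<gamma>) * t)) * (?x k s * cf x k)"
      using st e[of s] by (simp add: inner_diff_left inner_heat_semigroup mult.assoc[symmetric])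
    have ne: "?x k t \<noteq> 0" and inv: "exp (- ((lapl k + \<gamma>) * t)) = 1 / ?x k t"
      by (simp_all add: exp_minus inverse_eq_divide)
    show "(cf (integral {s..t} ?G) k = cf ?Y k) \<longleftrightarrow>
        ?x k t * cf y k = ?x k s * cf x k + ?I"
      unfolding 1 2 inv using ne by (auto simp: field_simps)
  qed
  finally show ?thesis .
qed

text \<open>The coefficients of the variation of constants formula, multiplied by \<open>e\<^bsup>\<mu>t\<^esup>\<close> for the eigenvalue
  \<open>-\<mu>\<close>; in this form it is additive in time, and \<open>e\<^bsup>\<mu>t\<^esup> coef (u t)\<close> is Lipschitz.\<close>

definition duhamel :: "(real \<Rightarrow> l2) \<Rightarrow> real \<Rightarrow> real \<Rightarrow> (real \<Rightarrow> h10) \<Rightarrow> bool" where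
  "duhamel F s t u \<longleftrightarrow> (\<forall>k. exp (lapl k * t) * coef (u t) k =
     exp (lapl k * s) * coef (u s) k + integral {s..t} (\<lambda>r. exp (lapl k * r) * cf (F r) k))"

lemma has_integral_heat_iff_duhamel:
  assumes "s \<le> t" "continuous_on {s..t} F"
  shows "((\<lambda>r. heat_semigroup (t - r) (F r)) has_integral
            h10_to_l2 (u t) - heat_semigroup (t - s) (h10_to_l2 (u s))) {s..t} \<longleftrightarrow> duhamel F s t u"
  using has_integral_heat_iff[OF assms, of 0] by (simp add: duhamel_def coef_def)

lemmas integral_combine_Icc = Henstock_Kurzweil_Integration.integral_combine

lemma continuous_on_coef_integrand:
  "continuous_on S F \<Longrightarrow> continuous_on S (\<lambda>r. exp (c * r) * cf (F r) k)"
  by (intro continuous_intros)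

lemma duhamel_trans:
  assumes "s \<le> t" "t \<le> e" "continuous_on {s..e} F" "duhamel F s t u" "duhamel F t e u"
  shows "duhamel F s e u"
  unfolding duhamel_def
proof
  fix k
  have "integral {s..t} (\<lambda>r. exp (lapl k * r) * cf (F r) k) +
      integral {t..e} (\<lambda>r. exp (lapl k * r) * cf (F r) k) =
      integral {s..e} (\<lambda>r. exp (lapl k * r) * cf (F r) k)"
    using assms by (intro integral_combine_Icc integrable_continuous_real continuous_on_coef_integrand) auto
  then show "exp (lapl k * e) * coef (u e) k =
      exp (lapl k * s) * coef (u s) k + integral {s..e} (\<lambda>r. exp (lapl k * r) * cf (F r) k)"
    using assms(4,5) unfolding duhamel_def by (metis (no_types, lifting) add.assoc)
qed

lemma duhamel_cong:
  assumes "\<And>r. r \<in> {s..t} \<Longrightarrow> F r = G r" "u s = v s" "u t = v t"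
  shows "duhamel F s t u \<longleftrightarrow> duhamel G s t v"
proof -
  have "integral {s..t} (\<lambda>r. exp (lapl k * r) * cf (F r) k) =
      integral {s..t} (\<lambda>r. exp (lapl k * r) * cf (G r) k)" for k
    by (rule integral_cong) (simp add: assms)
  then show ?thesis unfolding duhamel_def assms(2,3) by simp
qed

text \<open>Adding \<gamma> u to the forcing and \<gamma> to every eigenvalue describes the same
  \<open>u\<close>. The formula at all intermediate times makes e^(\<mu> r) times the coefficient
  differentiable, and the product rule with e^(\<gamma> r) is integrated.\<close>

lemma duhamel_shift:
  assumes st: "s \<le> t" and F: "continuous_on {s..t} F" and d: "\<And>r. r \<in> {s..t} \<Longrightarrow> duhamel F s r u"
  shows "exp ((lapl k + \<gamma>) * t) * coef (u t) k = exp ((lapl k + \<gamma>) * s) * coef (u s) k +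
    integral {s..t} (\<lambda>r. exp ((lapl k + \<gamma>) * r) * cf (F r + \<gamma> *\<^sub>R h10_to_l2 (u r)) k)"
proof -
  let ?P = "\<lambda>r. exp (lapl k * r) * coef (u r) k"
  let ?f = "\<lambda>r. exp (lapl k * r) * cf (F r) k"
  have P: "?P r = exp (lapl k * s) * coef (u s) k + integral {s..r} ?f" if "r \<in> {s..t}" for r
    using d[OF that] unfolding duhamel_def by blast
  have dP: "(?P has_real_derivative ?f r) (at r within {s..t})" if r: "r \<in> {s..t}" for r
  proof -
    have "((\<lambda>r. integral {s..r} ?f) has_real_derivative ?f r) (at r within {s..t})"
      by (rule integral_has_real_derivative[OF continuous_on_coef_integrand[OF F] r])
    then have "((\<lambda>r. exp (lapl k * s) * coef (u s) k + integral {s..r} ?f) has_real_derivative 0 + ?f r) (at r within {s..t})"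
      by (intro DERIV_add DERIV_const)
    then have "((\<lambda>r. exp (lapl k * s) * coef (u s) k + integral {s..r} ?f) has_real_derivative ?f r) (at r within {s..t})"
      by simp
    then show ?thesis
      by (rule has_field_derivative_transform_within[OF _ zero_less_one r]) (rule P[symmetric])
  qed
  have "((\<lambda>r. exp (\<gamma> * r) * ?f r + exp (\<gamma> * r) * \<gamma> * ?P r) has_integral exp (\<gamma> * t) * ?P t - exp (\<gamma> * s) * ?P s) {s..t}"
  proof (rule fundamental_theorem_of_calculus[OF st])
    fix r assume r: "r \<in> {s..t}"
    have "((\<lambda>r. exp (\<gamma> * r)) has_real_derivative exp (\<gamma> * r) * \<gamma>) (at r within {s..t})"
      by (auto intro!: derivative_eq_intros)
    from DERIV_mult[OF this dP[OF r]]
    show "((\<lambda>r. exp (\<gamma> * r) * ?P r) has_vector_derivative exp (\<gamma> * r) * ?f r + exp (\<gamma> * r) * \<gamma> * ?P r) (at r within {s..t})"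
      unfolding has_real_derivative_iff_has_vector_derivative by (simp add: add.commute mult.commute)
  qed
  then have e1: "integral {s..t} (\<lambda>r. exp (\<gamma> * r) * ?f r + exp (\<gamma> * r) * \<gamma> * ?P r) = exp (\<gamma> * t) * ?P t - exp (\<gamma> * s) * ?P s"
    by (rule integral_unique)
  have e2: "(\<lambda>r. exp (\<gamma> * r) * ?f r + exp (\<gamma> * r) * \<gamma> * ?P r) =
      (\<lambda>r. exp ((lapl k + \<gamma>) * r) * cf (F r + \<gamma> *\<^sub>R h10_to_l2 (u r)) k)"
    by (rule ext) (simp add: coef_def exp_add distrib_right inner_add_left algebra_simps)
  have e3: "exp (\<gamma> * r) * ?P r = exp ((lapl k + \<gamma>) * r) * coef (u r) k" for r
    by (simp add: exp_add distrib_right)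
  show ?thesis using e1 unfolding e2 e3 by linarith
qed

section \<open>The heat semigroup contracts the supremum norm\<close>

text \<open>For continuous \<open>v\<close> this says \<open>\<bar>v\<bar> \<le> K\<close>, but as a family of bounds on linear functionals it passes
  to weak limits and to \<open>L\<^sup>2\<close>-valued integrals.\<close>

definition avg_bounded :: "real \<Rightarrow> l2 \<Rightarrow> bool" where
  "avg_bounded K v \<longleftrightarrow>
     (\<forall>c d. 0 \<le> c \<longrightarrow> c < d \<longrightarrow> d \<le> 1 \<longrightarrow> \<bar>inner v (to_l2 (indicator {c<..<d}))\<bar> \<le> K * (d - c))"

lemma sq_integrable_indicator: "sq_integrable (indicator {c<..<d::real})"
proof (rule sq_integrable_bounded[where B = 1])
  show "indicator {c<..<d} \<in> borel_measurable leb01"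
    by (intro measurable_restrict_space1 borel_measurable_indicator) simp
qed (simp add: indicator_def)

lemma integral_indicator_leb01:
  assumes "0 \<le> c" "c < d" "d \<le> 1"
  shows "(\<integral>x. indicator {c<..<d} x \<partial>leb01) = d - c"
proof -
  have "{c<..<d} \<subseteq> {0<..<1}" using assms by auto
  moreover from this have "{c<..<d} \<inter> {0<..<1} = {c<..<d}" by blast
  ultimately show ?thesis
    using assms by (simp add: measure_restrict_space space_restrict_space)
qed

lemma avg_bounded_to_l2:
  assumes u: "sq_integrable u" and K: "\<And>x. 0 < x \<Longrightarrow> x < 1 \<Longrightarrow> \<bar>u x\<bar> \<le> K"
  shows "avg_bounded K (to_l2 u)"
  unfolding avg_bounded_def
proof (intro allI impI)
  fix c d :: real assume cd: "0 \<le> c" "c < d" "d \<le> 1"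
  have i: "integrable leb01 (\<lambda>x. u x * indicator {c<..<d} x)"
    by (rule sq_integrable_mult[OF u sq_integrable_indicator])
  have "norm (\<integral>x. u x * indicator {c<..<d} x \<partial>leb01) \<le> (\<integral>x. K * indicator {c<..<d} x \<partial>leb01)"
    using K
    by (intro Bochner_Integration.integral_norm_bound_integral[OF i] integrable_mult_right
          sq_integrable_integrable[OF sq_integrable_indicator])
       (auto simp: space_restrict_space indicator_def)
  then show "\<bar>inner (to_l2 u) (to_l2 (indicator {c<..<d}))\<bar> \<le> K * (d - c)"
    by (simp only: to_l2_inner[OF u sq_integrable_indicator] integral_indicator_leb01[OF cd]
        integral_mult_right_zero real_norm_def)
qed

text \<open>A value above \<open>K\<close> persists on a small interval, whose average then exceeds
  \<open>K\<close>. The bound is one-sided and is applied to the function and its negative.\<close>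

lemma avg_bounded_imp_le:
  assumes u: "continuous_on {0..1} u" and K: "avg_bounded K (to_l2 u)" and x: "0 < x" "x < 1"
  shows "u x \<le> K"
proof (rule ccontr)
  assume "\<not> u x \<le> K"
  define e where "e = (u x - K) / 2"
  have e: "0 < e" "K + e + e = u x" using \<open>\<not> u x \<le> K\<close> by (auto simp: e_def)
  have su: "sq_integrable u" by (rule sq_integrable_continuous[OF u])
  obtain r where r: "0 < r" "\<And>y. y \<in> {0..1} \<Longrightarrow> \<bar>y - x\<bar> < r \<Longrightarrow> \<bar>u y - u x\<bar> < e"
    using u x e(1) unfolding continuous_on_iff dist_real_def by (metis atLeastAtMost_iff less_imp_le)
  define c where "c = max 0 (x - r)"
  define d where "d = min 1 (x + r)"
  have cd: "0 \<le> c" "c < d" "d \<le> 1" using x r by (auto simp: c_def d_def)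
  have "(\<integral>x. (K + e) * indicator {c<..<d} x \<partial>leb01) \<le> (\<integral>x. u x * indicator {c<..<d} x \<partial>leb01)"
  proof (rule integral_mono)
    show "integrable leb01 (\<lambda>x. (K + e) * indicator {c<..<d} x)"
      by (intro integrable_mult_right sq_integrable_integrable[OF sq_integrable_indicator])
    show "integrable leb01 (\<lambda>x. u x * indicator {c<..<d} x)"
      by (rule sq_integrable_mult[OF su sq_integrable_indicator])
    fix y assume "y \<in> space leb01"
    then have y: "y \<in> {0..1}" by (simp add: space_restrict_space)
    show "(K + e) * indicator {c<..<d} y \<le> u y * indicator {c<..<d} y"
    proof (cases "y \<in> {c<..<d}")
      case True
      then have "\<bar>y - x\<bar> < r" by (auto simp: c_def d_def)
      then have "\<bar>u y - u x\<bar> < e" using r(2) y by blast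
      then have "K + e \<le> u y" using e(2) by linarith
      then show ?thesis using True by simp
    qed simp
  qed
  then have "(K + e) * (d - c) \<le> inner (to_l2 u) (to_l2 (indicator {c<..<d}))"
    by (simp only: to_l2_inner[OF su sq_integrable_indicator] integral_indicator_leb01[OF cd]
        integral_mult_right_zero)
  also have "\<dots> \<le> K * (d - c)"
    using K cd unfolding avg_bounded_def by (meson abs_le_D1)
  finally have "e * (d - c) \<le> 0" by (simp add: algebra_simps)
  moreover have "0 < e * (d - c)" using e cd by simp
  ultimately show False by linarith
qed

text \<open>Variation of constants for \<open>v'' = w\<^sup>2 (v - g)\<close>; \<open>A\<close> adjusts the boundary value at \<open>1\<close>.\<close>

lemma resolvent_exists:
  fixes g :: "real \<Rightarrow> real"
  assumes g: "continuous_on {0..1} g" and w: "0 < w"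
  obtains v v' where
    "\<And>x. x \<in> {0..1} \<Longrightarrow> (v has_real_derivative v' x) (at x within {0..1})"
    "\<And>x. x \<in> {0..1} \<Longrightarrow> (v' has_real_derivative w\<^sup>2 * (v x - g x)) (at x within {0..1})"
    "v 0 = 0" "v 1 = 0"
proof -
  define P where "P x = integral {0..x} (\<lambda>s. cosh (w * s) * g s)" for x
  define Q where "Q x = integral {0..x} (\<lambda>s. sinh (w * s) * g s)" for x
  have dP: "(P has_real_derivative cosh (w * x) * g x) (at x within {0..1})"
    and dQ: "(Q has_real_derivative sinh (w * x) * g x) (at x within {0..1})" if "x \<in> {0..1}" for x
    unfolding P_def[abs_def] Q_def[abs_def]
    by (intro integral_has_real_derivative continuous_intros g that)+
  have ds: "((\<lambda>x. sinh (w * x)) has_real_derivative cosh (w * x) * w) (at x within {0..1})"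
    and dc: "((\<lambda>x. cosh (w * x)) has_real_derivative sinh (w * x) * w) (at x within {0..1})" for x
    by (auto intro!: derivative_eq_intros)
  define z where "z x = - w * (sinh (w * x) * P x - cosh (w * x) * Q x)" for x
  define z' where "z' x = - w\<^sup>2 * (cosh (w * x) * P x - sinh (w * x) * Q x)" for x
  define A where "A = - z 1 / sinh w"
  define v where "v x = z x + A * sinh (w * x)" for x
  define v' where "v' x = z' x + A * (w * cosh (w * x))" for x
  have cs: "cosh (w * x) * cosh (w * x) - sinh (w * x) * sinh (w * x) = 1" for x
    using cosh_square_eq[of "w * x"] by (simp add: power2_eq_square)
  have dv: "(v has_real_derivative v' x) (at x within {0..1})" if x: "x \<in> {0..1}" for x
  proof -
    have "(v has_real_derivative
        - w * ((cosh (w * x) * w * P x + cosh (w * x) * g x * sinh (w * x)) -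
               (sinh (w * x) * w * Q x + sinh (w * x) * g x * cosh (w * x))) + A * (cosh (w * x) * w)) (at x within {0..1})"
      unfolding v_def[abs_def] z_def
      by (intro DERIV_add DERIV_cmult DERIV_diff DERIV_mult ds dc dP dQ x)
    then show ?thesis
      by (rule DERIV_cong) (simp add: v'_def z'_def power2_eq_square algebra_simps)
  qed
  have dv': "(v' has_real_derivative w\<^sup>2 * (v x - g x)) (at x within {0..1})" if x: "x \<in> {0..1}" for x
  proof -
    have "(v' has_real_derivative
        - w\<^sup>2 * ((sinh (w * x) * w * P x + cosh (w * x) * g x * cosh (w * x)) -
               (cosh (w * x) * w * Q x + sinh (w * x) * g x * sinh (w * x))) + A * (w * (sinh (w * x) * w))) (at x within {0..1})"
      unfolding v'_def[abs_def] z'_def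
      by (intro DERIV_add DERIV_cmult DERIV_diff DERIV_mult ds dc dP dQ x)
    moreover have "- w\<^sup>2 * ((sinh (w * x) * w * P x + cosh (w * x) * g x * cosh (w * x)) -
               (cosh (w * x) * w * Q x + sinh (w * x) * g x * sinh (w * x))) + A * (w * (sinh (w * x) * w)) =
        w\<^sup>2 * (v x - g x * (cosh (w * x) * cosh (w * x) - sinh (w * x) * sinh (w * x)))"
      by (simp add: v_def z_def power2_eq_square algebra_simps)
    ultimately show ?thesis unfolding cs by simp
  qed
  have "0 < sinh w" using w by simp
  then have "v 1 = 0" by (simp add: v_def A_def)
  moreover have "v 0 = 0" by (simp add: v_def z_def P_def Q_def)
  ultimately show thesis using dv dv' that by blast
qed

text \<open>Maximum principle: a maximum above K is interior, since K \<ge> 0 and \<open>v\<close>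
  vanishes at both ends. There v'' = w^2 (v - g) is positive, so v' becomes positive just to the
  right and \<open>v\<close> would grow past its maximum.\<close>

lemma resolvent_le:
  fixes g v v' :: "real \<Rightarrow> real"
  assumes v: "\<And>x. x \<in> {0..1} \<Longrightarrow> (v has_real_derivative v' x) (at x within {0..1})"
    and v': "\<And>x. x \<in> {0..1} \<Longrightarrow> (v' has_real_derivative w\<^sup>2 * (v x - g x)) (at x within {0..1})"
    and b: "v 0 = 0" "v 1 = 0" and g: "\<And>x. x \<in> {0..1} \<Longrightarrow> g x \<le> K" and K: "0 \<le> K" and w: "0 < w"
    and x: "x \<in> {0..1}"
  shows "v x \<le> K"
proof (rule ccontr)
  assume "\<not> v x \<le> K"
  have "continuous_on {0..1} v" using v by (metis DERIV_continuous_on)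
  then obtain y where y: "y \<in> {0..1}" "\<And>z. z \<in> {0..1} \<Longrightarrow> v z \<le> v y"
    using continuous_attains_sup[of "{0..1}" v] by force
  have vy: "K < v y" using y(2)[OF x] \<open>\<not> v x \<le> K\<close> by linarith
  then have y01: "0 < y" "y < 1" using b K y(1) by (auto simp: less_le)
  have at: "at z within {0..1} = at z" if "0 < z" "z < 1" for z :: real
    using that by (intro at_within_interior) (simp add: interior_atLeastAtMost_real)
  have dv: "(v has_real_derivative v' z) (at z)" if "0 < z" "z < 1" for z
    using v[of z] that at[OF that] by simp
  have "v' y = 0"
  proof (rule DERIV_local_max[OF dv[OF y01], of "min y (1 - y)"])
    show "\<forall>z. \<bar>y - z\<bar> < min y (1 - y) \<longrightarrow> v z \<le> v y"
      by (intro allI impI y(2)) (auto simp: abs_less_iff)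
  qed (use y01 in auto)
  moreover have "(v' has_real_derivative w\<^sup>2 * (v y - g y)) (at y)"
    using v'[OF y(1)] at[OF y01] by simp
  moreover have "0 < w\<^sup>2 * (v y - g y)" using w vy g[OF y(1)] by simp
  ultimately obtain d where d: "0 < d" "\<And>h. 0 < h \<Longrightarrow> h < d \<Longrightarrow> 0 < v' (y + h)"
    using DERIV_pos_inc_right by metis
  define h where "h = min (d / 2) ((1 - y) / 2)"
  have h: "0 < h" "h < d" "y + h < 1" using d y01 by (auto simp: h_def min_def field_simps)
  obtain z where z: "y < z" "z < y + h" "v (y + h) - v y = (y + h - y) * v' z"
    using MVT2[of y "y + h" v v'] dv h y01 by (metis add.commute le_less_trans less_add_same_cancel2 less_le_trans order_less_le_trans)
  have "0 < v' z" using d(2)[of "z - y"] z h by simp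
  then have "v y < v (y + h)" using z h by (simp add: algebra_simps)
  moreover have "v (y + h) \<le> v y" using h y01 by (intro y(2)) auto
  ultimately show False by linarith
qed

text \<open>On coefficients the resolvent is found by Green's identity with a mode; the boundary
  terms vanish because both functions are 0 at the ends. The two-sided bound comes from the maximum
  principle for \<open>v\<close> and for \<open>- v\<close>.\<close>

lemma resolvent_l2:
  assumes g: "continuous_on {0..1} g" "\<And>x. x \<in> {0..1} \<Longrightarrow> \<bar>g x\<bar> \<le> K" and w: "0 < w"
  obtains v where "continuous_on {0..1} v" "\<And>x. x \<in> {0..1} \<Longrightarrow> \<bar>v x\<bar> \<le> K"
    "\<And>k. cf (to_l2 v) k = w\<^sup>2 / (w\<^sup>2 + lapl k) * cf (to_l2 g) k"
proof -
  obtain v v' where v: "\<And>x. x \<in> {0..1} \<Longrightarrow> (v has_real_derivative v' x) (at x within {0..1})"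
    and v': "\<And>x. x \<in> {0..1} \<Longrightarrow> (v' has_real_derivative w\<^sup>2 * (v x - g x)) (at x within {0..1})"
    and b: "v 0 = 0" "v 1 = 0"
    using resolvent_exists[OF g(1) w] by blast
  have K: "0 \<le> K" using g(2)[of 0] by simp
  have vc: "continuous_on {0..1} v" and v'c: "continuous_on {0..1} v'"
    by (rule DERIV_continuous_on[OF v], assumption, rule DERIV_continuous_on[OF v'], assumption)
  have "\<bar>v x\<bar> \<le> K" if x: "x \<in> {0..1}" for x
  proof -
    have "v x \<le> K"
      by (rule resolvent_le[OF v v' b _ K w x]) (use g(2) in \<open>auto simp: abs_le_iff\<close>)
    moreover have "- v x \<le> K"
    proof (rule resolvent_le[where v = "\<lambda>x. - v x" and v' = "\<lambda>x. - v' x" and g = "\<lambda>x. - g x" and w = w and x = x and K = K])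
      show "((\<lambda>x. - v x) has_real_derivative - v' x) (at x within {0..1})" if "x \<in> {0..1}" for x
        by (rule DERIV_minus[OF v[OF that]])
      show "((\<lambda>x. - v' x) has_real_derivative w\<^sup>2 * (- v x - - g x)) (at x within {0..1})" if "x \<in> {0..1}" for x
        using DERIV_minus[OF v'[OF that]] by (simp add: algebra_simps)
    qed (use b g(2) K w x in \<open>auto simp: abs_le_iff\<close>)
    ultimately show ?thesis by simp
  qed
  moreover have "cf (to_l2 v) k = w\<^sup>2 / (w\<^sup>2 + lapl k) * cf (to_l2 g) k" for k
  proof -
    let ?L = "lapl k"
    note sv = sq_integrable_continuous[OF vc] and sg = sq_integrable_continuous[OF g(1)]
    have "(\<integral>x. (w\<^sup>2 * (v x - g x) * mode k x + mode' k x * v' x) - (v' x * mode' k x + - (?L * mode k x) * v x) \<partial>leb01)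
        = (v' 1 * mode k 1 - v 1 * mode' k 1) - (v' 0 * mode k 0 - v 0 * mode' k 0)"
    proof (rule integral_leb01_FTC)
      fix x :: real assume x: "0 \<le> x" "x \<le> 1"
      show "((\<lambda>x. v' x * mode k x - v x * mode' k x) has_real_derivative
          (w\<^sup>2 * (v x - g x) * mode k x + mode' k x * v' x) - (v' x * mode' k x + - (?L * mode k x) * v x)) (at x within {0..1})"
        using x by (intro DERIV_diff DERIV_mult v v' DERIV_mode DERIV_mode') auto
    qed (intro continuous_intros vc v'c g(1) continuous_on_mode continuous_on_mode')
    then have "0 = (\<integral>x. (w\<^sup>2 * (v x - g x) * mode k x + mode' k x * v' x) - (v' x * mode' k x + - (?L * mode k x) * v x) \<partial>leb01)"
      by (simp add: b mode_boundary)
    also have "\<dots> = (\<integral>x. (w\<^sup>2 + ?L) * (v x * mode k x) - w\<^sup>2 * (g x * mode k x) \<partial>leb01)"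
      by (rule Bochner_Integration.integral_cong) (simp_all add: algebra_simps)
    also have "\<dots> = (w\<^sup>2 + ?L) * cf (to_l2 v) k - w\<^sup>2 * cf (to_l2 g) k"
      using sq_integrable_mult[OF sv sq_integrable_mode] sq_integrable_mult[OF sg sq_integrable_mode]
      by (simp add: dirichlet_mode_eq to_l2_inner[OF sv sq_integrable_mode] to_l2_inner[OF sg sq_integrable_mode])
    finally have "(w\<^sup>2 + ?L) * cf (to_l2 v) k = w\<^sup>2 * cf (to_l2 g) k" by linarith
    moreover have "w\<^sup>2 + ?L \<noteq> 0" using w lapl_pos[of k] by (smt (verit) zero_less_power)
    ultimately show ?thesis by (simp add: field_simps)
  qed
  ultimately show thesis using vc that by blast
qed

lemma resolvent_power:
  assumes g: "continuous_on {0..1} g" "\<And>x. x \<in> {0..1} \<Longrightarrow> \<bar>g x\<bar> \<le> K" and w: "0 < w"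
  shows "\<exists>v. continuous_on {0..1} v \<and> (\<forall>x\<in>{0..1}. \<bar>v x\<bar> \<le> K) \<and>
    (\<forall>k. cf (to_l2 v) k = (w\<^sup>2 / (w\<^sup>2 + lapl k)) ^ n * cf (to_l2 g) k)"
proof (induction n)
  case 0
  then show ?case using g by auto
next
  case (Suc n)
  then obtain v where v: "continuous_on {0..1} v" "\<And>x. x \<in> {0..1} \<Longrightarrow> \<bar>v x\<bar> \<le> K"
    "\<And>k. cf (to_l2 v) k = (w\<^sup>2 / (w\<^sup>2 + lapl k)) ^ n * cf (to_l2 g) k"
    by blast
  obtain z where z: "continuous_on {0..1} z" "\<And>x. x \<in> {0..1} \<Longrightarrow> \<bar>z x\<bar> \<le> K"
    "\<And>k. cf (to_l2 z) k = w\<^sup>2 / (w\<^sup>2 + lapl k) * cf (to_l2 v) k"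
    by (rule resolvent_l2[OF v(1,2) w]) blast+
  show ?case
    using z by (intro exI[of _ z]) (simp add: v(3) mult.assoc)
qed

text \<open>The semigroup is the limit of powers of resolvents, which obey the maximum principle.\<close>

lemma avg_bounded_heat_semigroup:
  assumes g: "continuous_on {0..1} g" "\<And>x. x \<in> {0..1} \<Longrightarrow> \<bar>g x\<bar> \<le> K" and t: "0 \<le> t"
  shows "avg_bounded K (heat_semigroup t (to_l2 g))"
proof (cases "t = 0")
  case True
  then show ?thesis
    using g by (simp add: heat_semigroup_0 avg_bounded_to_l2 sq_integrable_continuous)
next
  case False
  with t have t: "0 < t" by simp
  \<comment> \<open>With w^2 = (n+1)/t the factor is 1/(1 + \<mu> t/(n+1)), one implicit Euler step
    of length t/(n+1); its power n+1 tends to e^(-\<mu> t).\<close>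
  define w where "w n = sqrt (real (Suc n) / t)" for n
  have w: "0 < w n" "(w n)\<^sup>2 = real (Suc n) / t" for n
    using t by (simp_all add: w_def)
  let ?p = "\<lambda>n k. (w n)\<^sup>2 / ((w n)\<^sup>2 + lapl k)"
  have "\<forall>n. \<exists>v. continuous_on {0..1} v \<and> (\<forall>x\<in>{0..1}. \<bar>v x\<bar> \<le> K) \<and>
    (\<forall>k. cf (to_l2 v) k = ?p n k ^ Suc n * cf (to_l2 g) k)"
    using resolvent_power[OF g w(1)] by blast
  then obtain v where vc: "\<And>n. continuous_on {0..1} (v n)" and vK: "\<And>n x. x \<in> {0..1} \<Longrightarrow> \<bar>v n x\<bar> \<le> K"
    and v: "\<And>n k. cf (to_l2 (v n)) k = ?p n k ^ Suc n * cf (to_l2 g) k"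
    by metis
  have fac: "?p n k ^ Suc n = inverse ((1 + lapl k * t / real (Suc n)) ^ Suc n)" for n k
  proof -
    have "?p n k = inverse (1 + lapl k * t / real (Suc n))"
      unfolding w(2) using t lapl_pos[of k] by (simp add: field_simps)
    then show ?thesis by (simp only: power_inverse)
  qed
  have lim: "(\<lambda>n. to_l2 (v n)) \<longlonglongrightarrow> heat_semigroup t (to_l2 g)"
  proof (rule dirichlet.dominated_convergence_basis)
    fix k
    have "(\<lambda>n. (1 + lapl k * t / real (Suc n)) ^ Suc n) \<longlonglongrightarrow> exp (lapl k * t)"
      using LIMSEQ_Suc[OF tendsto_exp_limit_sequentially[of "lapl k * t"]] .
    then have "(\<lambda>n. inverse ((1 + lapl k * t / real (Suc n)) ^ Suc n)) \<longlonglongrightarrow> inverse (exp (lapl k * t))"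
      by (rule tendsto_inverse) simp
    then show "(\<lambda>n. cf (to_l2 (v n)) k) \<longlonglongrightarrow> cf (heat_semigroup t (to_l2 g)) k"
      unfolding v fac inner_heat_semigroup[OF less_imp_le[OF t]] exp_minus
      by (intro tendsto_mult tendsto_const)
  next
    have "\<bar>cf (to_l2 (v n)) k\<bar> \<le> \<bar>cf (to_l2 g) k\<bar>" for n k
    proof -
      have "0 \<le> ?p n k" "?p n k \<le> 1"
        using w(1)[of n] lapl_pos[of k] by (simp_all add: divide_le_eq_1 add_pos_pos)
      then have "?p n k ^ Suc n \<le> 1" "0 \<le> ?p n k ^ Suc n"
        by (simp_all only: power_le_one zero_le_power)
      then show ?thesis
        unfolding v abs_mult by (intro mult_left_le_one_le) auto
    qed
    then show "\<forall>\<^sub>F n in sequentially. \<forall>k. \<bar>cf (to_l2 (v n)) k\<bar> \<le> \<bar>cf (to_l2 g) k\<bar>"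
      by simp
    show "summable (\<lambda>k. \<bar>cf (to_l2 g) k\<bar>\<^sup>2)"
      using dirichlet.bessel_summable by simp
  qed simp
  show ?thesis
    unfolding avg_bounded_def
  proof (intro allI impI)
    fix c d :: real assume cd: "0 \<le> c" "c < d" "d \<le> 1"
    have "avg_bounded K (to_l2 (v n))" for n
      by (rule avg_bounded_to_l2[OF sq_integrable_continuous[OF vc]]) (simp add: vK)
    then have "\<bar>inner (to_l2 (v n)) (to_l2 (indicator {c<..<d}))\<bar> \<le> K * (d - c)" for n
      using cd unfolding avg_bounded_def by blast
    then show "\<bar>inner (heat_semigroup t (to_l2 g)) (to_l2 (indicator {c<..<d}))\<bar> \<le> K * (d - c)"
      by (intro tendsto_upperbound[OF tendsto_rabs[OF tendsto_inner[OF lim tendsto_const]]]) auto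
  qed
qed

text \<open>In the formula for the shifted operator, testing with the indicator of an interval makes
  the L^2-valued integral scalar; there the integrand is bounded by \<open>N r\<close> times the
  length, because the semigroup contracts the supremum norm. Continuity turns averages back into
  values.\<close>

lemma duhamel_sup_bound:
  assumes st: "s \<le> t" and F: "continuous_on {s..t} F" and u: "continuous_on {s..t} u"
    and d: "\<And>r. r \<in> {s..t} \<Longrightarrow> duhamel F s r u"
    and g: "\<And>r. r \<in> {s..t} \<Longrightarrow> F r + \<gamma> *\<^sub>R h10_to_l2 (u r) = to_l2 (g r)"
      "\<And>r. r \<in> {s..t} \<Longrightarrow> continuous_on {0..1} (g r)"
      "\<And>r x. r \<in> {s..t} \<Longrightarrow> x \<in> {0..1} \<Longrightarrow> \<bar>g r x\<bar> \<le> N r"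
    and N: "continuous_on {s..t} N" and K: "\<And>x. \<bar>fun_of (u s) x\<bar> \<le> K"
  shows "\<bar>fun_of (u t) x\<bar> \<le> exp (- (\<gamma> * (t - s))) * K + integral {s..t} (\<lambda>r. exp (- (\<gamma> * (t - r))) * N r)"
    (is "_ \<le> ?B")
proof -
  let ?e = "\<lambda>r. exp (- (\<gamma> * (t - r)))"
  let ?N = "integral {s..t} (\<lambda>r. ?e r * N r)" and ?h = "heat_semigroup (t - s) (h10_to_l2 (u s))"
  define G where "G r = F r + \<gamma> *\<^sub>R h10_to_l2 (u r)" for r
  have uc: "continuous_on {s..t} (\<lambda>r. h10_to_l2 (u r))"
    by (rule bounded_linear.continuous_on[OF bounded_linear_h10_to_l2 u])
  have G: "continuous_on {s..t} G"
    unfolding G_def[abs_def] by (intro continuous_intros F uc)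
  have I: "((\<lambda>r. ?e r *\<^sub>R heat_semigroup (t - r) (G r)) has_integral
      h10_to_l2 (u t) - ?e s *\<^sub>R ?h) {s..t}"
    by (rule has_integral_heat_iff[OF st G, THEN iffD2], rule allI)
       (use duhamel_shift[OF st F d] in \<open>simp only: G_def coef_def\<close>)
  have us: "avg_bounded K (?h)"
    unfolding h10_to_l2_def using st K by (intro avg_bounded_heat_semigroup fun_of_continuous) auto
  have Gr: "avg_bounded (N r) (heat_semigroup (t - r) (G r))" if "r \<in> {s..t}" for r
    unfolding G_def g(1)[OF that] using that g(2,3) by (intro avg_bounded_heat_semigroup) auto
  have "avg_bounded ?B (h10_to_l2 (u t))"
    unfolding avg_bounded_def
  proof (intro allI impI)
    fix c d :: real assume cd: "0 \<le> c" "c < d" "d \<le> 1"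
    let ?\<chi> = "to_l2 (indicator {c<..<d})"
    have 1: "((\<lambda>r. ?e r * inner (heat_semigroup (t - r) (G r)) ?\<chi>) has_integral
        inner (h10_to_l2 (u t)) ?\<chi> - ?e s * inner (?h) ?\<chi>) {s..t}"
      using has_integral_linear[OF I bounded_linear_inner_left[of ?\<chi>]]
      by (simp add: o_def inner_diff_left)
    have 2: "((\<lambda>r. ?e r * N r * (d - c)) has_integral
        ?N * (d - c)) {s..t}"
      by (intro has_integral_mult_left integrable_integral integrable_continuous_real continuous_intros N)
    have "norm (integral {s..t} (\<lambda>r. ?e r * inner (heat_semigroup (t - r) (G r)) ?\<chi>))
        \<le> integral {s..t} (\<lambda>r. ?e r * N r * (d - c))"
    proof (rule integral_norm_bound_integral[OF has_integral_integrable[OF 1] has_integral_integrable[OF 2]])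
      fix r assume "r \<in> {s..t}"
      then have "\<bar>inner (heat_semigroup (t - r) (G r)) ?\<chi>\<bar> \<le> N r * (d - c)"
        using Gr cd unfolding avg_bounded_def by blast
      then show "norm (?e r * inner (heat_semigroup (t - r) (G r)) ?\<chi>) \<le> ?e r * N r * (d - c)"
        by (simp add: abs_mult mult.assoc)
    qed
    then have "\<bar>inner (h10_to_l2 (u t)) ?\<chi> - ?e s * inner (?h) ?\<chi>\<bar>
        \<le> ?N * (d - c)"
      unfolding integral_unique[OF 1] integral_unique[OF 2] by simp
    moreover have "\<bar>?e s * inner (?h) ?\<chi>\<bar> \<le> ?e s * (K * (d - c))"
      using us cd unfolding avg_bounded_def by (simp add: abs_mult)
    ultimately show "\<bar>inner (h10_to_l2 (u t)) ?\<chi>\<bar> \<le> ?B * (d - c)"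
      by (simp add: algebra_simps abs_le_iff)
  qed
  moreover have "avg_bounded B (- v)" if "avg_bounded B v" for B v
    using that by (simp add: avg_bounded_def)
  moreover have "- h10_to_l2 (u t) = to_l2 (\<lambda>x. - fun_of (u t) x)"
    using to_l2_scale[OF fun_of_sq_integrable, of "-1" "u t"] by (simp add: h10_to_l2_def)
  ultimately have 1: "avg_bounded ?B (to_l2 (fun_of (u t)))" and 2: "avg_bounded ?B (to_l2 (\<lambda>x. - fun_of (u t) x))"
    unfolding h10_to_l2_def by metis+
  show ?thesis
  proof (cases "x \<in> {0<..<1}")
    case True
    then show ?thesis
      using avg_bounded_imp_le[OF fun_of_continuous 1] avg_bounded_imp_le[OF continuous_on_minus[OF fun_of_continuous] 2]
      by (simp add: abs_le_iff)
  next
    case False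
    \<comment> \<open>Outside (0,1) only \<open>0 \<le> ?B\<close> is left to prove. At 1/2 either
      the function or its negative is nonnegative, and both lie below \<open>?B\<close>.\<close>
    have "0 \<le> fun_of (u t) (1/2) \<or> 0 \<le> - fun_of (u t) (1/2)" by linarith
    then have "0 \<le> ?B"
      using avg_bounded_imp_le[OF fun_of_continuous 1, of "1/2"]
        avg_bounded_imp_le[OF continuous_on_minus[OF fun_of_continuous] 2, of "1/2"] by auto
    then show ?thesis using False by (simp add: fun_of_outside)
  qed
qed

section \<open>Local existence\<close>

lemma lapl_ge: "1 \<le> lapl k" "real (Suc k) \<le> lapl k"
proof -
  have p: "1 \<le> pi" using pi_gt3 by linarith
  have s: "1 \<le> real (Suc k)" by simp
  have "real (Suc k) * 1 \<le> real (Suc k) * pi" by (rule mult_left_mono[OF p]) simp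
  then have "real (Suc k) \<le> real (Suc k) * pi" by simp
  moreover from this s have "real (Suc k) * pi * 1 \<le> real (Suc k) * pi * (real (Suc k) * pi)"
    by (intro mult_left_mono) linarith+
  ultimately show "real (Suc k) \<le> lapl k" unfolding power2_eq_square by linarith
  then show "1 \<le> lapl k" using s by linarith
qed

text \<open>The Cauchy--Schwarz inequality for the weight \<open>e\<^bsup>-\<mu>(t-r)\<^esup>\<close>, whose mass is at most \<open>1/\<mu>\<close>.\<close>

lemma exp_convolution_sq_le:
  fixes \<phi> :: "real \<Rightarrow> real"
  assumes \<mu>: "0 < \<mu>" and st: "s \<le> t" and \<phi>: "continuous_on {s..t} \<phi>"
    and y: "y = integral {s..t} (\<lambda>r. exp (- (\<mu> * (t - r))) * \<phi> r)"
  shows "\<mu> * y\<^sup>2 \<le> integral {s..t} (\<lambda>r. exp (- (\<mu> * (t - r))) * (\<phi> r)\<^sup>2)"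
proof -
  let ?e = "\<lambda>r. exp (- (\<mu> * (t - r)))"
  let ?E = "(1 - exp (- (\<mu> * (t - s)))) / \<mu>"
  have E: "(?e has_integral ?E) {s..t}"
  proof -
    have "(?e has_integral exp (- (\<mu> * (t - t))) / \<mu> - exp (- (\<mu> * (t - s))) / \<mu>) {s..t}"
    proof (rule fundamental_theorem_of_calculus[OF st])
      fix r assume "r \<in> {s..t}"
      have "((\<lambda>r. ?e r / \<mu>) has_real_derivative ?e r) (at r within {s..t})"
        using \<mu> by (auto intro!: derivative_eq_intros)
      then show "((\<lambda>r. ?e r / \<mu>) has_vector_derivative ?e r) (at r within {s..t})"
        by (simp add: has_real_derivative_iff_has_vector_derivative)
    qed
    then show ?thesis by (simp add: diff_divide_distrib)
  qed
  have Y: "((\<lambda>r. ?e r * \<phi> r) has_integral y) {s..t}"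
    unfolding y by (intro integrable_integral integrable_continuous_real continuous_intros \<phi>)
  let ?J = "integral {s..t} (\<lambda>r. ?e r * (\<phi> r)\<^sup>2)"
  have J: "((\<lambda>r. ?e r * (\<phi> r)\<^sup>2) has_integral ?J) {s..t}"
    by (intro integrable_integral integrable_continuous_real continuous_intros \<phi>)
  \<comment> \<open>Expanding the weighted square of \<phi> - \<mu> y, which is nonnegative. The
    constant \<mu> y is the weighted mean of \<phi> if the mass is rounded up to 1/\<mu>.\<close>
  have "((\<lambda>r. ?e r * (\<phi> r)\<^sup>2 - (2 * (\<mu> * y)) * (?e r * \<phi> r) + (\<mu> * y)\<^sup>2 * ?e r) has_integral
      ?J - (2 * (\<mu> * y)) * y + (\<mu> * y)\<^sup>2 * (?E)) {s..t}"
    by (intro has_integral_add has_integral_diff has_integral_mult_right E Y J)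
  moreover have "E * p\<^sup>2 - (2 * (\<mu> * y)) * (E * p) + (\<mu> * y)\<^sup>2 * E = E * (p - \<mu> * y)\<^sup>2" for E p
    by (simp add: algebra_simps power2_eq_square)
  ultimately have "((\<lambda>r. ?e r * (\<phi> r - \<mu> * y)\<^sup>2) has_integral
      ?J - (2 * (\<mu> * y)) * y + (\<mu> * y)\<^sup>2 * (?E)) {s..t}"
    by (simp only:)
  then have "0 \<le> ?J - (2 * (\<mu> * y)) * y + (\<mu> * y)\<^sup>2 * (?E)"
    by (rule has_integral_nonneg) simp
  moreover have "(\<mu> * y)\<^sup>2 * (?E) \<le> (\<mu> * y)\<^sup>2 * (1 / \<mu>)"
    using \<mu> by (intro mult_left_mono divide_right_mono) auto
  moreover have "(\<mu> * y)\<^sup>2 * (1 / \<mu>) = \<mu> * y\<^sup>2" using \<mu> by (simp add: power2_eq_square)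
  moreover have "(2 * (\<mu> * y)) * y = 2 * (\<mu> * y\<^sup>2)" by (simp add: power2_eq_square)
  ultimately show ?thesis by linarith
qed

text \<open>The coefficient that the formula forces at time \<open>t\<close> for initial value
  \<open>v\<close> and forcing \<open>F\<close>. It depends on the data alone, so it can be
  estimated before any element of H^1_0 with these coefficients is known.\<close>

definition duhamel_coef :: "h10 \<Rightarrow> (real \<Rightarrow> l2) \<Rightarrow> real \<Rightarrow> real \<Rightarrow> nat \<Rightarrow> real" where
  "duhamel_coef v F s t k = exp (- (lapl k * t)) *
     (exp (lapl k * s) * coef v k + integral {s..t} (\<lambda>r. exp (lapl k * r) * cf (F r) k))"

lemma duhamel_coef_iff:
  "x = duhamel_coef v F s t k \<longleftrightarrow> exp (lapl k * t) * x =
     exp (lapl k * s) * coef v k + integral {s..t} (\<lambda>r. exp (lapl k * r) * cf (F r) k)"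
  (is "_ \<longleftrightarrow> _ = ?r")
proof -
  have "exp (lapl k * t) * exp (- (lapl k * t)) = 1" by (simp add: exp_add[symmetric])
  then have "exp (lapl k * t) * duhamel_coef v F s t k = ?r"
    unfolding duhamel_coef_def mult.assoc[symmetric, of _ _ ?r] by (simp only: mult_1)
  moreover have "exp (lapl k * t) \<noteq> 0" by simp
  ultimately show ?thesis
    using mult_left_cancel[of "exp (lapl k * t)" x "duhamel_coef v F s t k"] by (simp only: simp_thms)
qed

lemma duhamel_iff_coef: "duhamel F s t u \<longleftrightarrow> (\<forall>k. coef (u t) k = duhamel_coef (u s) F s t k)"
  unfolding duhamel_def duhamel_coef_iff ..

lemma duhamel_coef_start: "duhamel_coef v F s s k = coef v k"
  using duhamel_coef_iff[of "coef v k" v F s s k] by simp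

text \<open>Twice the Parseval tail of the initial value plus the share of a forcing bounded by
  \<open>B\<close>. One factor 2 comes from squaring a sum, the other from 1 + \<mu> \<le> 2 \<mu>.
  No time occurs in it.\<close>

definition tail_bound :: "h10 \<Rightarrow> real \<Rightarrow> nat \<Rightarrow> real" where
  "tail_bound v B N = 2 * ((norm v)\<^sup>2 - (\<Sum>k<N. h1_term v k)) + 4 * B\<^sup>2 / lapl N"

lemma tail_bound_tendsto: "tail_bound v B \<longlonglongrightarrow> 0"
proof -
  have "(\<lambda>N. \<Sum>k<N. h1_term v k) \<longlonglongrightarrow> (norm v)\<^sup>2"
    using h10_parseval[of v] by (simp add: sums_def)
  then have "(\<lambda>N. 2 * ((norm v)\<^sup>2 - (\<Sum>k<N. h1_term v k))) \<longlonglongrightarrow> 2 * ((norm v)\<^sup>2 - (norm v)\<^sup>2)"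
    by (intro tendsto_intros)
  moreover have "(\<lambda>N. 4 * B\<^sup>2 / lapl N) \<longlonglongrightarrow> 0"
  proof (rule Lim_null_comparison)
    show "(\<lambda>N. 4 * B\<^sup>2 / real (Suc N)) \<longlonglongrightarrow> 0"
      using LIMSEQ_Suc[OF lim_const_over_n[of "4 * B\<^sup>2"]] by simp
    have "norm (4 * B\<^sup>2 / lapl N) \<le> 4 * B\<^sup>2 / real (Suc N)" for N
      using divide_left_mono[OF lapl_ge(2)[of N], of "4 * B\<^sup>2"] lapl_pos[of N] by simp
    then show "\<forall>\<^sub>F N in sequentially. norm (4 * B\<^sup>2 / lapl N) \<le> 4 * B\<^sup>2 / real (Suc N)" by simp
  qed
  ultimately show ?thesis
    unfolding tail_bound_def[abs_def] using tendsto_add by fastforce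
qed

text \<open>The convolution inequality absorbs the weight \<mu>_k. For \<open>k \<ge> N\<close> the
  decay rate is then lowered to that of mode \<open>N\<close>, a common weight under which Bessel's
  inequality sums the forcing coefficients inside the integral; the remaining exponential has
  integral at most 1/\<mu>_N.\<close>

lemma duhamel_coef_tail:
  assumes st: "s \<le> t" and F: "continuous_on {s..t} F" and B: "\<And>r. r \<in> {s..t} \<Longrightarrow> norm (F r) \<le> B"
  shows "(\<Sum>k\<in>{N..<n}. (1 + lapl k) * (duhamel_coef v F s t k)\<^sup>2) \<le> tail_bound v B N"
proof -
  let ?e = "\<lambda>k r. exp (- (lapl k * (t - r)))"
  let ?f = "\<lambda>k r. cf (F r) k"
  define y where "y k = integral {s..t} (\<lambda>r. ?e k r * ?f k r)" for k
  have fc: "continuous_on {s..t} (?f k)" for k by (intro continuous_intros F)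
  have ek: "exp (- (lapl k * t)) * exp (lapl k * r) = ?e k r" for k r
    by (simp add: exp_add[symmetric] algebra_simps)
  have c: "duhamel_coef v F s t k = ?e k s * coef v k + y k" for k
  proof -
    have "exp (- (lapl k * t)) * integral {s..t} (\<lambda>r. exp (lapl k * r) * ?f k r) = y k"
      unfolding y_def integral_mult_right[symmetric] by (simp only: ek mult.assoc[symmetric])
    then show ?thesis unfolding duhamel_coef_def distrib_left by (simp only: ek mult.assoc[symmetric])
  qed
  have term_le: "(1 + lapl k) * (duhamel_coef v F s t k)\<^sup>2 \<le>
      2 * (h1_term v k) + 4 * integral {s..t} (\<lambda>r. ?e N r * (?f k r)\<^sup>2)" if k: "N \<le> k" for k
  proof -
    have "(?e k s * coef v k + y k)\<^sup>2 \<le> 2 * (?e k s * coef v k)\<^sup>2 + 2 * (y k)\<^sup>2"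
      using zero_le_power2[of "?e k s * coef v k - y k"] by (simp add: power2_sum power2_diff)
    moreover have "(?e k s * coef v k)\<^sup>2 \<le> (coef v k)\<^sup>2"
      using st by (intro exp_lapl_mult_sq_le) simp
    ultimately have "(duhamel_coef v F s t k)\<^sup>2 \<le> 2 * (coef v k)\<^sup>2 + 2 * (y k)\<^sup>2" unfolding c by linarith
    then have "(1 + lapl k) * (duhamel_coef v F s t k)\<^sup>2 \<le> (1 + lapl k) * (2 * (coef v k)\<^sup>2 + 2 * (y k)\<^sup>2)"
      using lapl_pos[of k] by (intro mult_left_mono) auto
    moreover have "(1 + lapl k) * (y k)\<^sup>2 \<le> 2 * (lapl k * (y k)\<^sup>2)"
    proof -
      have "1 * (y k)\<^sup>2 \<le> lapl k * (y k)\<^sup>2" using lapl_ge(1)[of k] by (rule mult_right_mono) simp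
      then show ?thesis unfolding distrib_right by linarith
    qed
    moreover have "lapl k * (y k)\<^sup>2 \<le> integral {s..t} (\<lambda>r. ?e k r * (?f k r)\<^sup>2)"
      by (rule exp_convolution_sq_le[OF lapl_pos st fc y_def])
    moreover have "integral {s..t} (\<lambda>r. ?e k r * (?f k r)\<^sup>2) \<le> integral {s..t} (\<lambda>r. ?e N r * (?f k r)\<^sup>2)"
    proof (rule integral_le)
      have l: "lapl N \<le> lapl k" using k by (intro power_mono mult_right_mono) auto
      fix r assume "r \<in> {s..t}"
      then have "lapl N * (t - r) \<le> lapl k * (t - r)" by (intro mult_right_mono[OF l]) auto
      then show "?e k r * (?f k r)\<^sup>2 \<le> ?e N r * (?f k r)\<^sup>2"
        by (intro mult_right_mono) auto
    qed (intro integrable_continuous_real continuous_intros fc)+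
    ultimately show ?thesis unfolding distrib_left by (simp only: mult.left_commute[of "1 + lapl k" 2])
  qed
  have "(\<Sum>k\<in>{N..<n}. (1 + lapl k) * (duhamel_coef v F s t k)\<^sup>2) \<le>
      (\<Sum>k\<in>{N..<n}. 2 * (h1_term v k) + 4 * integral {s..t} (\<lambda>r. ?e N r * (?f k r)\<^sup>2))"
    by (rule sum_mono) (use term_le in simp)
  also have "\<dots> = 2 * (\<Sum>k\<in>{N..<n}. h1_term v k) +
      4 * (\<Sum>k\<in>{N..<n}. integral {s..t} (\<lambda>r. ?e N r * (?f k r)\<^sup>2))"
    unfolding sum.distrib sum_distrib_left ..
  also have "(\<Sum>k\<in>{N..<n}. h1_term v k) \<le> (norm v)\<^sup>2 - (\<Sum>k<N. h1_term v k)"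
  proof -
    have "(\<Sum>k\<in>{..<N} \<union> {N..<n}. h1_term v k) \<le> (norm v)\<^sup>2"
      using sum_le_suminf[OF sums_summable[OF h10_parseval[of v]], of "{..<N} \<union> {N..<n}"] lapl_pos
      unfolding sums_unique[OF h10_parseval, symmetric] by (simp add: add_nonneg_nonneg)
    moreover have "(\<Sum>k\<in>{..<N} \<union> {N..<n}. h1_term v k) =
        (\<Sum>k<N. h1_term v k) + (\<Sum>k\<in>{N..<n}. h1_term v k)"
      by (rule sum.union_disjoint) auto
    ultimately show ?thesis by linarith
  qed
  also have "(\<Sum>k\<in>{N..<n}. integral {s..t} (\<lambda>r. ?e N r * (?f k r)\<^sup>2)) \<le> B\<^sup>2 / lapl N"
  proof -
    have i: "(\<lambda>r. ?e N r * (?f k r)\<^sup>2) integrable_on {s..t}" for k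
      by (intro integrable_continuous_real continuous_intros fc)
    have "(\<Sum>k\<in>{N..<n}. integral {s..t} (\<lambda>r. ?e N r * (?f k r)\<^sup>2)) =
        integral {s..t} (\<lambda>r. \<Sum>k\<in>{N..<n}. ?e N r * (?f k r)\<^sup>2)"
      using i by (intro integral_sum[symmetric]) auto
    also have "\<dots> \<le> integral {s..t} (\<lambda>r. ?e N r * B\<^sup>2)"
    proof (rule integral_le)
      show "(\<lambda>r. \<Sum>k\<in>{N..<n}. ?e N r * (?f k r)\<^sup>2) integrable_on {s..t}"
        using i by (intro integrable_sum) auto
      fix r assume r: "r \<in> {s..t}"
      have "(\<Sum>k\<in>{N..<n}. (?f k r)\<^sup>2) \<le> B\<^sup>2"
        using sum_coef_le_norm[of "{N..<n}" "F r"] power_mono[OF B[OF r] norm_ge_zero, of 2] by simp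
      then show "(\<Sum>k\<in>{N..<n}. ?e N r * (?f k r)\<^sup>2) \<le> ?e N r * B\<^sup>2"
        unfolding sum_distrib_left[symmetric] by (rule mult_left_mono) simp
    qed (intro integrable_continuous_real continuous_intros)
    also have "\<dots> \<le> B\<^sup>2 / lapl N"
    proof -
      have "((\<lambda>r. ?e N r * B\<^sup>2) has_integral exp (- (lapl N * (t - t))) * B\<^sup>2 / lapl N - exp (- (lapl N * (t - s))) * B\<^sup>2 / lapl N) {s..t}"
      proof (rule fundamental_theorem_of_calculus[OF st])
        fix r assume "r \<in> {s..t}"
        have "((\<lambda>r. exp (- (c * (t - r))) * B\<^sup>2 / c) has_real_derivative exp (- (c * (t - r))) * B\<^sup>2) (at r within {s..t})"
          if "0 < c" for c
          using that by (auto intro!: derivative_eq_intros)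
        from this[OF lapl_pos[of N]] show "((\<lambda>r. ?e N r * B\<^sup>2 / lapl N) has_vector_derivative ?e N r * B\<^sup>2) (at r within {s..t})"
          by (simp add: has_real_derivative_iff_has_vector_derivative)
      qed
      moreover have "0 \<le> exp (- (lapl N * (t - s))) * B\<^sup>2 / lapl N" using lapl_pos[of N] by simp
      ultimately show ?thesis by (simp only: integral_unique) simp
    qed
    finally show ?thesis .
  qed
  finally show ?thesis unfolding tail_bound_def by simp
qed

lemma continuous_on_duhamel_coef:
  assumes "continuous_on {s..e} F"
  shows "continuous_on {s..e} (\<lambda>t. duhamel_coef v F s t k)"
  unfolding duhamel_coef_def
  by (intro continuous_intros indefinite_integral_continuous_1 integrable_continuous_real assms)

lemma continuous_on_h10_tail:
  assumes \<tau>: "\<tau> \<longlonglongrightarrow> 0" and tail: "\<And>t N n. t \<in> S \<Longrightarrow> (\<Sum>k\<in>{N..<n}. h1_term (u t) k) \<le> \<tau> N"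
    and c: "\<And>k. continuous_on S (\<lambda>t. coef (u t) k)"
  shows "continuous_on S u"
  unfolding continuous_on_def
proof
  fix t assume t: "t \<in> S"
  show "(u \<longlongrightarrow> u t) (at t within S)"
  proof (cases "at t within S = bot")
    case False
    have "\<forall>\<^sub>F i in at t within S. \<forall>N n. (\<Sum>k\<in>{N..<n}. h1_term (u i) k) \<le> \<tau> N"
      using tail by (auto simp: eventually_at_filter)
    moreover have "((\<lambda>i. coef (u i) k) \<longlongrightarrow> coef (u t) k) (at t within S)" for k
      using c t by (simp add: continuous_on_def)
    ultimately obtain v where v: "\<And>k. coef v k = coef (u t) k" "(u \<longlongrightarrow> v) (at t within S)"
      by (rule h10_tail_convergence[OF False \<tau>]) blast
    from v(1) have "v = u t" by (rule coef_eqI)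
    with v(2) show ?thesis by simp
  qed simp
qed

text \<open>The tail bound at \<open>N = 0\<close> bounds the whole weighted sum of squares, so
  Riesz-Fischer in H^1_0 applies.\<close>

lemma duhamel_solve:
  assumes "s \<le> t" "continuous_on {s..t} F" "\<And>r. r \<in> {s..t} \<Longrightarrow> norm (F r) \<le> B"
  shows "\<exists>w. \<forall>k. coef w k = duhamel_coef v F s t k"
proof -
  have "summable (\<lambda>k. (1 + lapl k) * (duhamel_coef v F s t k)\<^sup>2)"
  proof (rule bounded_imp_summable)
    show "0 \<le> (1 + lapl k) * (duhamel_coef v F s t k)\<^sup>2" for k
      using lapl_pos[of k] by (intro mult_nonneg_nonneg) auto
    show "(\<Sum>k\<le>n. (1 + lapl k) * (duhamel_coef v F s t k)\<^sup>2) \<le> tail_bound v B 0" for n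
      using duhamel_coef_tail[OF assms, where v = v and N = 0 and n = "Suc n"] by (simp add: atLeast0LessThan lessThan_Suc_atMost)
  qed
  then obtain w where "\<And>k. coef w k = duhamel_coef v F s t k"
    by (rule h10_riesz_fischer) blast
  then show ?thesis by blast
qed

lemma duhamel_coef_cong:
  assumes "\<And>r. r \<in> {s..t} \<Longrightarrow> F r = G r"
  shows "duhamel_coef v F s t k = duhamel_coef v G s t k"
proof -
  have "integral {s..t} (\<lambda>r. exp (lapl k * r) * cf (F r) k) =
      integral {s..t} (\<lambda>r. exp (lapl k * r) * cf (G r) k)"
    by (rule integral_cong) (simp add: assms)
  then show ?thesis unfolding duhamel_coef_def by simp
qed

text \<open>The maximum with \<open>s\<close> freezes the state at its initial value for the first
  \<delta>; the clock, which starts from the value \<open>A\<close> reached before \<open>s\<close>,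
  is delayed as well. Thus the forcing up to \<open>t\<close> uses \<open>u\<close> only up to t -
  \<delta>.\<close>

definition delay_forcing ::
    "(h10 \<Rightarrow> real \<Rightarrow> l2) \<Rightarrow> (h10 \<Rightarrow> real) \<Rightarrow> real \<Rightarrow> real \<Rightarrow> real \<Rightarrow> (real \<Rightarrow> h10) \<Rightarrow> real \<Rightarrow> l2" where
  "delay_forcing R b A s \<delta> u r =
     R (u (max s (r - \<delta>))) (A + integral {s..r} (\<lambda>q. b (u (max s (q - \<delta>)))))"

lemma continuous_on_delay:
  fixes s e \<delta> :: real
  assumes u: "continuous_on {s..e} u" and \<delta>: "0 \<le> \<delta>"
  shows "continuous_on {s..e} (\<lambda>r. u (max s (r - \<delta>)))"
proof (rule continuous_on_compose2[OF u])
  show "continuous_on {s..e} (\<lambda>r. max s (r - \<delta>))"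
    by (intro continuous_on_max continuous_intros)
  show "(\<lambda>r. max s (r - \<delta>)) ` {s..e} \<subseteq> {s..e}" using \<delta> by auto
qed

lemma continuous_on_delay_forcing:
  assumes u: "continuous_on {s..e} u" and \<delta>: "0 \<le> \<delta>"
    and R: "continuous_on UNIV (\<lambda>(v, p). R v p)" and b: "continuous_on UNIV b"
  shows "continuous_on {s..e} (delay_forcing R b A s \<delta> u)"
proof -
  have bc: "continuous_on {s..e} (\<lambda>q. b (u (max s (q - \<delta>))))"
    by (rule continuous_on_compose2[OF b continuous_on_delay[OF u \<delta>]]) simp
  have "continuous_on {s..e} (\<lambda>r. (u (max s (r - \<delta>)), A + integral {s..r} (\<lambda>q. b (u (max s (q - \<delta>))))))"
    by (intro continuous_on_Pair continuous_on_delay[OF u \<delta>] continuous_on_add continuous_on_const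
        indefinite_integral_continuous_1 integrable_continuous_real bc)
  from continuous_on_compose2[OF R this] show ?thesis
    by (simp add: delay_forcing_def[abs_def])
qed

text \<open>Because of the delay, the iterates j and j + 1 of the solution operator agree on
  [s, s + j \<delta>]. Once j \<delta> \<ge> 1, iterate j is a fixed point on the whole interval,
  with no contraction estimate.\<close>

lemma delay_solution:
  fixes s \<delta> :: real
  assumes \<delta>: "0 < \<delta>"
    and R: "continuous_on UNIV (\<lambda>(v, p). R v p)" "\<And>v p. norm (R v p) \<le> B"
    and b: "continuous_on UNIV b"
  obtains u where "continuous_on {s..s+1} u"
    "\<And>t k. t \<in> {s..s+1} \<Longrightarrow> coef (u t) k = duhamel_coef v (delay_forcing R b A s \<delta> u) s t k"
proof -
  define G where "G = delay_forcing R b A s \<delta>"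
  define Op where "Op u t = (SOME w. \<forall>k. coef w k = duhamel_coef v (G u) s t k)" for u t
  have GB: "norm (G u r) \<le> B" for u r unfolding G_def delay_forcing_def by (rule R(2))
  have Gc: "continuous_on {s..e} (G u)" if "continuous_on {s..e} u" for u e
    unfolding G_def using that \<delta> by (intro continuous_on_delay_forcing R b) auto
  have Op: "coef (Op u t) k = duhamel_coef v (G u) s t k" if u: "continuous_on {s..s+1} u" and t: "t \<in> {s..s+1}" for u t k
  proof -
    have "continuous_on {s..t} (G u)"
      by (rule continuous_on_subset[OF Gc[OF u]]) (use t in auto)
    moreover have "s \<le> t" using t by simp
    ultimately have "\<exists>w. \<forall>k. coef w k = duhamel_coef v (G u) s t k"
      by (intro duhamel_solve[OF _ _ GB])
    then have "\<forall>k. coef (Op u t) k = duhamel_coef v (G u) s t k"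
      unfolding Op_def by (rule someI_ex)
    then show ?thesis ..
  qed
  have Opc: "continuous_on {s..s+1} (Op u)" if u: "continuous_on {s..s+1} u" for u
  proof (rule continuous_on_h10_tail[OF tail_bound_tendsto])
    show "(\<Sum>k\<in>{N..<n}. h1_term (Op u t) k) \<le> tail_bound v B N" if "t \<in> {s..s+1}" for t N n
      unfolding Op[OF u that] using that GB
      by (intro duhamel_coef_tail continuous_on_subset[OF Gc[OF u]]) auto
    have "continuous_on {s..s+1} (\<lambda>t. duhamel_coef v (G u) s t k)" for k
      by (rule continuous_on_duhamel_coef[OF Gc[OF u]])
    then show "continuous_on {s..s+1} (\<lambda>t. coef (Op u t) k)" for k
      by (rule continuous_on_cong[THEN iffD1, rotated -1]) (simp_all add: Op[OF u])
  qed
  define U where "U j = (Op ^^ j) (\<lambda>_. v)" for j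
  have U_Suc: "U (Suc j) = Op (U j)" and U_0: "U 0 = (\<lambda>_. v)" for j by (simp_all add: U_def)
  have Uc: "continuous_on {s..s+1} (U j)" for j
    by (induction j) (simp_all add: U_0 U_Suc Opc)
  have agree: "U (Suc j) t = U j t" if "t \<in> {s..s+1}" "t \<le> s + real j * \<delta>" for j t
    using that
  proof (induction j arbitrary: t)
    case 0
    then have "t = s" by simp
    have "coef (Op (U 0) s) k = coef v k" for k
      using Op[OF Uc, of s 0 k] by (simp add: duhamel_coef_start)
    then show ?case unfolding U_Suc \<open>t = s\<close> by (intro coef_eqI) (simp add: U_0)
  next
    case (Suc j)
    have d: "U (Suc j) (max s (r - \<delta>)) = U j (max s (r - \<delta>))" if "r \<in> {s..t}" for r
    proof (rule Suc.IH)
      have "r - \<delta> \<le> s + real j * \<delta>" using that Suc.prems(2) by (auto simp: algebra_simps of_nat_Suc)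
      moreover have "0 \<le> real j * \<delta>" using \<delta> by simp
      ultimately show "max s (r - \<delta>) \<le> s + real j * \<delta>" by simp
      show "max s (r - \<delta>) \<in> {s..s + 1}" using that Suc.prems(1) \<delta> by auto
    qed
    have "G (U (Suc j)) r = G (U j) r" if r: "r \<in> {s..t}" for r
    proof -
      have "integral {s..r} (\<lambda>q. b (U (Suc j) (max s (q - \<delta>)))) = integral {s..r} (\<lambda>q. b (U j (max s (q - \<delta>))))"
        by (rule integral_cong) (use d r in auto)
      then show ?thesis unfolding G_def delay_forcing_def using d[OF r] by simp
    qed
    then have "duhamel_coef v (G (U (Suc j))) s t k = duhamel_coef v (G (U j)) s t k" for k
      by (rule duhamel_coef_cong)
    then have "coef (U (Suc (Suc j)) t) k = coef (U (Suc j) t) k" for k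
      using Op[OF Uc[of "Suc j"] Suc.prems(1), of k] Op[OF Uc[of j] Suc.prems(1), of k]
      unfolding U_Suc[symmetric] by simp
    then show ?case by (rule coef_eqI)
  qed
  obtain j where "1 / \<delta> \<le> real j" using real_arch_simple by blast
  then have j: "1 \<le> real j * \<delta>" using \<delta> by (simp add: divide_le_eq)
  have "coef (U j t) k = duhamel_coef v (delay_forcing R b A s \<delta> (U j)) s t k" if t: "t \<in> {s..s+1}" for t k
    using Op[OF Uc t, of j k] agree[OF t, of j] t j unfolding U_Suc G_def by simp
  with Uc show thesis by (rule that)
qed

text \<open>With the exponential factor the coefficient is a constant plus the integral of a bounded
  function. The constant grows with \<open>k\<close>, which is harmless: equicontinuity is used for
  one coefficient at a time and the tails are handled separately.\<close>

lemma duhamel_coef_lipschitz: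
  assumes F: "continuous_on {s..e} F" and B: "\<And>r. r \<in> {s..e} \<Longrightarrow> norm (F r) \<le> B"
    and t: "t \<in> {s..e}" "t' \<in> {s..e}"
  shows "\<bar>exp (lapl k * t) * duhamel_coef v F s t k - exp (lapl k * t') * duhamel_coef v F s t' k\<bar>
    \<le> exp (lapl k * e) * B * \<bar>t - t'\<bar>"
proof -
  let ?f = "\<lambda>r. exp (lapl k * r) * cf (F r) k"
  have Q: "exp (lapl k * t) * duhamel_coef v F s t k = exp (lapl k * s) * coef v k + integral {s..t} ?f" for t
    using duhamel_coef_iff by blast
  have fc: "continuous_on {s..e} ?f" by (intro continuous_intros F)
  have "\<bar>integral {s..y} ?f - integral {s..x} ?f\<bar> \<le> exp (lapl k * e) * B * (y - x)"
    if xy: "s \<le> x" "x \<le> y" "y \<le> e" for x y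
  proof -
    have "integral {s..x} ?f + integral {x..y} ?f = integral {s..y} ?f"
      using xy by (intro integral_combine_Icc integrable_continuous_real continuous_on_subset[OF fc]) auto
    moreover have "norm (integral {x..y} ?f) \<le> exp (lapl k * e) * B * (y - x)"
    proof (rule integral_bound)
      show "continuous_on {x..y} ?f" using xy by (intro continuous_on_subset[OF fc]) auto
      show "norm (?f r) \<le> exp (lapl k * e) * B" if r: "r \<in> {x..y}" for r
      proof -
        have "lapl k * r \<le> lapl k * e" using r xy by (intro mult_left_mono) auto
        moreover have "\<bar>cf (F r) k\<bar> \<le> B"
          using inner_mode_le[of "F r" k] B[of r] r xy by auto
        ultimately show ?thesis
          unfolding real_norm_def abs_mult abs_exp_cancel by (intro mult_mono) auto
      qed
    qed (use xy in auto)
    ultimately show ?thesis by (simp add: abs_le_iff)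
  qed
  note * = this
  show ?thesis
  proof (cases "t \<le> t'")
    case True
    then show ?thesis unfolding Q using *[of t t'] t by (simp add: abs_minus_commute)
  next
    case False
    then show ?thesis unfolding Q using *[of t' t] t by simp
  qed
qed

lemma rational_near:
  fixes s t e :: real
  assumes "t \<in> {s..s+1}" "0 < e"
  obtains q where "q \<in> \<rat>" "q \<in> {s..s+1}" "\<bar>t - q\<bar> < e"
proof -
  have "max s (t - e) < min (s + 1) (t + e)" using assms by auto
  then obtain q where "q \<in> \<rat>" "max s (t - e) < q" "q < min (s + 1) (t + e)"
    using Rats_dense_in_real by blast
  then show thesis by (intro that[of q]) auto
qed

text \<open>Tonelli's method: solutions of the equation with a small delay exist by recursion, and they
  are relatively compact by \<open>h10_tail_convergence\<close>.\<close>

lemma bounded_local_existence: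
  fixes s :: real and R :: "h10 \<Rightarrow> real \<Rightarrow> l2"
  assumes R: "continuous_on UNIV (\<lambda>(v, p). R v p)" "\<And>v p. norm (R v p) \<le> B"
    and b: "continuous_on UNIV b" "\<And>v. \<bar>b v\<bar> \<le> M"
  obtains u where "continuous_on {s..s+1} u" "u s = v"
    "\<And>t. t \<in> {s..s+1} \<Longrightarrow> duhamel (\<lambda>r. R (u r) (A + integral {s..r} (\<lambda>q. b (u q)))) s t u"
proof -
  let ?S = "{s..s+1}"
  define dl where "dl n = 1 / real (Suc n)" for n
  have dl: "0 < dl n" for n by (simp add: dl_def)
  have "\<forall>n. \<exists>u. continuous_on ?S u \<and>
      (\<forall>t\<in>?S. \<forall>k. coef (u t) k = duhamel_coef v (delay_forcing R b A s (dl n) u) s t k)"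
    using delay_solution[OF dl R b(1)] by metis
  then obtain U0 where U0c: "\<And>n. continuous_on ?S (U0 n)"
    and U0: "\<And>n t k. t \<in> ?S \<Longrightarrow> coef (U0 n t) k = duhamel_coef v (delay_forcing R b A s (dl n) (U0 n)) s t k"
    by metis
  define F0 where "F0 n = delay_forcing R b A s (dl n) (U0 n)" for n
  have F0c: "continuous_on ?S (F0 n)" for n
    unfolding F0_def using dl[of n] by (intro continuous_on_delay_forcing U0c R b) auto
  have F0B: "norm (F0 n r) \<le> B" for n r unfolding F0_def delay_forcing_def by (rule R(2))
  have tail0: "(\<Sum>k\<in>{N..<m}. h1_term (U0 n t) k) \<le> tail_bound v B N" if "t \<in> ?S" for n t N m
    unfolding U0[OF that] F0_def[symmetric] using that F0B
    by (intro duhamel_coef_tail continuous_on_subset[OF F0c]) auto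
  define L where "L k = exp (lapl k * (s + 1)) * B" for k
  have lip0: "\<bar>exp (lapl k * t) * coef (U0 n t) k - exp (lapl k * t') * coef (U0 n t') k\<bar> \<le> L k * \<bar>t - t'\<bar>"
    if "t \<in> ?S" "t' \<in> ?S" for n t t' k
    unfolding U0[OF that(1)] U0[OF that(2)] F0_def[symmetric] L_def
    by (rule duhamel_coef_lipschitz[OF F0c F0B that])
  have B0: "0 \<le> B" using R(2)[of v 0] norm_ge_zero order_trans by blast
  have L0: "0 \<le> L k" for k using B0 by (simp add: L_def)
  \<comment> \<open>A diagonal sequence over the countable set of pairs of a mode and a rational
    time. The tail bound at 0 bounds every squared coefficient.\<close>
  obtain \<rho> where \<rho>: "strict_mono \<rho>"
    and \<rho>l: "\<And>kq. kq \<in> UNIV \<times> (\<rat> \<inter> ?S) \<Longrightarrow> \<exists>l. (\<lambda>n. coef (U0 (\<rho> n) (snd kq)) (fst kq)) \<longlonglongrightarrow> l"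
  proof (rule function_convergent_subsequence[of "UNIV \<times> (\<rat> \<inter> ?S)" "\<lambda>n kq. coef (U0 n (snd kq)) (fst kq)" "sqrt (tail_bound v B 0)"])
    show "countable (UNIV \<times> (\<rat> \<inter> ?S) :: (nat \<times> real) set)"
      by (intro countable_SIGMA countable_Int1 countable_rat) auto
    fix n and kq :: "nat \<times> real" assume "kq \<in> UNIV \<times> (\<rat> \<inter> ?S)"
    then have q: "snd kq \<in> ?S" by auto
    let ?k = "fst kq" and ?c = "coef (U0 n (snd kq)) (fst kq)"
    have "?c\<^sup>2 * 1 \<le> ?c\<^sup>2 * (1 + lapl ?k)" using lapl_pos[of ?k] by (intro mult_left_mono) auto
    also have "\<dots> \<le> (\<Sum>k\<in>{0..<Suc ?k}. h1_term (U0 n (snd kq)) k)"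
      by (subst mult.commute, rule member_le_sum) (auto intro!: mult_nonneg_nonneg add_nonneg_nonneg)
    also have "\<dots> \<le> tail_bound v B 0" by (rule tail0[OF q])
    finally show "norm (coef (U0 n (snd kq)) (fst kq)) \<le> sqrt (tail_bound v B 0)"
      using real_le_rsqrt[of "\<bar>?c\<bar>"] by simp
  qed blast
  define U where "U n = U0 (\<rho> n)" for n
  let ?q = "\<lambda>k n t. exp (lapl k * t) * coef (U n t) k"
  define d where "d n = dl (\<rho> n)" for n
  have d: "0 < d n" for n unfolding d_def by (rule dl)
  have dlim: "d \<longlonglongrightarrow> 0"
  proof -
    have "dl \<longlonglongrightarrow> 0" unfolding dl_def[abs_def] using LIMSEQ_Suc[OF lim_const_over_n[of 1]] by simp
    then show ?thesis unfolding d_def[abs_def] using LIMSEQ_subseq_LIMSEQ[OF _ \<rho>, of dl 0] by (simp add: o_def)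
  qed
  note Uc = U0c[of "\<rho> n" for n, folded U_def]
  note tail = tail0[where n = "\<rho> n" for n, folded U_def]
  note lip = lip0[where n = "\<rho> n" for n, folded U_def]
  \<comment> \<open>From rational to all times by the Lipschitz bound, in three parts of e/3; the 1
    in \<open>L k + 1\<close> avoids a division by zero.\<close>
  have "convergent (\<lambda>n. ?q k n t)" if t: "t \<in> ?S" for t k
  proof (rule Cauchy_convergent, rule metric_CauchyI)
    fix e :: real assume e: "0 < e"
    define e' where "e' = e / 3 / (L k + 1)"
    have e': "0 < e'" using e L0[of k] by (simp add: e'_def)
    obtain q where q: "q \<in> \<rat>" "q \<in> ?S" "\<bar>t - q\<bar> < e'"
      using rational_near[OF t e'] by blast
    have Lq: "L k * \<bar>t - q\<bar> \<le> e / 3"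
    proof -
      have "L k * \<bar>t - q\<bar> \<le> (L k + 1) * e'" using q(3) L0[of k] by (intro mult_mono) auto
      also have "\<dots> = e / 3"
        unfolding e'_def by (rule nonzero_mult_div_cancel_left[of _ "e / 3", folded times_divide_eq_right]) (use L0[of k] in linarith)
      finally show ?thesis .
    qed
    obtain l where "(\<lambda>n. coef (U n q) k) \<longlonglongrightarrow> l"
      using \<rho>l[of "(k, q)"] q by (auto simp: U_def)
    then have "(\<lambda>n. ?q k n q) \<longlonglongrightarrow> exp (lapl k * q) * l"
      by (intro tendsto_intros)
    then have "Cauchy (\<lambda>n. ?q k n q)" by (rule LIMSEQ_imp_Cauchy)
    moreover have "0 < e / 3" using e by simp
    ultimately obtain n0 where n0: "\<And>m n. n0 \<le> m \<Longrightarrow> n0 \<le> n \<Longrightarrow>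
        \<bar>?q k m q - ?q k n q\<bar> < e / 3"
      unfolding Cauchy_def dist_real_def by blast
    have "dist (?q k m t) (?q k n t) < e"
      if "n0 \<le> m" "n0 \<le> n" for m n
      using n0[OF that] lip[OF t q(2), of k m] lip[OF t q(2), of k n] Lq unfolding dist_real_def by linarith
    then show "\<exists>n0. \<forall>m\<ge>n0. \<forall>n\<ge>n0. dist (?q k m t) (?q k n t) < e"
      by blast
  qed
  then have "\<forall>t k. \<exists>l. t \<in> ?S \<longrightarrow> (\<lambda>n. ?q k n t) \<longlonglongrightarrow> l"
    unfolding convergent_def by blast
  then obtain Q where Q: "\<And>t k. t \<in> ?S \<Longrightarrow> (\<lambda>n. ?q k n t) \<longlonglongrightarrow> Q t k"
    by metis
  let ?c = "\<lambda>t k. exp (- (lapl k * t)) * Q t k"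
  \<comment> \<open>The times may vary with \<open>n\<close>, since the delayed arguments
    do.\<close>
  have Qmove: "(\<lambda>n. coef (U n (T n)) k) \<longlonglongrightarrow> ?c t k"
    if t: "t \<in> ?S" and T: "\<And>n. T n \<in> ?S" "T \<longlonglongrightarrow> t" for t T k
  proof -
    have "(\<lambda>n. exp (lapl k * T n) * coef (U n (T n)) k - ?q k n t) \<longlonglongrightarrow> 0"
    proof (rule Lim_null_comparison)
      show "\<forall>\<^sub>F n in sequentially. norm (exp (lapl k * T n) * coef (U n (T n)) k - ?q k n t) \<le> L k * \<bar>T n - t\<bar>"
        using lip[OF T(1) t] by simp
      show "(\<lambda>n. L k * \<bar>T n - t\<bar>) \<longlonglongrightarrow> 0"
        using tendsto_mult_right_zero[OF tendsto_rabs_zero[OF LIM_zero[OF T(2)]]] by simp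
    qed
    from tendsto_add[OF this Q[OF t, of k]]
    have "(\<lambda>n. exp (lapl k * T n) * coef (U n (T n)) k) \<longlonglongrightarrow> Q t k" by simp
    moreover have "(\<lambda>n. exp (- (lapl k * T n))) \<longlonglongrightarrow> exp (- (lapl k * t))"
      by (intro tendsto_intros T)
    ultimately have "(\<lambda>n. exp (- (lapl k * T n)) * (exp (lapl k * T n) * coef (U n (T n)) k)) \<longlonglongrightarrow> ?c t k"
      by (intro tendsto_mult)
    then show ?thesis unfolding exp_lapl_cancel .
  qed
  have ex: "\<exists>w. \<forall>k. coef w k = ?c t k" if t: "t \<in> ?S" for t
  proof -
    have "\<forall>\<^sub>F n in sequentially. \<forall>N m. (\<Sum>k\<in>{N..<m}. h1_term (U n t) k) \<le> tail_bound v B N"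
      using tail[OF t] by simp
    from h10_tail_convergence[OF sequentially_bot tail_bound_tendsto this Qmove[OF t t tendsto_const]]
    show ?thesis by metis
  qed
  define u where "u t = (SOME w. \<forall>k. coef w k = ?c t k)" for t
  have u: "coef (u t) k = ?c t k" if "t \<in> ?S" for t k
    unfolding u_def using someI_ex[OF ex[OF that]] by blast
  have lim: "(\<lambda>n. U n (T n)) \<longlonglongrightarrow> u t" if t: "t \<in> ?S" and T: "\<And>n. T n \<in> ?S" "T \<longlonglongrightarrow> t" for t T
  proof -
    have "\<forall>\<^sub>F n in sequentially. \<forall>N m. (\<Sum>k\<in>{N..<m}. h1_term (U n (T n)) k) \<le> tail_bound v B N"
      using tail[OF T(1)] by simp
    from h10_tail_convergence[OF sequentially_bot tail_bound_tendsto this Qmove[OF that]]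
    obtain w where w: "\<And>k. coef w k = ?c t k" "(\<lambda>n. U n (T n)) \<longlonglongrightarrow> w" by metis
    have "w = u t" by (rule coef_eqI) (simp only: w u[OF t])
    with w show ?thesis by simp
  qed
  have uc: "continuous_on ?S u"
  proof (rule continuous_on_h10_tail[OF tail_bound_tendsto])
    show "(\<Sum>k\<in>{N..<m}. h1_term (u t) k) \<le> tail_bound v B N" if t: "t \<in> ?S" for t N m
    proof (rule LIMSEQ_le_const2)
      show "(\<lambda>n. \<Sum>k\<in>{N..<m}. h1_term (U n t) k) \<longlonglongrightarrow> (\<Sum>k\<in>{N..<m}. h1_term (u t) k)"
        unfolding u[OF t] by (intro tendsto_intros Qmove[OF t t tendsto_const])
    qed (use tail[OF t] in blast)
    show "continuous_on ?S (\<lambda>t. coef (u t) k)" for k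
    proof -
      have Ql: "\<bar>Q x k - Q y k\<bar> \<le> L k * \<bar>x - y\<bar>" if xy: "x \<in> ?S" "y \<in> ?S" for x y
      proof (rule LIMSEQ_le_const2)
        show "(\<lambda>n. \<bar>?q k n x - ?q k n y\<bar>) \<longlonglongrightarrow> \<bar>Q x k - Q y k\<bar>"
          by (intro tendsto_intros Q xy)
      qed (use lip[OF xy] in blast)
      have "(L k)-lipschitz_on ?S (\<lambda>t. Q t k)"
        using Ql L0 by (intro lipschitz_onI) (auto simp: dist_real_def)
      then have "continuous_on ?S (\<lambda>t. Q t k)" by (rule lipschitz_on_continuous_on)
      then have "continuous_on ?S (\<lambda>t. ?c t k)" by (intro continuous_intros)
      then show ?thesis
        by (rule continuous_on_cong[THEN iffD1, rotated -1]) (simp_all only: u)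
    qed
  qed
  define F where "F r = R (u r) (A + integral {s..r} (\<lambda>q. b (u q)))" for r
  have delayed: "(\<lambda>n. U n (max s (r - d n))) \<longlonglongrightarrow> u r" if r: "r \<in> ?S" for r
  proof (rule lim[OF r])
    show "max s (r - d n) \<in> ?S" for n using r d[of n] by auto
    have "(\<lambda>n. max s (r - d n)) \<longlonglongrightarrow> max s (r - 0)" by (intro tendsto_intros dlim)
    then show "(\<lambda>n. max s (r - d n)) \<longlonglongrightarrow> r" using r by (simp add: max_absorb2)
  qed
  have blim: "(\<lambda>n. b (w n)) \<longlonglongrightarrow> b w'" if "w \<longlonglongrightarrow> w'" for w w'
    using continuous_on_tendsto_compose[OF b(1) that] by simp
  \<comment> \<open>State and clock converge together; for the clock, the bound \<open>M\<close> on
    \<open>b\<close> permits dominated convergence.\<close>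
  have Flim: "(\<lambda>n. F0 (\<rho> n) r) \<longlonglongrightarrow> F r" if r: "r \<in> ?S" for r
  proof -
    have "(\<lambda>n. integral {s..r} (\<lambda>q. b (U n (max s (q - d n))))) \<longlonglongrightarrow> integral {s..r} (\<lambda>q. b (u q))"
    proof (rule dominated_convergence(2)[where h = "\<lambda>_. M"])
      show "(\<lambda>q. b (U n (max s (q - d n)))) integrable_on {s..r}" for n
      proof (rule integrable_continuous_real, rule continuous_on_compose2[OF b(1)])
        show "continuous_on {s..r} (\<lambda>q. U n (max s (q - d n)))"
          using r d[of n] by (intro continuous_on_delay continuous_on_subset[OF Uc]) auto
      qed simp
      show "(\<lambda>n. b (U n (max s (q - d n)))) \<longlonglongrightarrow> b (u q)" if "q \<in> {s..r}" for q
        using that r by (intro blim delayed) auto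
    qed (use b(2) in auto)
    then have "(\<lambda>n. (U n (max s (r - d n)), A + integral {s..r} (\<lambda>q. b (U n (max s (q - d n))))))
        \<longlonglongrightarrow> (u r, A + integral {s..r} (\<lambda>q. b (u q)))"
      by (intro tendsto_intros delayed[OF r])
    from continuous_on_tendsto_compose[OF R(1) this]
    show ?thesis by (simp add: F_def F0_def delay_forcing_def U_def d_def)
  qed
  have main: "duhamel_coef v F s t k = coef (u t) k" if t: "t \<in> ?S" for t k
  proof -
    have "(\<lambda>n. integral {s..t} (\<lambda>r. exp (lapl k * r) * cf (F0 (\<rho> n) r) k))
        \<longlonglongrightarrow> integral {s..t} (\<lambda>r. exp (lapl k * r) * cf (F r) k)"
    proof (rule dominated_convergence(2)[where h = "\<lambda>r. exp (lapl k * r) * B"])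
      show "(\<lambda>r. exp (lapl k * r) * cf (F0 (\<rho> n) r) k) integrable_on {s..t}" for n
        using t by (intro integrable_continuous_real continuous_on_coef_integrand continuous_on_subset[OF F0c]) auto
      show "(\<lambda>r. exp (lapl k * r) * B) integrable_on {s..t}"
        by (intro integrable_continuous_real continuous_intros)
      show "norm (exp (lapl k * r) * cf (F0 (\<rho> n) r) k) \<le> exp (lapl k * r) * B" for n r
        unfolding real_norm_def abs_mult abs_exp_cancel
        by (intro mult_left_mono order_trans[OF inner_mode_le F0B]) simp
      show "(\<lambda>n. exp (lapl k * r) * cf (F0 (\<rho> n) r) k) \<longlonglongrightarrow> exp (lapl k * r) * cf (F r) k"
        if "r \<in> {s..t}" for r
        using that t by (intro tendsto_intros Flim) auto
    qed
    then have "(\<lambda>n. duhamel_coef v (F0 (\<rho> n)) s t k) \<longlonglongrightarrow> duhamel_coef v F s t k"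
      unfolding duhamel_coef_def by (intro tendsto_intros)
    moreover have "(\<lambda>n. duhamel_coef v (F0 (\<rho> n)) s t k) \<longlonglongrightarrow> coef (u t) k"
      using Qmove[OF t t tendsto_const, of k] unfolding u[OF t] U_def U0[OF t] F0_def .
    ultimately show ?thesis by (rule LIMSEQ_unique)
  qed
  have us: "u s = v"
    by (rule coef_eqI) (use main[of s] in \<open>simp add: duhamel_coef_start\<close>)
  show thesis
  proof (rule that[OF uc us])
    fix t assume "t \<in> ?S"
    then show "duhamel (\<lambda>r. R (u r) (A + integral {s..r} (\<lambda>q. b (u q)))) s t u"
      unfolding duhamel_iff_coef us F_def[symmetric] using main by simp
  qed
qed

section \<open>The nonlinearity\<close>

lemma sq_integrable_comp_fun_of:
  assumes "continuous_on UNIV f"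
  shows "sq_integrable (\<lambda>x. f (fun_of v x))"
  by (rule sq_integrable_continuous) (rule continuous_on_compose2[OF assms fun_of_continuous], simp)

text \<open>Convergence in H^1_0 is uniform convergence of functions, and near \<open>v\<close> all
  values lie in one compact interval, on which \<open>f\<close> is uniformly continuous. No growth
  of \<open>f\<close> enters.\<close>

lemma continuous_on_nemytskii:
  assumes f: "continuous_on UNIV f"
  shows "continuous_on UNIV (\<lambda>v. to_l2 (\<lambda>x. f (fun_of v x)))"
proof (rule continuous_onI)
  fix v :: h10 and e :: real assume e: "0 < e"
  let ?R = "norm v + 1"
  have "uniformly_continuous_on {-?R..?R} f"
    by (intro compact_uniformly_continuous continuous_on_subset[OF f]) auto
  then obtain d where d: "0 < d" "\<And>x y. x \<in> {-?R..?R} \<Longrightarrow> y \<in> {-?R..?R} \<Longrightarrow> \<bar>x - y\<bar> < d \<Longrightarrow> \<bar>f x - f y\<bar> < e"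
    using e unfolding uniformly_continuous_on_def dist_real_def by metis
  have "dist (to_l2 (\<lambda>x. f (fun_of w x))) (to_l2 (\<lambda>x. f (fun_of v x))) \<le> e" if w: "dist w v < min d 1" for w
  proof -
    have "norm w \<le> ?R" using w norm_triangle_sub[of w v] by (simp add: dist_norm)
    then have b: "fun_of w x \<in> {-?R..?R}" "fun_of v x \<in> {-?R..?R}" for x
      using fun_of_bound[of w x] fun_of_bound[of v x] by auto
    have "\<bar>fun_of w x - fun_of v x\<bar> < d" for x
      using fun_of_bound[of "w - v" x] w by (simp add: fun_of_diff dist_norm)
    then have "\<bar>f (fun_of w x) - f (fun_of v x)\<bar> \<le> e" for x
      using d(2)[OF b] by (simp add: less_imp_le)
    then have "norm (to_l2 (\<lambda>x. f (fun_of w x) - f (fun_of v x))) \<le> e"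
      using e by (intro to_l2_norm_le sq_integrable_diff sq_integrable_comp_fun_of f) auto
    then show ?thesis
      by (simp add: dist_norm to_l2_diff sq_integrable_comp_fun_of f)
  qed
  then show "\<exists>d>0. \<forall>w\<in>UNIV. dist w v < d \<longrightarrow> dist (to_l2 (\<lambda>x. f (fun_of w x))) (to_l2 (\<lambda>x. f (fun_of v x))) \<le> e"
    using d(1) by (intro exI[of _ "min d 1"]) simp
qed

text \<open>The state and the clock value as independent arguments: the reaction sees the history of
  \<open>u\<close> only through the clock, so joint continuity in the pair is what both the delay
  method and the continuity of the forcing rest on.\<close>

definition rhs ::
    "real \<Rightarrow> (real \<Rightarrow> real) \<Rightarrow> (real \<Rightarrow> real) \<Rightarrow> (h10 \<Rightarrow> real) \<Rightarrow> h10 \<Rightarrow> real \<Rightarrow> l2" where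
  "rhs lam f h b v p = to_l2 (\<lambda>x. (lam * f (fun_of v x) + h p) / b v)"

lemma reaction_eq_rhs:
  "reaction lam f h a l \<sigma> u t = rhs lam f h (\<lambda>v. a (l v)) (u t) (time_change a l \<sigma> u t)"
  by (simp add: reaction_def rhs_def)

lemma sq_integrable_one: "sq_integrable (\<lambda>x. 1)"
  by (rule sq_integrable_continuous) simp

lemma rhs_eq:
  assumes f: "continuous_on UNIV f"
  shows "rhs lam f h b v p = (1 / b v) *\<^sub>R (lam *\<^sub>R to_l2 (\<lambda>x. f (fun_of v x)) + h p *\<^sub>R to_l2 (\<lambda>x. 1))"
proof -
  note s = sq_integrable_comp_fun_of[OF f, of v] sq_integrable_one
  have "to_l2 (\<lambda>x. 1 / b v * (lam * f (fun_of v x) + h p * 1)) =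
      (1 / b v) *\<^sub>R (lam *\<^sub>R to_l2 (\<lambda>x. f (fun_of v x)) + h p *\<^sub>R to_l2 (\<lambda>x. 1))"
    by (simp only: to_l2_scale to_l2_add sq_integrable_add sq_integrable_scale s)
  then show ?thesis by (simp add: rhs_def)
qed

lemma continuous_on_rhs:
  assumes f: "continuous_on UNIV f" and h: "continuous_on UNIV h" and b: "continuous_on UNIV b"
    and b0: "\<And>v. b v \<noteq> 0"
  shows "continuous_on UNIV (\<lambda>(v, p). rhs lam f h b v p)"
  unfolding rhs_eq[OF f] case_prod_beta
  by (intro continuous_intros continuous_on_compose2[OF b] continuous_on_compose2[OF h]
      continuous_on_compose2[OF continuous_on_nemytskii[OF f]]) (auto simp: b0)

lemma norm_rhs_le:
  assumes f: "continuous_on UNIV f" and fB: "\<And>x. \<bar>f (fun_of v x)\<bar> \<le> Bf" and hH: "\<bar>h p\<bar> \<le> H"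
    and m: "0 < m" "m \<le> b v" and lam: "0 \<le> lam"
  shows "norm (rhs lam f h b v p) \<le> (lam * Bf + H) / m"
proof -
  have Bf: "0 \<le> Bf" using fB[of 0] by linarith
  have num: "\<bar>lam * f (fun_of v x) + h p\<bar> \<le> lam * Bf + H" for x
  proof -
    have "\<bar>lam * f (fun_of v x)\<bar> \<le> lam * Bf" using lam fB by (simp add: abs_mult mult_left_mono)
    then show ?thesis using hH by linarith
  qed
  have "sq_integrable (\<lambda>x. (lam * f (fun_of v x) + h p) / b v)"
    by (intro sq_integrable_continuous continuous_intros continuous_on_compose2[OF f fun_of_continuous])
       (use m in auto)
  then show ?thesis
    unfolding rhs_def
  proof (rule to_l2_norm_le)
    have "0 \<le> lam * Bf + H" using num[of 0] by linarith
    then show "0 \<le> (lam * Bf + H) / m" using m by simp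
    show "\<bar>(lam * f (fun_of v x) + h p) / b v\<bar> \<le> (lam * Bf + H) / m" for x
      using num[of x] m by (simp add: abs_divide) (rule frac_le, auto)
  qed
qed

section \<open>Continuation of solutions\<close>

locale quasilinear_problem =
  fixes lam m M C0 C1 :: real and a h f :: "real \<Rightarrow> real" and l :: "h10 \<Rightarrow> real"
  assumes lam: "0 < lam"
    and m: "0 < m"
    and a: "continuous_on {0..} a" "a \<in> {0..} \<rightarrow> {m..M}"
    and l: "continuous_on UNIV l" "\<And>v. 0 \<le> l v"
    and h: "continuous_on UNIV h" "bounded (range h)"
    and f: "continuous_on UNIV f"
      "\<And>r. 0 < r \<Longrightarrow> \<exists>\<gamma>>0. mono_on {-r<..<r} (\<lambda>s. \<gamma> * s + lam * f s)"
    and growth: "\<And>y. y * f y \<le> - (m / lam) * C0 * y\<^sup>2 + \<bar>y\<bar> * C1"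
begin

abbreviation b :: "h10 \<Rightarrow> real" where "b v \<equiv> a (l v)"

abbreviation F :: "real \<Rightarrow> (real \<Rightarrow> h10) \<Rightarrow> real \<Rightarrow> l2" where
  "F \<equiv> reaction lam f h a l"

abbreviation \<alpha> :: "real \<Rightarrow> (real \<Rightarrow> h10) \<Rightarrow> real \<Rightarrow> real" where
  "\<alpha> \<equiv> time_change a l"

lemma b_bounds: "m \<le> b v" "b v \<le> M" "0 < b v"
proof -
  have "b v \<in> {m..M}" by (rule PiE[OF a(2), of "l v"]) (use l(2)[of v] in auto)
  then show "m \<le> b v" "b v \<le> M" "0 < b v" using m by auto
qed

lemma continuous_on_b: "continuous_on UNIV b"
  by (rule continuous_on_compose2[OF a(1) l(1)]) (use l(2) in auto)

lemma continuous_on_b_comp: "continuous_on S u \<Longrightarrow> continuous_on S (\<lambda>r. b (u r))"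
  by (rule continuous_on_compose2[OF continuous_on_b]) auto

lemma f_bounded_Icc:
  obtains B where "\<And>y. y \<in> {p..q} \<Longrightarrow> \<bar>f y\<bar> \<le> B"
proof -
  have "compact (f ` {p..q})" by (intro compact_continuous_image continuous_on_subset[OF f(1)]) auto
  then show thesis using that by (metis compact_imp_bounded bounded_iff imageI real_norm_def)
qed

definition H :: real where "H = (SOME H. \<forall>p. \<bar>h p\<bar> \<le> H)"

lemma h_le: "\<bar>h p\<bar> \<le> H"
proof -
  have "\<exists>H. \<forall>p. \<bar>h p\<bar> \<le> H" using h(2) unfolding bounded_iff by auto
  from someI_ex[OF this] show ?thesis unfolding H_def by blast
qed

lemma H_nonneg: "0 \<le> H" using h_le[of 0] by linarith

text \<open>The absolute value relaxes the growth condition to linear growth at a nonnegative rate,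
  whatever the sign of \<open>C0\<close>; this suffices on bounded time intervals.\<close>

definition D :: real where "D = \<bar>m / lam * C0\<bar>"

lemma growth_upper:
  assumes "0 < y"
  shows "f y \<le> D * y + \<bar>C1\<bar>" "- f (- y) \<le> D * y + \<bar>C1\<bar>"
proof -
  have "- (m / lam) * C0 \<le> D"
    unfolding D_def using abs_ge_minus_self[of "m / lam * C0"] by simp
  then have "- (m / lam) * C0 * y\<^sup>2 \<le> D * y\<^sup>2" by (rule mult_right_mono) simp
  moreover have "y * C1 \<le> y * \<bar>C1\<bar>" using assms by (intro mult_left_mono) auto
  moreover have "y * (D * y + \<bar>C1\<bar>) = D * y\<^sup>2 + y * \<bar>C1\<bar>"
    by (simp add: power2_eq_square algebra_simps)
  moreover have "y * f y \<le> - (m / lam) * C0 * y\<^sup>2 + y * C1"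
    using growth[of y] assms by simp
  moreover have "y * (- f (- y)) \<le> - (m / lam) * C0 * y\<^sup>2 + y * C1"
    using growth[of "- y"] assms by simp
  ultimately have "y * f y \<le> y * (D * y + \<bar>C1\<bar>)" "y * (- f (- y)) \<le> y * (D * y + \<bar>C1\<bar>)"
    by linarith+
  then show "f y \<le> D * y + \<bar>C1\<bar>" "- f (- y) \<le> D * y + \<bar>C1\<bar>"
    by (simp_all only: mult_le_cancel_left_pos[OF assms])
qed

lemma continuous_on_time_change:
  "continuous_on {\<sigma>..e} u \<Longrightarrow> continuous_on {\<sigma>..e} (\<alpha> \<sigma> u)"
  unfolding time_change_def[abs_def]
  by (intro continuous_intros indefinite_integral_continuous_1 integrable_continuous_real continuous_on_b_comp)

lemma continuous_on_reaction:
  assumes u: "continuous_on {\<sigma>..e} u"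
  shows "continuous_on {\<sigma>..e} (F \<sigma> u)"
proof -
  have "continuous_on UNIV (\<lambda>(v, p). rhs lam f h b v p)"
    by (rule continuous_on_rhs[OF f(1) h(1) continuous_on_b]) (use b_bounds(3) less_irrefl in metis)
  from continuous_on_compose2[OF this continuous_on_Pair[OF u continuous_on_time_change[OF u]]]
  show ?thesis by (simp add: reaction_eq_rhs[abs_def])
qed

lemma time_change_cong:
  "(\<And>r. r \<in> {\<sigma>..t} \<Longrightarrow> u r = v r) \<Longrightarrow> \<alpha> \<sigma> u t = \<alpha> \<sigma> v t"
  unfolding time_change_def by (intro arg_cong2[where f = "(+)"] refl integral_cong) simp

text \<open>Causality: the clock looks back to \<sigma> but never ahead. This is what makes it
  possible to glue and extend solutions.\<close>

lemma reaction_cong: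
  "(\<And>r. r \<in> {\<sigma>..t} \<Longrightarrow> u r = v r) \<Longrightarrow> \<sigma> \<le> t \<Longrightarrow> F \<sigma> u t = F \<sigma> v t"
  using time_change_cong[of \<sigma> t u v] by (simp add: reaction_eq_rhs)

lemma duhamel_reaction_cong:
  assumes "\<And>r. r \<in> {\<sigma>..t} \<Longrightarrow> u r = v r" "\<sigma> \<le> t"
  shows "duhamel (F \<sigma> u) \<sigma> t u \<longleftrightarrow> duhamel (F \<sigma> v) \<sigma> t v"
proof (rule duhamel_cong)
  show "F \<sigma> u r = F \<sigma> v r" if "r \<in> {\<sigma>..t}" for r
    using that assms by (intro reaction_cong) auto
qed (use assms in auto)

lemma forward_interval_Icc: "forward_interval \<sigma> I \<Longrightarrow> t \<in> I \<Longrightarrow> {\<sigma>..t} \<subseteq> I"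
  unfolding forward_interval_def by (meson atLeastAtMost_iff mem_is_interval_1_I subsetI)

lemma mild_solution_iff:
  "mild_solution lam f h a l \<sigma> w0 I u \<longleftrightarrow>
     forward_interval \<sigma> I \<and> continuous_on I u \<and> u \<sigma> = w0 \<and> (\<forall>t\<in>I. duhamel (F \<sigma> u) \<sigma> t u)"
proof -
  have "((\<lambda>s. heat_semigroup (t - s) (F \<sigma> u s)) has_integral
               h10_to_l2 (u t) - heat_semigroup (t - \<sigma>) (h10_to_l2 w0)) {\<sigma>..t} \<longleftrightarrow> duhamel (F \<sigma> u) \<sigma> t u"
    if "forward_interval \<sigma> I" "continuous_on I u" "u \<sigma> = w0" "t \<in> I" for t
  proof -
    have st: "\<sigma> \<le> t" using that(1,4) unfolding forward_interval_def by auto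
    have "continuous_on {\<sigma>..t} u"
      by (rule continuous_on_subset[OF that(2) forward_interval_Icc[OF that(1,4)]])
    then show ?thesis
      using has_integral_heat_iff_duhamel[OF st continuous_on_reaction] that(3) by blast
  qed
  then show ?thesis unfolding mild_solution_def by blast
qed

text \<open>\<open>f\<close> is frozen outside the radius norm v + 1, which makes the forcing
  bounded. For a short time the solution stays within distance 1 of \<open>v\<close>, hence below
  that radius in supremum norm, and the truncation is not felt. \<open>A\<close> is the clock value
  at the restart.\<close>

lemma local_existence:
  obtains \<delta> u where "0 < \<delta>" "continuous_on {s..s+\<delta>} u" "u s = v"
    "\<And>t. t \<in> {s..s+\<delta>} \<Longrightarrow> duhamel (\<lambda>r. rhs lam f h b (u r) (A + integral {s..r} (\<lambda>q. b (u q)))) s t u"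
proof -
  let ?R = "norm v + 1"
  define g where "g y = f (max (- ?R) (min ?R y))" for y
  have gc: "continuous_on UNIV g"
    unfolding g_def[abs_def] by (rule continuous_on_compose2[OF f(1)]) (auto intro!: continuous_intros)
  have gf: "g y = f y" if "\<bar>y\<bar> \<le> ?R" for y using that by (simp add: g_def abs_le_iff min_absorb2 max_absorb2)
  obtain Bf where Bf: "\<And>y. y \<in> {-?R..?R} \<Longrightarrow> \<bar>f y\<bar> \<le> Bf" by (rule f_bounded_Icc) blast
  have gB: "\<bar>g y\<bar> \<le> Bf" for y
    unfolding g_def using norm_ge_zero[of v] by (intro Bf) auto
  obtain u where u: "continuous_on {s..s+1} u" "u s = v"
    and d: "\<And>t. t \<in> {s..s+1} \<Longrightarrow> duhamel (\<lambda>r. rhs lam g h b (u r) (A + integral {s..r} (\<lambda>q. b (u q)))) s t u"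
  proof (rule bounded_local_existence[of "rhs lam g h b" "(lam * Bf + H) / m" b M s v A])
    show "continuous_on UNIV (\<lambda>(v, p). rhs lam g h b v p)"
      by (rule continuous_on_rhs[OF gc h(1) continuous_on_b]) (use b_bounds(3) less_irrefl in metis)
    show "norm (rhs lam g h b v p) \<le> (lam * Bf + H) / m" for v p
      by (rule norm_rhs_le) (use gc gB h_le m b_bounds(1) lam in auto)
    show "\<bar>b v\<bar> \<le> M" for v using b_bounds(2,3)[of v] by simp
  qed (use continuous_on_b in blast)+
  obtain e where e: "0 < e" "\<And>t. t \<in> {s..s+1} \<Longrightarrow> dist t s < e \<Longrightarrow> dist (u t) (u s) < 1"
    using u(1) unfolding continuous_on_iff by (metis atLeastAtMost_iff le_add_same_cancel1 order_refl zero_le_one zero_less_one)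
  define \<delta> where "\<delta> = min 1 (e / 2)"
  have \<delta>: "0 < \<delta>" "\<delta> \<le> 1" "\<delta> < e" using e(1) by (auto simp: \<delta>_def)
  have eq: "rhs lam g h b (u r) p = rhs lam f h b (u r) p" if r: "r \<in> {s..s+\<delta>}" for r p
  proof -
    have "dist (u r) (u s) < 1" using r \<delta> by (intro e(2)) (auto simp: dist_real_def)
    then have "norm (u r) \<le> ?R" using norm_triangle_sub[of "u r" v] by (simp add: u(2) dist_norm)
    then have "\<bar>fun_of (u r) x\<bar> \<le> ?R" for x using fun_of_bound[of "u r" x] by linarith
    then show ?thesis by (simp add: rhs_def gf)
  qed
  show thesis
  proof (rule that[of \<delta> u])
    show "0 < \<delta>" "u s = v" by fact+
    show "continuous_on {s..s+\<delta>} u" by (rule continuous_on_subset[OF u(1)]) (use \<delta> in auto)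
    fix t assume t: "t \<in> {s..s+\<delta>}"
    then have "t \<in> {s..s+1}" using \<delta> by auto
    from d[OF this] show "duhamel (\<lambda>r. rhs lam f h b (u r) (A + integral {s..r} (\<lambda>q. b (u q)))) s t u"
      by (subst (asm) duhamel_cong[OF _ refl refl]) (use eq t in auto)
  qed
qed

text \<open>Adding \<open>\<gamma> z\<close> makes the nonlinearity increasing, hence controlled by its values at \<open>\<plusminus>Y\<close>, where
  the one-sided growth condition applies.\<close>

lemma shifted_reaction_le:
  assumes g: "0 < g" "mono_on {-r<..<r} (\<lambda>s. g * s + lam * f s)"
    and z: "\<bar>z\<bar> \<le> Y" and Y: "0 < Y" "Y < r" and \<beta>: "m \<le> \<beta>" and p: "\<bar>p\<bar> \<le> H"
  shows "\<bar>(lam * f z + p) / \<beta> + g / m * z\<bar> \<le> g / m * Y + (lam * (D * Y + \<bar>C1\<bar>) + H) / m"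
proof -
  let ?C = "lam * (D * Y + \<bar>C1\<bar>)"
  have C: "0 \<le> ?C" using lam Y by (simp add: D_def)
  have \<beta>0: "0 < \<beta>" using \<beta> m by linarith
  have up: "lam * f Y \<le> ?C" "lam * (- f (- Y)) \<le> ?C"
    using growth_upper[OF Y(1)] lam by (intro mult_left_mono; simp)+
  have "g * z + lam * f z \<le> g * Y + lam * f Y"
    using z Y by (intro mono_onD[OF g(2)]) auto
  then have 1: "lam * f z \<le> g * (Y - z) + ?C" using up(1) by (simp add: algebra_simps)
  have "g * (- Y) + lam * f (- Y) \<le> g * z + lam * f z"
    using z Y by (intro mono_onD[OF g(2)]) auto
  then have 2: "- (lam * f z) \<le> g * (Y + z) + ?C" using up(2) by (simp add: algebra_simps)
  have pos: "0 \<le> g * (Y - z)" "0 \<le> g * (Y + z)" using z g(1) by (auto intro!: mult_nonneg_nonneg)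
  \<comment> \<open>The bound on the numerator is nonnegative, so replacing \<beta> by the smaller
    \<open>m\<close> enlarges it. The resulting term -(g/m) z cancels the shift exactly, which is
    why the shift is the constant g/m rather than g/\<beta>.\<close>
  have 3: "(lam * f z + p) / \<beta> \<le> (g * (Y - z) + ?C + H) / m"
    by (rule order_trans[OF divide_right_mono divide_left_mono])
       (use 1 p pos C H_nonneg \<beta> \<beta>0 m in \<open>auto intro!: add_nonneg_nonneg\<close>)
  have 4: "- (lam * f z + p) / \<beta> \<le> (g * (Y + z) + ?C + H) / m"
    by (rule order_trans[OF divide_right_mono divide_left_mono])
       (use 2 p pos C H_nonneg \<beta> \<beta>0 m in \<open>auto intro!: add_nonneg_nonneg\<close>)
  have E: "(g * (Y - z) + ?C + H) / m = g / m * Y + (?C + H) / m - g / m * z"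
    "(g * (Y + z) + ?C + H) / m = g / m * Y + (?C + H) / m + g / m * z"
    by (simp_all add: add_divide_distrib diff_divide_distrib algebra_simps)
  show ?thesis
    unfolding abs_le_iff using 3 4[folded minus_divide_left] unfolding E by (intro conjI; linarith)
qed

end

section \<open>The a priori bound and the extension of solutions\<close>

context quasilinear_problem
begin

text \<open>Comparison with \<open>y\<close>, which satisfies y' = G y. Up to the infimum
  \<open>ts\<close> of the times where \<bar>u\<bar> exceeds \<open>y\<close>, the shifted forcing
  is at most (\<gamma> + G) y, and variation of constants with decay \<gamma> turns exactly this
  back into \<open>y\<close>, whatever \<gamma> is. The head start of \<open>y\<close> at \<sigma>
  survives as a positive gap at \<open>ts\<close>, which contradicts the choice of
  \<open>ts\<close>.\<close>

lemma a_priori_bound: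
  assumes u: "continuous_on {\<sigma>..<T} u"
    and d: "\<And>t. t \<in> {\<sigma>..<T} \<Longrightarrow> duhamel (F \<sigma> u) \<sigma> t u" and T: "\<sigma> < T"
  obtains K where "\<And>t x. t \<in> {\<sigma>..<T} \<Longrightarrow> \<bar>fun_of (u t) x\<bar> \<le> K"
proof -
  \<comment> \<open>The added 1 is the head start, and it also keeps \<open>y \<ge> 1\<close>, so
    that the constant terms of the forcing bound are absorbed into the rate
    \<open>G\<close>.\<close>
  define y0 where "y0 = norm (u \<sigma>) + 1"
  define G where "G = (lam * (D + \<bar>C1\<bar>) + H) / m"
  define y where "y t = y0 * exp (G * (t - \<sigma>))" for t
  have y0: "1 \<le> y0" by (simp add: y0_def)
  have D: "0 \<le> D" by (simp add: D_def)
  have G: "0 \<le> G" unfolding G_def using lam m D H_nonneg by simp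
  have y_mono: "y s \<le> y t" if "s \<le> t" for s t
    unfolding y_def using that G y0 by (intro mult_left_mono) (auto intro: mult_left_mono)
  have y1: "1 \<le> y t" if "\<sigma> \<le> t" for t 
  proof -
    have "y \<sigma> = y0" by (simp add: y_def)
    then show ?thesis using y_mono[OF that] y0 by linarith
  qed
  have yc: "continuous_on S y" for S unfolding y_def[abs_def] by (intro continuous_intros)
  have "\<bar>fun_of (u t) x\<bar> \<le> y T" if t: "t \<in> {\<sigma>..<T}" for t x
  proof (rule ccontr)
    assume neg: "\<not> \<bar>fun_of (u t) x\<bar> \<le> y T"
    define Z where "Z = {t \<in> {\<sigma>..<T}. \<exists>x. y t < \<bar>fun_of (u t) x\<bar>}"
    have "t \<in> Z" unfolding Z_def using t neg y_mono[of t T] by (intro CollectI conjI exI[of _ x]) auto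
    moreover have Zb: "bdd_below Z" by (rule bdd_belowI[of _ \<sigma>]) (simp add: Z_def)
    define ts where "ts = Inf Z"
    have ts_le: "ts \<le> t" unfolding ts_def by (rule cInf_lower[OF \<open>t \<in> Z\<close> Zb])
    have ts_ge: "\<sigma> \<le> ts" unfolding ts_def
      by (rule cInf_greatest) (use \<open>t \<in> Z\<close> in \<open>auto simp: Z_def\<close>)
    have ts: "\<sigma> \<le> ts" "ts < T" using ts_ge ts_le t by auto
    have uc: "continuous_on {\<sigma>..ts} u" by (rule continuous_on_subset[OF u]) (use ts in auto)
    have before: "\<bar>fun_of (u r) x\<bar> \<le> y r" if "r \<in> {\<sigma>..<ts}" for r x
    proof (rule ccontr)
      assume "\<not> \<bar>fun_of (u r) x\<bar> \<le> y r"
      then have "r \<in> Z" unfolding Z_def using that ts by (auto intro: exI[of _ x])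
      then have "ts \<le> r" unfolding ts_def by (rule cInf_lower[OF _ Zb])
      then show False using that by simp
    qed
    have fc: "continuous_on S (\<lambda>r. fun_of (u r) x)" if cu: "continuous_on S u" for S x
    proof (rule continuous_onI)
      fix r and e :: real assume r: "r \<in> S" and e: "0 < e"
      then obtain d where "0 < d" "\<And>q. q \<in> S \<Longrightarrow> dist q r < d \<Longrightarrow> dist (u q) (u r) < e"
        using cu unfolding continuous_on_iff by metis
      then show "\<exists>d>0. \<forall>q\<in>S. dist q r < d \<longrightarrow> dist (fun_of (u q) x) (fun_of (u r) x) \<le> e"
        using fun_of_bound[of "u q - u r" x for q] unfolding fun_of_diff dist_norm real_norm_def
        by (meson less_imp_le order_trans)
    qed
    have upto: "\<bar>fun_of (u r) x\<bar> \<le> y r" if r: "r \<in> {\<sigma>..ts}" for r x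
    proof (cases "\<sigma> < ts")
      case True
      have "\<bar>fun_of (u r) x\<bar> - y r \<le> 0"
      proof (rule continuous_le_on_closure[where S = "{\<sigma>..<ts}" and f = "\<lambda>r. \<bar>fun_of (u r) x\<bar> - y r"])
        show "continuous_on (closure {\<sigma>..<ts}) (\<lambda>r. \<bar>fun_of (u r) x\<bar> - y r)"
          using True by (simp add: closure_atLeastLessThan) (intro continuous_intros yc fc uc)
        show "r \<in> closure {\<sigma>..<ts}" using True r by (simp add: closure_atLeastLessThan)
      qed (use before in simp)
      then show ?thesis by simp
    next
      case False
      then have "r = \<sigma>" using r by simp
      then show ?thesis using fun_of_bound[of "u \<sigma>" x] by (simp add: y_def y0_def)
    qed
    \<comment> \<open>The monotonicity interval need only contain the values up to
      \<open>ts\<close>, so the shift may depend on \<open>y ts\<close>; \<open>G\<close> does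
      not.\<close>
    define r where "r = y ts + 1"
    have yr: "y q < r" if "q \<in> {\<sigma>..ts}" for q
      using y_mono[of q ts] that by (simp add: r_def)
    have "0 < r" using y1[OF ts(1)] by (simp add: r_def)
    then obtain g where g: "0 < g" "mono_on {-r<..<r} (\<lambda>s. g * s + lam * f s)"
      using f(2) by blast
    let ?\<gamma> = "g / m"
    let ?i = "\<lambda>q. exp (- (?\<gamma> * (ts - q))) * ((?\<gamma> + G) * y q)"
    define w where "w q x = (lam * f (fun_of (u q) x) + h (\<alpha> \<sigma> u q)) / b (u q) + ?\<gamma> * fun_of (u q) x" for q x
    have wc: "continuous_on S (w q)" and wl: "F \<sigma> u q + ?\<gamma> *\<^sub>R h10_to_l2 (u q) = to_l2 (w q)" for q S
    proof -
      have bq: "b (u q) \<noteq> 0" using b_bounds(3)[of "u q"] by simp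
      show "continuous_on S (w q)"
        unfolding w_def[abs_def]
        by (intro continuous_intros continuous_on_compose2[OF f(1)] fun_of_continuous) (simp_all add: bq)
      have s: "sq_integrable (\<lambda>x. (lam * f (fun_of (u q) x) + h (\<alpha> \<sigma> u q)) / b (u q))"
        by (intro sq_integrable_continuous continuous_intros continuous_on_compose2[OF f(1)] fun_of_continuous)
           (simp_all add: bq)
      show "F \<sigma> u q + ?\<gamma> *\<^sub>R h10_to_l2 (u q) = to_l2 (w q)"
        unfolding w_def[abs_def] reaction_def h10_to_l2_def
        by (simp only: to_l2_add[OF s sq_integrable_scale[OF fun_of_sq_integrable]] to_l2_scale[OF fun_of_sq_integrable])
    qed
    have wb: "\<bar>w q x\<bar> \<le> (?\<gamma> + G) * y q" if q: "q \<in> {\<sigma>..ts}" for q x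
    proof -
      have yq: "1 \<le> y q" using y1 q by simp
      have "\<bar>w q x\<bar> \<le> ?\<gamma> * y q + (lam * (D * y q + \<bar>C1\<bar>) + H) / m"
        unfolding w_def
        by (rule shifted_reaction_le[OF g upto[OF q] _ yr[OF q] b_bounds(1) h_le]) (use yq in simp)
      also have "(lam * (D * y q + \<bar>C1\<bar>) + H) / m \<le> G * y q"
      proof -
        have "\<bar>C1\<bar> * 1 \<le> \<bar>C1\<bar> * y q" "H * 1 \<le> H * y q"
          using yq H_nonneg by (intro mult_left_mono; simp)+
        then have "D * y q + \<bar>C1\<bar> \<le> (D + \<bar>C1\<bar>) * y q" "H \<le> H * y q" by (simp_all add: distrib_right)
        then have "lam * (D * y q + \<bar>C1\<bar>) + H \<le> lam * ((D + \<bar>C1\<bar>) * y q) + H * y q"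
          using lam by (intro add_mono mult_left_mono) auto
        then have "(lam * (D * y q + \<bar>C1\<bar>) + H) / m \<le> (lam * ((D + \<bar>C1\<bar>) * y q) + H * y q) / m"
          using m by (intro divide_right_mono) auto
        then show ?thesis by (simp add: G_def algebra_simps)
      qed
      finally show ?thesis by (simp add: distrib_right)
    qed
    \<comment> \<open>The head start 1 after the decay of the shifted semigroup: it shrinks but
      stays positive.\<close>
    define \<eta> where "\<eta> = exp (- (?\<gamma> * (ts - \<sigma>)))"
    have int: "((\<lambda>q. ?i q) has_integral y ts - \<eta> * y0) {\<sigma>..ts}"
    proof -
      have "((\<lambda>q. ?i q) has_integral
          exp (- (?\<gamma> * (ts - ts))) * y ts - exp (- (?\<gamma> * (ts - \<sigma>))) * y \<sigma>) {\<sigma>..ts}"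
      proof (rule fundamental_theorem_of_calculus[OF ts(1)])
        fix q assume "q \<in> {\<sigma>..ts}"
        have "((\<lambda>q. exp (- (c * (ts - q))) * y q) has_real_derivative exp (- (c * (ts - q))) * ((c + G) * y q)) (at q within {\<sigma>..ts})" for c
          unfolding y_def[abs_def] by (auto intro!: derivative_eq_intros simp: algebra_simps)
        then show "((\<lambda>q. exp (- (?\<gamma> * (ts - q))) * y q) has_vector_derivative ?i q) (at q within {\<sigma>..ts})"
          unfolding has_real_derivative_iff_has_vector_derivative .
      qed
      then show ?thesis by (simp add: \<eta>_def y_def)
    qed
    have at_ts: "\<bar>fun_of (u ts) x\<bar> \<le> y ts - \<eta>" for x
    proof -
      have "\<bar>fun_of (u ts) x\<bar> \<le> exp (- (?\<gamma> * (ts - \<sigma>))) * norm (u \<sigma>) +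
          integral {\<sigma>..ts} (\<lambda>q. ?i q)"
      proof (rule duhamel_sup_bound[OF ts(1) continuous_on_reaction[OF uc] uc])
        show "duhamel (F \<sigma> u) \<sigma> q u" if "q \<in> {\<sigma>..ts}" for q by (rule d) (use that ts in auto)
        show "continuous_on {\<sigma>..ts} (\<lambda>q. (?\<gamma> + G) * y q)" by (intro continuous_intros yc)
      qed (use wl wc wb fun_of_bound in auto)
      also have "\<dots> = y ts - \<eta>" unfolding integral_unique[OF int] \<eta>_def[symmetric] y0_def by (simp add: algebra_simps)
      finally show ?thesis .
    qed
    have \<eta>: "0 < \<eta>" by (simp add: \<eta>_def)
    obtain e where e: "0 < e" "\<And>q. q \<in> {\<sigma>..<T} \<Longrightarrow> \<bar>q - ts\<bar> < e \<Longrightarrow> norm (u q - u ts) < \<eta>"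
      using u \<eta> ts unfolding continuous_on_iff dist_norm real_norm_def by (metis atLeastLessThan_iff)
    have "ts + e \<le> Inf Z"
    proof (rule cInf_greatest)
      fix q assume q: "q \<in> Z"
      show "ts + e \<le> q"
      proof (rule ccontr)
        assume "\<not> ts + e \<le> q"
        moreover have "ts \<le> q" unfolding ts_def by (rule cInf_lower[OF q Zb])
        ultimately have "norm (u q - u ts) < \<eta>" using q by (intro e(2)) (auto simp: Z_def)
        then have "\<bar>fun_of (u q) x - fun_of (u ts) x\<bar> < \<eta>" for x
          using fun_of_bound[of "u q - u ts" x] unfolding fun_of_diff by linarith
        note close = this
        obtain x where "y q < \<bar>fun_of (u q) x\<bar>" using q unfolding Z_def by blast
        then show False using close[of x] at_ts[of x] y_mono[OF \<open>ts \<le> q\<close>] by linarith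
      qed
    qed (use \<open>t \<in> Z\<close> in auto)
    then show False using e(1) by (simp add: ts_def)
  qed
  then show thesis by (rule that)
qed

text \<open>A bound on the values of \<open>u\<close> already bounds the forcing in L^2, hence the
  tails uniformly up to \<open>T\<close>. Each coefficient, times its exponential, is Lipschitz on
  the half-open interval and so has a limit at \<open>T\<close>; uniform tails upgrade this to a
  limit in H^1_0.\<close>

lemma extend_closed:
  assumes u: "continuous_on {\<sigma>..<T} u"
    and d: "\<And>t. t \<in> {\<sigma>..<T} \<Longrightarrow> duhamel (F \<sigma> u) \<sigma> t u" and T: "\<sigma> < T"
  obtains u' where "continuous_on {\<sigma>..T} u'" "\<And>t. t \<in> {\<sigma>..<T} \<Longrightarrow> u' t = u t"
    "\<And>t. t \<in> {\<sigma>..T} \<Longrightarrow> duhamel (F \<sigma> u') \<sigma> t u'"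
proof -
  let ?S = "{\<sigma>..<T}"
  let ?\<FF> = "at T within ?S"
  obtain K where K: "\<And>t x. t \<in> ?S \<Longrightarrow> \<bar>fun_of (u t) x\<bar> \<le> K"
    using a_priori_bound[OF u d T] by blast
  obtain Bf where Bf: "\<And>y. y \<in> {-K..K} \<Longrightarrow> \<bar>f y\<bar> \<le> Bf" by (rule f_bounded_Icc) blast
  define B where "B = (lam * Bf + H) / m"
  have FB: "norm (F \<sigma> u t) \<le> B" if "t \<in> ?S" for t
    unfolding reaction_eq_rhs B_def
  proof (rule norm_rhs_le)
    show "\<bar>f (fun_of (u t) x)\<bar> \<le> Bf" for x using K[OF that, of x] by (intro Bf) auto
  qed (use f(1) h_le m b_bounds(1) lam in auto)
  have Fc: "continuous_on {\<sigma>..t} (F \<sigma> u)" if "t \<in> ?S" for t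
    by (intro continuous_on_reaction continuous_on_subset[OF u]) (use that in auto)
  have c: "coef (u t) k = duhamel_coef (u \<sigma>) (F \<sigma> u) \<sigma> t k" if "t \<in> ?S" for t k
    using d[OF that] unfolding duhamel_iff_coef by blast
  have tail: "(\<Sum>k\<in>{N..<n}. h1_term (u t) k) \<le> tail_bound (u \<sigma>) B N" if "t \<in> ?S" for t N n
    unfolding c[OF that] by (rule duhamel_coef_tail[OF _ Fc[OF that]]) (use FB that in auto)
  have B0: "0 \<le> B" using FB[of \<sigma>] T norm_ge_zero[of "F \<sigma> u \<sigma>"] by (meson atLeastLessThan_iff order_refl order_trans)
  have lim: "\<exists>q. ((\<lambda>t. coef (u t) k) \<longlongrightarrow> q) ?\<FF>" for k
  proof -
    let ?L = "exp (lapl k * T) * B"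
    let ?q = "\<lambda>t. exp (lapl k * t) * coef (u t) k"
    have lip: "\<bar>?q t - ?q t'\<bar> \<le> ?L * \<bar>t - t'\<bar>"
      if t: "t \<in> ?S" "t' \<in> ?S" for t t'
    proof -
      let ?e = "max t t'"
      have e: "?e \<in> ?S" using t by auto
      have "\<bar>?q t - ?q t'\<bar> \<le> exp (lapl k * ?e) * B * \<bar>t - t'\<bar>"
        unfolding c[OF t(1)] c[OF t(2)]
        by (rule duhamel_coef_lipschitz[OF Fc[OF e]]) (use FB t in auto)
      also have "\<dots> \<le> ?L * \<bar>t - t'\<bar>"
        using e B0 lapl_pos[of k] by (intro mult_right_mono) (auto)
      finally show ?thesis .
    qed
    have L0: "0 \<le> ?L" using B0 by simp
    have "(?L)-lipschitz_on ?S ?q"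
      using lip L0 by (intro lipschitz_onI) (auto simp: dist_real_def)
    then have "uniformly_continuous_on ?S ?q" by (rule lipschitz_on_uniformly_continuous)
    moreover have "T \<in> closure ?S" using T by (simp add: closure_atLeastLessThan)
    ultimately obtain q where "(?q \<longlongrightarrow> q) ?\<FF>"
      by (rule uniformly_continuous_on_extension_at_closure) blast
    then have "((\<lambda>t. exp (- (lapl k * t)) * (?q t)) \<longlongrightarrow> exp (- (lapl k * T)) * q) ?\<FF>"
      by (intro tendsto_intros)
    then show ?thesis unfolding exp_lapl_cancel by (rule exI)
  qed
  then obtain q where q: "\<And>k. ((\<lambda>t. coef (u t) k) \<longlongrightarrow> q k) ?\<FF>" by metis
  have ne: "?\<FF> \<noteq> bot"
  proof -
    have "T islimpt ?S" using T by (simp add: islimpt_Ico)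
    then show ?thesis by (simp add: trivial_limit_within)
  qed
  have "\<forall>\<^sub>F t in ?\<FF>. \<forall>N n. (\<Sum>k\<in>{N..<n}. h1_term (u t) k) \<le> tail_bound (u \<sigma>) B N"
    using tail by (auto simp: eventually_at_filter)
  from h10_tail_convergence[OF ne tail_bound_tendsto this q]
  obtain v where v: "(u \<longlongrightarrow> v) ?\<FF>" by metis
  define u' where "u' t = (if t < T then u t else v)" for t
  have agree: "u' t = u t" if "t \<in> ?S" for t using that by (simp add: u'_def)
  have u'c: "continuous_on {\<sigma>..T} u'"
    unfolding continuous_on_def
  proof
    fix t assume t: "t \<in> {\<sigma>..T}"
    have "(u' \<longlongrightarrow> u' t) (at t within ?S)"
    proof (cases "t = T")
      case True
      have "(u' \<longlongrightarrow> v) ?\<FF>"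
        by (rule Lim_transform_eventually[OF v]) (auto simp: eventually_at_filter u'_def)
      then show ?thesis using True by (simp add: u'_def)
    next
      case False
      then have "t \<in> ?S" using t by auto
      moreover have "continuous_on ?S u'"
        using u by (rule continuous_on_cong[THEN iffD1, rotated -1]) (simp_all add: agree)
      ultimately show ?thesis by (simp add: continuous_on_def)
    qed
    moreover have "at t within {\<sigma>..T} = at t within ?S"
    proof (cases "t = T")
      case True
      have "{\<sigma>..T} - {T} = ?S - {T}" by auto
      then show ?thesis using True by (simp add: at_within_def)
    next
      case False
      then show ?thesis using t by (intro at_within_nhd[where S = "{..<T}"]) auto
    qed
    ultimately show "(u' \<longlongrightarrow> u' t) (at t within {\<sigma>..T})" by simp
  qed
  have d': "duhamel (F \<sigma> u') \<sigma> t u'" if t: "t \<in> ?S" for t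
    using d[OF t] duhamel_reaction_cong[of \<sigma> t u' u] t agree by auto
  have dT: "duhamel (F \<sigma> u') \<sigma> T u'"
    unfolding duhamel_iff_coef
  proof
    fix k
    have cl: "closure ?S = {\<sigma>..T}" using T by (simp add: closure_atLeastLessThan)
    \<comment> \<open>Both sides are continuous on the closed interval once \<open>u'\<close> is,
      and they agree before \<open>T\<close>.\<close>
    have "coef (u' T) k - duhamel_coef (u' \<sigma>) (F \<sigma> u') \<sigma> T k = 0"
    proof (rule continuous_constant_on_closure[where S = ?S and f = "\<lambda>t. coef (u' t) k - duhamel_coef (u' \<sigma>) (F \<sigma> u') \<sigma> t k"])
      show "continuous_on (closure ?S) (\<lambda>t. coef (u' t) k - duhamel_coef (u' \<sigma>) (F \<sigma> u') \<sigma> t k)"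
        unfolding cl coef_def
        by (intro continuous_intros continuous_on_duhamel_coef continuous_on_reaction u'c
            bounded_linear.continuous_on[OF bounded_linear_h10_to_l2])
      show "coef (u' t) k - duhamel_coef (u' \<sigma>) (F \<sigma> u') \<sigma> t k = 0" if "t \<in> ?S" for t
        using d'[OF that] unfolding duhamel_iff_coef by simp
      show "T \<in> closure ?S" unfolding cl using T by simp
    qed
    then show "coef (u' T) k = duhamel_coef (u' \<sigma>) (F \<sigma> u') \<sigma> T k" by simp
  qed
  show thesis
  proof (rule that[OF u'c agree])
    fix t assume "t \<in> {\<sigma>..T}"
    then show "duhamel (F \<sigma> u') \<sigma> t u'"
      using d'[of t] dT by (cases "t = T") auto
  qed
qed

text \<open>The problem is restarted at \<open>T\<close> with the clock value reached there. The
  clock of the glued function is then the clock of the restarted one, and the coefficient formula is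
  additive in time.\<close>

lemma extend_right:
  assumes u: "continuous_on {\<sigma>..T} u"
    and d: "\<And>t. t \<in> {\<sigma>..T} \<Longrightarrow> duhamel (F \<sigma> u) \<sigma> t u" and T: "\<sigma> \<le> T"
  obtains \<delta> u' where "0 < \<delta>" "continuous_on {\<sigma>..T+\<delta>} u'" "\<And>t. t \<in> {\<sigma>..T} \<Longrightarrow> u' t = u t"
    "\<And>t. t \<in> {\<sigma>..T+\<delta>} \<Longrightarrow> duhamel (F \<sigma> u') \<sigma> t u'"
proof -
  obtain \<delta> z where \<delta>: "0 < \<delta>" and z: "continuous_on {T..T+\<delta>} z" "z T = u T"
    and dz: "\<And>t. t \<in> {T..T+\<delta>} \<Longrightarrow> duhamel (\<lambda>r. rhs lam f h b (z r) (\<alpha> \<sigma> u T + integral {T..r} (\<lambda>q. b (z q)))) T t z"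
    using local_existence[of T "u T" "\<alpha> \<sigma> u T"] by blast
  define u' where "u' t = (if t \<le> T then u t else z t)" for t
  have agree: "u' t = u t" if "t \<in> {\<sigma>..T}" for t using that by (simp add: u'_def)
  have agree_z: "u' t = z t" if "t \<in> {T..T+\<delta>}" for t using that z(2) by (auto simp: u'_def)
  have "continuous_on ({\<sigma>..T} \<union> {T..T+\<delta>}) u'"
  proof (rule continuous_on_closed_Un)
    show "continuous_on {\<sigma>..T} u'"
      using u by (rule continuous_on_cong[THEN iffD1, rotated -1]) (simp_all add: agree)
    show "continuous_on {T..T+\<delta>} u'"
      using z(1) by (rule continuous_on_cong[THEN iffD1, rotated -1]) (simp_all add: agree_z)
  qed auto
  moreover have "{\<sigma>..T} \<union> {T..T+\<delta>} = {\<sigma>..T+\<delta>}" using T \<delta> by auto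
  ultimately have u'c: "continuous_on {\<sigma>..T+\<delta>} u'" by simp
  have d1: "duhamel (F \<sigma> u') \<sigma> t u'" if t: "t \<in> {\<sigma>..T}" for t
    using d[OF t] duhamel_reaction_cong[of \<sigma> t u' u] t agree by auto
  have tc: "\<alpha> \<sigma> u' r = \<alpha> \<sigma> u T + integral {T..r} (\<lambda>q. b (z q))" if r: "r \<in> {T..T+\<delta>}" for r
  proof -
    have "integral {\<sigma>..T} (\<lambda>q. b (u' q)) + integral {T..r} (\<lambda>q. b (u' q)) = integral {\<sigma>..r} (\<lambda>q. b (u' q))"
      using r T by (intro integral_combine_Icc integrable_continuous_real
          continuous_on_b_comp continuous_on_subset[OF u'c]) auto
    moreover have "integral {\<sigma>..T} (\<lambda>q. b (u' q)) = integral {\<sigma>..T} (\<lambda>q. b (u q))"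
      by (rule integral_cong) (simp add: agree)
    moreover have "integral {T..r} (\<lambda>q. b (u' q)) = integral {T..r} (\<lambda>q. b (z q))"
      by (rule integral_cong) (use agree_z r in auto)
    ultimately show ?thesis unfolding time_change_def by simp
  qed
  have d2: "duhamel (F \<sigma> u') T t u'" if t: "t \<in> {T..T+\<delta>}" for t
  proof -
    have "rhs lam f h b (z r) (\<alpha> \<sigma> u T + integral {T..r} (\<lambda>q. b (z q))) = F \<sigma> u' r" if "r \<in> {T..t}" for r
      unfolding reaction_eq_rhs using tc[of r] agree_z[of r] that t by auto
    then show ?thesis
      using dz[OF t] duhamel_cong[of T t _ "F \<sigma> u'" z u'] agree_z[of T] agree_z[OF t] \<delta> by auto
  qed
  show thesis
  proof (rule that[OF \<delta> u'c agree])
    fix t assume t: "t \<in> {\<sigma>..T+\<delta>}"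
    show "duhamel (F \<sigma> u') \<sigma> t u'"
    proof (cases "t \<le> T")
      case True
      then show ?thesis using d1 t by simp
    next
      case False
      show ?thesis
        by (rule duhamel_trans[OF T _ continuous_on_reaction d1 d2])
           (use False t T in \<open>auto intro: continuous_on_subset[OF u'c]\<close>)
    qed
  qed
qed

section \<open>The time change, and continuation beyond any bounded interval\<close>

lemma time_change_diff_ge:
  assumes "continuous_on {\<sigma>..t'} u" "\<sigma> \<le> t" "t \<le> t'"
  shows "m * (t' - t) \<le> \<alpha> \<sigma> u t' - \<alpha> \<sigma> u t"
proof -
  have i: "(\<lambda>q. b (u q)) integrable_on {x..t'}" if "\<sigma> \<le> x" for x
    by (intro integrable_continuous_real continuous_on_b_comp continuous_on_subset[OF assms(1)]) (use that in auto)
  have "integral {\<sigma>..t} (\<lambda>q. b (u q)) + integral {t..t'} (\<lambda>q. b (u q)) = integral {\<sigma>..t'} (\<lambda>q. b (u q))"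
    using assms i[of \<sigma>] by (intro integral_combine_Icc) auto
  moreover have "integral {t..t'} (\<lambda>q. m) \<le> integral {t..t'} (\<lambda>q. b (u q))"
    using assms by (intro integral_le i b_bounds) auto
  ultimately show ?thesis using assms by (simp add: time_change_def mult.commute)
qed

lemma inj_on_time_change:
  assumes I: "forward_interval \<sigma> I" and u: "continuous_on I u"
  shows "inj_on (\<alpha> \<sigma> u) I"
proof (rule linorder_inj_onI')
  fix s t assume st: "s \<in> I" "t \<in> I" "s < t"
  have "\<sigma> \<le> s" using I st(1) unfolding forward_interval_def by auto
  moreover have "continuous_on {\<sigma>..t} u"
    by (rule continuous_on_subset[OF u forward_interval_Icc[OF I st(2)]])
  ultimately have "m * (t - s) \<le> \<alpha> \<sigma> u t - \<alpha> \<sigma> u s" using st by (intro time_change_diff_ge) auto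
  moreover have "0 < m * (t - s)" using m st by simp
  ultimately show "\<alpha> \<sigma> u s \<noteq> \<alpha> \<sigma> u t" by simp
qed

lemma time_change_image_unbounded:
  assumes u: "continuous_on {\<sigma>..} u"
  shows "\<alpha> \<sigma> u ` {\<sigma>..} = {\<sigma>..}"
proof
  have uc: "continuous_on {\<sigma>..t} u" for t by (rule continuous_on_subset[OF u]) auto
  have a0: "\<alpha> \<sigma> u \<sigma> = \<sigma>" by (simp add: time_change_def)
  have ge: "\<sigma> + m * (t - \<sigma>) \<le> \<alpha> \<sigma> u t" if "\<sigma> \<le> t" for t
    using time_change_diff_ge[OF uc order_refl that] a0 by simp
  show "\<alpha> \<sigma> u ` {\<sigma>..} \<subseteq> {\<sigma>..}"
  proof clarsimp
    fix t assume "\<sigma> \<le> t"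
    moreover from this have "0 \<le> m * (t - \<sigma>)" using m by simp
    ultimately show "\<sigma> \<le> \<alpha> \<sigma> u t" using ge[of t] by linarith
  qed
  show "{\<sigma>..} \<subseteq> \<alpha> \<sigma> u ` {\<sigma>..}"
  proof
    fix \<tau> assume \<tau>: "\<tau> \<in> {\<sigma>..}"
    \<comment> \<open>The clock runs at speed at least \<open>m\<close>, so by this time it has
      reached \<tau>; the intermediate value theorem then finds the preimage.\<close>
    define t where "t = \<sigma> + (\<tau> - \<sigma>) / m"
    have t: "\<sigma> \<le> t" using \<tau> m by (simp add: t_def)
    have "\<tau> \<le> \<alpha> \<sigma> u t" using ge[OF t] m by (simp add: t_def)
    then obtain s where "\<sigma> \<le> s" "s \<le> t" "\<alpha> \<sigma> u s = \<tau>"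
      using IVT'[of "\<alpha> \<sigma> u" \<sigma> \<tau> t] a0 \<tau> t continuous_on_time_change[OF uc] by auto
    then show "\<tau> \<in> \<alpha> \<sigma> u ` {\<sigma>..}" by auto
  qed
qed

text \<open>A forward interval other than the half-line is bounded, hence closed or half-open at its
  supremum \<open>T\<close>. In the first case the solution is continued past \<open>T\<close>; in
  the second it suffices to add \<open>T\<close>.\<close>

lemma proper_extension:
  assumes mild: "mild_solution lam f h a l \<sigma> w0 I u" and I: "I \<noteq> {\<sigma>..}"
  obtains I' u' where "mild_solution lam f h a l \<sigma> w0 I' u'" "I \<subset> I'" "\<And>t. t \<in> I \<Longrightarrow> u' t = u t"
proof -
  have fI: "forward_interval \<sigma> I" and uI: "continuous_on I u" and u0: "u \<sigma> = w0"
    and dI: "\<And>t. t \<in> I \<Longrightarrow> duhamel (F \<sigma> u) \<sigma> t u"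
    using mild unfolding mild_solution_iff by auto
  have \<sigma>I: "\<sigma> \<in> I" "I \<subseteq> {\<sigma>..}" "I \<noteq> {\<sigma>}" using fI unfolding forward_interval_def by auto
  have "bdd_above I"
  proof (rule ccontr)
    assume nb: "\<not> bdd_above I"
    have "{\<sigma>..} \<subseteq> I"
    proof
      fix t assume t: "t \<in> {\<sigma>..}"
      obtain t' where "t' \<in> I" "t \<le> t'" using nb unfolding bdd_above_def by (meson linear)
      then show "t \<in> I" using forward_interval_Icc[OF fI] t by force
    qed
    then show False using I \<sigma>I by blast
  qed
  define T where "T = Sup I"
  have le_T: "t \<le> T" if "t \<in> I" for t unfolding T_def by (rule cSup_upper[OF that \<open>bdd_above I\<close>])
  obtain t1 where "t1 \<in> I" "t1 \<noteq> \<sigma>" using \<sigma>I by blast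
  moreover from this have "\<sigma> < t1" using \<sigma>I(2) by force
  ultimately have T: "\<sigma> < T" using le_T by force
  have inI: "t \<in> I" if lt: "\<sigma> \<le> t" "t < T" for t
  proof -
    obtain t' where "t' \<in> I" "t < t'"
      using less_cSup_iff[of I t] lt(2) \<sigma>I(1) \<open>bdd_above I\<close> unfolding T_def by auto
    then show ?thesis using forward_interval_Icc[OF fI \<open>t' \<in> I\<close>] lt(1) by auto
  qed
  have fwd: "forward_interval \<sigma> {\<sigma>..e}" if "\<sigma> < e" for e
  proof -
    have "e \<in> {\<sigma>..e}" "e \<noteq> \<sigma>" using that by auto
    then have "{\<sigma>..e} \<noteq> {\<sigma>}" by blast
    then show ?thesis using that unfolding forward_interval_def by (simp add: is_interval_cc)
  qed
  show thesis
  proof (cases "T \<in> I")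
    case True
    have II: "I = {\<sigma>..T}"
    proof (rule equalityI; rule subsetI)
      show "t \<in> {\<sigma>..T}" if "t \<in> I" for t using le_T[OF that] \<sigma>I(2) that by auto
      show "t \<in> I" if "t \<in> {\<sigma>..T}" for t using inI[of t] True that by (cases "t = T") auto
    qed
    obtain \<delta> u' where u': "0 < \<delta>" "continuous_on {\<sigma>..T+\<delta>} u'" "\<And>t. t \<in> {\<sigma>..T} \<Longrightarrow> u' t = u t"
      "\<And>t. t \<in> {\<sigma>..T+\<delta>} \<Longrightarrow> duhamel (F \<sigma> u') \<sigma> t u'"
      using extend_right[of \<sigma> T u] uI dI T unfolding II by auto
    have "T + \<delta> \<in> {\<sigma>..T+\<delta>}" "T + \<delta> \<notin> I" using u'(1) T II by auto
    then have "I \<subset> {\<sigma>..T+\<delta>}" using u'(1) II by auto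
    moreover have "mild_solution lam f h a l \<sigma> w0 {\<sigma>..T+\<delta>} u'"
      unfolding mild_solution_iff using u' u0 T fwd[of "T + \<delta>"] by auto
    ultimately show thesis using u'(3) II that by blast
  next
    case False
    have II: "I = {\<sigma>..<T}"
    proof (rule equalityI; rule subsetI)
      show "t \<in> {\<sigma>..<T}" if "t \<in> I" for t
      proof -
        have "t \<noteq> T" using False that by blast
        then show ?thesis using le_T[OF that] \<sigma>I(2) that by auto
      qed
      show "t \<in> I" if "t \<in> {\<sigma>..<T}" for t using inI[of t] that by simp
    qed
    obtain u' where u': "continuous_on {\<sigma>..T} u'" "\<And>t. t \<in> {\<sigma>..<T} \<Longrightarrow> u' t = u t"
      "\<And>t. t \<in> {\<sigma>..T} \<Longrightarrow> duhamel (F \<sigma> u') \<sigma> t u'"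
      using extend_closed[of \<sigma> T u] uI dI T unfolding II by blast
    have "T \<in> {\<sigma>..T}" using T by simp
    then have "I \<subset> {\<sigma>..T}" using False II by auto
    moreover have "mild_solution lam f h a l \<sigma> w0 {\<sigma>..T} u'"
      unfolding mild_solution_iff using u' u0 T fwd[of T] by auto
    ultimately show thesis using u'(2) II that by blast
  qed
qed

end

theorem corollary4p7:
  fixes lam m M C0 C1 \<sigma> :: real
    and a h f :: "real \<Rightarrow> real"
    and l :: "h10 \<Rightarrow> real"
    and w0 :: h10
    and J :: "real set"
    and w :: "real \<Rightarrow> h10"
  assumes lam: "0 < lam"
    and mM: "0 < m" "0 < M"
    and a: "continuous_on {0..} a" "a \<in> {0..} \<rightarrow> {m..M}"
    and l: "continuous_on UNIV l" "\<And>v. 0 \<le> l v"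
    and h: "continuous_on UNIV h" "bounded (range h)"
    and f: "continuous_on UNIV f"
      "\<And>r. 0 < r \<Longrightarrow> \<exists>\<gamma>>0. mono_on {-r<..<r} (\<lambda>s. \<gamma> * s + lam * f s)"
    and growth: "\<And>\<nu> u. \<nu> \<in> {m / lam, M / lam} \<Longrightarrow> u * f u \<le> - \<nu> * C0 * u\<^sup>2 + \<bar>u\<bar> * C1"
    and w: "maximal_quasilinear_solution lam f h a l \<sigma> w0 J w"
  shows "J = {\<sigma>..}"
proof -
  have "y * f y \<le> - (m / lam) * C0 * y\<^sup>2 + \<bar>y\<bar> * C1" for y
    by (rule growth) simp
  then interpret quasilinear_problem lam m M C0 C1 a h f l
    using lam mM a l h f by unfold_locales
  obtain I u where mild: "mild_solution lam f h a l \<sigma> w0 I u"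
    and J: "J = \<alpha> \<sigma> u ` I" and wu: "\<And>t. t \<in> I \<Longrightarrow> w (\<alpha> \<sigma> u t) = u t"
    using w unfolding maximal_quasilinear_solution_def quasilinear_solution_def by blast
  have "I = {\<sigma>..}"
  proof (rule ccontr)
    assume "I \<noteq> {\<sigma>..}"
    then obtain I' u' where mild': "mild_solution lam f h a l \<sigma> w0 I' u'"
      and II': "I \<subset> I'" and agree: "\<And>t. t \<in> I \<Longrightarrow> u' t = u t"
      using proper_extension[OF mild] by blast
    have fI: "forward_interval \<sigma> I" using mild unfolding mild_solution_iff by blast
    have inj: "inj_on (\<alpha> \<sigma> u') I'"
      using mild' unfolding mild_solution_iff by (blast intro: inj_on_time_change)
    have \<alpha>: "\<alpha> \<sigma> u' t = \<alpha> \<sigma> u t" if "t \<in> I" for t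
      using forward_interval_Icc[OF fI that] agree by (intro time_change_cong) blast
    have J': "J = \<alpha> \<sigma> u' ` I" unfolding J by (rule image_cong) (simp_all add: \<alpha>)
    \<comment> \<open>The extension has to be expressed in \<tau>; injectivity of the extended clock
      on \<open>I'\<close> makes the inverse legitimate.\<close>
    define w' where "w' \<tau> = u' (inv_into I' (\<alpha> \<sigma> u') \<tau>)" for \<tau>
    have w': "w' (\<alpha> \<sigma> u' t) = u' t" if "t \<in> I'" for t
      unfolding w'_def using inj that by simp
    have "quasilinear_solution lam f h a l \<sigma> w0 (\<alpha> \<sigma> u' ` I') w'"
      unfolding quasilinear_solution_def using mild' w' by blast
    moreover have "J \<subseteq> \<alpha> \<sigma> u' ` I'" unfolding J' using II' by blast
    moreover have "\<forall>\<tau>\<in>J. w' \<tau> = w \<tau>"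
    proof
      fix \<tau> assume "\<tau> \<in> J"
      then obtain t where t: "t \<in> I" "\<tau> = \<alpha> \<sigma> u' t" unfolding J' by blast
      then have "w' \<tau> = u' t" using w' II' by blast
      then show "w' \<tau> = w \<tau>" using wu[OF t(1)] agree[OF t(1)] \<alpha>[OF t(1)] t(2) by simp
    qed
    ultimately have "\<alpha> \<sigma> u' ` I' = J"
      using w unfolding maximal_quasilinear_solution_def by blast
    \<comment> \<open>Equal images under an injective clock come from equal intervals, so a proper
      extension in t would be one in \<tau>.\<close>
    then have "I' = I" using inj II' unfolding J' by (simp add: inj_on_image_eq_iff psubset_imp_subset)
    then show False using II' by blast
  qed
  moreover from this have "continuous_on {\<sigma>..} u" using mild unfolding mild_solution_iff by blast
  ultimately show ?thesis using J time_change_image_unbounded by simp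
qed

end
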